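(* Let $X_e=(X_1,X_2,X_3)\in\mathcal M$ be an equilateral configuration of three point vortices on the hyperbolic plane with nonzero real vorticities $\Gamma_1,\Gamma_2,\Gamma_3$ and momentum value $\mu=\mathbf J(X_e)=\Gamma_1X_1+\Gamma_2X_2+\Gamma_3X_3$. Then $X_e$ is $SL(2,\mathbb{R})_\mu$-stable if $$\sum_{i\ne j}\Gamma_i\Gamma_j>0.$$ However, if $$\sum_{i\ne j}\Gamma_i\Gamma_j<0,$$ then $X_e$ is $SL(2,\mathbb{R})$-unstable.
   Context: On $\mathbb{R}^3$ let $\langle X_1,X_2\rangle_{\mathcal H}=x_1x_2+y_1y_2-z_1z_2$ and $X_1\times_{\mathcal H}X_2=(y_1z_2-z_1y_2,\ z_1x_2-x_1z_2,\ -x_1y_2+y_1x_2)$. The hyperbolic plane is $\mathcal H_2=\{(x,y,z)\in\mathbb{R}^3\mid z^2-x^2-y^2=1,\ z>0\}$ with the metric $dx^2+dy^2-dz^2$, whose distance satisfies $\langle X_1,X_2\rangle_{\mathcal H}=-\cosh d(X_1,X_2)$. The phase space is $\mathcal M=\mathcal H_2^3\setminus\Delta$, where $\Delta$ is the set of configurations in which two or more points coincide. The dynamics is $$\dot X_r=\frac1\pi\sum_{p\ne r}\Gamma_p\frac{X_p\times_{\mathcal H}X_r}{\langle X_r,X_p\rangle_{\mathcal H}^2-1},\qquad r=1,2,3.$$ The group $SL(2,\mathbb{R})$ acts on $\mathbb{R}^3$ by conjugation $\rho\mapsto g\rho g^{-1}$ under the identification $(x,y,z)\leftrightarrow\begin{pmatrix}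 x & y+z \\ y-z & -x \end{pmatrix}$; this preserves $\mathcal H_2$ and acts diagonally on $\mathcal M$. $SL(2,\mathbb{R})_\mu$ is the isotropy subgroup of $\mu\in\mathbb{R}^3$. A configuration is equilateral if its three mutual hyperbolic distances are equal. A point $X_e\in\mathcal M$ is a relative equilibrium if the trajectory through it is contained in its $SL(2,\mathbb{R})$-orbit; every equilateral configuration is a relative equilibrium. For a subgroup $G'\subseteq SL(2,\mathbb{R})$, a relative equilibrium $X_e$ is $G'$-stable if for every $G'$-invariant open neighbourhood $V$ of $X_e$ there is a $G'$-invariant open neighbourhood $U$ of $X_e$ such that every trajectory intersecting $U$ lies entirely within $V$; it is $G'$-unstable if it is not $G'$-stable. *)

theory Defs
  imports "HOL-Analysis.Analysis"
begin

definition hyp_inner :: "real^3 \<Rightarrow> real^3 \<Rightarrow> real" where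
  "hyp_inner X Y = X$1 * Y$1 + X$2 * Y$2 - X$3 * Y$3"

definition hyp_cross :: "real^3 \<Rightarrow> real^3 \<Rightarrow> real^3" where
  "hyp_cross X Y =
     vector [X$2 * Y$3 - X$3 * Y$2, X$3 * Y$1 - X$1 * Y$3, - X$1 * Y$2 + X$2 * Y$1]"

definition hyp_plane :: "(real^3) set" where
  "hyp_plane = {X. (X$3)\<^sup>2 - (X$1)\<^sup>2 - (X$2)\<^sup>2 = 1 \<and> X$3 > 0}"

text \<open>The geodesic distance of the hyperboloid model in closed form;
  \<open>cosh_hyp_dist\<close> below shows that it is the nonnegative solution \<open>d\<close> of
  \<open>hyp_inner X Y = - cosh d\<close>.\<close>

definition hyp_dist :: "real^3 \<Rightarrow> real^3 \<Rightarrow> real" where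
  "hyp_dist X Y = arcosh (- hyp_inner X Y)"

lemma hyp_inner_le_minus_one:
  assumes "X \<in> hyp_plane" "Y \<in> hyp_plane"
  shows "hyp_inner X Y \<le> -1"
proof -
  let ?a = "X$1" and ?b = "X$2" and ?c = "X$3"
  let ?p = "Y$1" and ?q = "Y$2" and ?r = "Y$3"
  have X: "?c\<^sup>2 = 1 + ?a\<^sup>2 + ?b\<^sup>2" "?c > 0" and Y: "?r\<^sup>2 = 1 + ?p\<^sup>2 + ?q\<^sup>2" "?r > 0"
    using assms by (auto simp: hyp_plane_def)
  have "(?c * ?r)\<^sup>2 - (1 + ?a * ?p + ?b * ?q)\<^sup>2
      = (?a - ?p)\<^sup>2 + (?b - ?q)\<^sup>2 + (?a * ?q - ?b * ?p)\<^sup>2"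
    unfolding power_mult_distrib X Y by (simp add: power2_eq_square algebra_simps)
  then have "(1 + ?a * ?p + ?b * ?q)\<^sup>2 \<le> (?c * ?r)\<^sup>2"
    by (smt (verit) zero_le_power2)
  then have "1 + ?a * ?p + ?b * ?q \<le> ?c * ?r"
    using X(2) Y(2) by (meson mult_pos_pos less_imp_le power2_le_imp_le)
  then show ?thesis by (simp add: hyp_inner_def)
qed

lemma cosh_hyp_dist:
  assumes "X \<in> hyp_plane" "Y \<in> hyp_plane"
  shows "hyp_inner X Y = - cosh (hyp_dist X Y)" "hyp_dist X Y \<ge> 0"
  using hyp_inner_le_minus_one[OF assms]
  by (simp_all add: hyp_dist_def cosh_arcosh_real arcosh_nonneg_real)

type_synonym config = "real^3^3"

definition phase_space :: "config set" where
  "phase_space = {X. (\<forall>r. X$r \<in> hyp_plane) \<and> (\<forall>r s. r \<noteq> s \<longrightarrow> X$r \<noteq> X$s)}"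

definition equilateral :: "config \<Rightarrow> bool" where
  "equilateral X \<longleftrightarrow>
     hyp_dist (X$1) (X$2) = hyp_dist (X$2) (X$3) \<and>
     hyp_dist (X$2) (X$3) = hyp_dist (X$3) (X$1)"

definition vortex_field :: "(3 \<Rightarrow> real) \<Rightarrow> config \<Rightarrow> config" where
  "vortex_field \<Gamma> X = (\<chi> r. (1 / pi) *\<^sub>R (\<Sum>p\<in>UNIV - {r}.
     (\<Gamma> p / ((hyp_inner (X$r) (X$p))\<^sup>2 - 1)) *\<^sub>R hyp_cross (X$p) (X$r)))"

definition momentum :: "(3 \<Rightarrow> real) \<Rightarrow> config \<Rightarrow> real^3" where
  "momentum \<Gamma> X = (\<Sum>r\<in>UNIV. \<Gamma> r *\<^sub>R X$r)"

text \<open>Solutions live on open intervals, since vortices may collide in finite time. They are not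
  required to be maximal: every solution extends to a maximal one, so ``every trajectory
  meeting \<open>U\<close> stays in \<open>V\<close>'' means the same for both classes of curves.\<close>

definition trajectory :: "(3 \<Rightarrow> real) \<Rightarrow> real set \<Rightarrow> (real \<Rightarrow> config) \<Rightarrow> bool" where
  "trajectory \<Gamma> I X \<longleftrightarrow> open I \<and> is_interval I \<and>
     (\<forall>t\<in>I. X t \<in> phase_space \<and> (X has_vector_derivative vortex_field \<Gamma> (X t)) (at t))"

definition SL2 :: "(real^2^2) set" where
  "SL2 = {g. det g = 1}"

definition to_mat :: "real^3 \<Rightarrow> real^2^2" where
  "to_mat X = vector [vector [X$1, X$2 + X$3], vector [X$2 - X$3, - X$1]]"

text \<open>A left inverse of \<open>to_mat\<close>, and an inverse on traceless matrices.\<close>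

definition of_mat :: "real^2^2 \<Rightarrow> real^3" where
  "of_mat A = vector [A$1$1, (A$1$2 + A$2$1) / 2, (A$1$2 - A$2$1) / 2]"

definition sl2_act :: "real^2^2 \<Rightarrow> real^3 \<Rightarrow> real^3" where
  "sl2_act g X = of_mat (g ** to_mat X ** matrix_inv g)"

lemma of_mat_to_mat: "of_mat (to_mat X) = X"
  by (simp add: of_mat_def to_mat_def vec_eq_iff forall_3)

lemma to_mat_of_mat: "trace A = 0 \<Longrightarrow> to_mat (of_mat A) = A"
  by (simp add: of_mat_def to_mat_def vec_eq_iff forall_2 trace_def sum_2 field_simps)

lemma SL2_matrix_inv:
  assumes "g \<in> SL2"
  shows "matrix_inv g ** g = mat 1" "g ** matrix_inv g = mat 1"
proof -
  have "\<exists>h. g ** h = mat 1 \<and> h ** g = mat 1"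
    using assms invertible_det_nz[of g] by (simp add: SL2_def invertible_def)
  from someI_ex[OF this] show "matrix_inv g ** g = mat 1" "g ** matrix_inv g = mat 1"
    by (simp_all add: matrix_inv_def)
qed

lemma to_mat_sl2_act:
  assumes "g \<in> SL2"
  shows "to_mat (sl2_act g X) = g ** to_mat X ** matrix_inv g"
proof -
  have "trace (g ** to_mat X ** matrix_inv g) = trace (matrix_inv g ** (g ** to_mat X))"
    by (rule trace_mul_sym)
  also have "\<dots> = trace (to_mat X)"
    by (simp add: matrix_mul_assoc SL2_matrix_inv[OF assms])
  also have "\<dots> = 0"
    by (simp add: trace_def sum_2 to_mat_def)
  finally show ?thesis
    by (simp add: sl2_act_def to_mat_of_mat)
qed

definition sl2_act_config :: "real^2^2 \<Rightarrow> config \<Rightarrow> config" where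
  "sl2_act_config g X = (\<chi> r. sl2_act g (X$r))"

definition isotropy :: "real^3 \<Rightarrow> (real^2^2) set" where
  "isotropy \<mu> = {g \<in> SL2. sl2_act g \<mu> = \<mu>}"

definition invariant_open_nbhd :: "(real^2^2) set \<Rightarrow> config \<Rightarrow> config set \<Rightarrow> bool" where
  "invariant_open_nbhd G X V \<longleftrightarrow>
     openin (top_of_set phase_space) V \<and> X \<in> V \<and> (\<forall>g\<in>G. \<forall>Y\<in>V. sl2_act_config g Y \<in> V)"

text \<open>These notions are meant for a subgroup \<open>G\<close> of \<open>SL2\<close> and a relative
  equilibrium \<open>Xe\<close>; equilateral configurations are relative equilibria.\<close>

definition G_stable :: "(3 \<Rightarrow> real) \<Rightarrow> (real^2^2) set \<Rightarrow> config \<Rightarrow> bool" where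
  "G_stable \<Gamma> G Xe \<longleftrightarrow> (\<forall>V. invariant_open_nbhd G Xe V \<longrightarrow>
     (\<exists>U. invariant_open_nbhd G Xe U \<and>
        (\<forall>I X. trajectory \<Gamma> I X \<and> (\<exists>t\<in>I. X t \<in> U) \<longrightarrow> (\<forall>t\<in>I. X t \<in> V))))"

definition G_unstable :: "(3 \<Rightarrow> real) \<Rightarrow> (real^2^2) set \<Rightarrow> config \<Rightarrow> bool" where
  "G_unstable \<Gamma> G Xe \<longleftrightarrow> \<not> G_stable \<Gamma> G Xe"

end

theory Submission
  imports Defs
begin

text \<open>The dynamics of the shape \<open>(a, b, c)\<close>, the hyperbolic cosines of the three mutual distances,
  closes up to the sign of the oriented volume \<open>v\<close> spanned by the vortices: with
  \<open>f(x) = 1 / (x\<^sup>2 - 1)\<close> one has \<open>a' = \<Gamma>\<^sub>1 (v / \<pi>) (f(b) - f(c))\<close> and cyclically, while \<open>v\<^sup>2\<close> is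
  the Gram determinant of the shape. Equilateral shapes are fixed points, and the sign of
  \<open>\<sigma>\<^sub>2 = \<Gamma>\<^sub>1\<Gamma>\<^sub>2 + \<Gamma>\<^sub>2\<Gamma>\<^sub>3 + \<Gamma>\<^sub>3\<Gamma>\<^sub>1\<close> decides whether they are elliptic or hyperbolic.

  If \<open>\<sigma>\<^sub>2 > 0\<close>, the conserved quantities \<open>a/\<Gamma>\<^sub>1 + b/\<Gamma>\<^sub>2 + c/\<Gamma>\<^sub>3\<close> and
  \<open>F(a)/\<Gamma>\<^sub>1 + F(b)/\<Gamma>\<^sub>2 + F(c)/\<Gamma>\<^sub>3\<close>, \<open>F' = f\<close>, isolate the equilateral shape, so the shape is
  trapped. The momentum is then timelike and conserved; hence configurations with almost the same
  shape and momentum lie in a compact set and accumulate only on the orbit of the isotropy group.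

  If \<open>\<sigma>\<^sub>2 < 0\<close>, the differences \<open>d = (b - c, c - a, a - b)\<close> satisfy \<open>d' \<approx> (v f'(\<kappa>) / \<pi>) R d\<close> with
  \<open>R\<^sup>2 = - \<sigma>\<^sub>2\<close> on vectors of sum zero. Up to sign the quadratic form \<open>d \<bullet> R d\<close> is indefinite and
  grows at an exponential rate near the equilateral shape, which a trajectory confined to a
  neighbourhood of that shape cannot sustain.\<close>

subsection \<open>Existence of solutions for Lipschitz fields\<close>

text \<open>Inequalities alone do not refute stability: the growth argument needs an actual
  trajectory that lives long enough, although vortices might collide early. The supposed stability
  itself removes this obstacle. A confined trajectory keeps its mutual distances bounded below,
  which bounds its speed and lets it be continued to any prescribed time.

  The matrix is R d = (\<open>\<Gamma> 2\<close> d2 - \<open>\<Gamma> 3\<close> d3,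
  \<open>\<Gamma> 3\<close> d3 - \<open>\<Gamma> 1\<close> d1, \<open>\<Gamma> 1\<close> d1 -
  \<open>\<Gamma> 2\<close> d2). Along d' = m R d the derivative of d . R d is m (|R d|^2 -
  \<open>sigma2 \<Gamma>\<close> |d|^2), of one sign when \<open>sigma2 \<Gamma>\<close> is
  negative. One quadratic function thus replaces eigenvectors and invariant manifolds, and tolerates
  small relative errors.

  In the stable case \<open>sigma2 \<Gamma>\<close> appears as a determinant: after rescaling
  deviations by the vorticities, the second variation of the conserved energy is a multiple of the
  sum of \<open>\<Gamma> i\<close> y_i^2 on the plane y_1 + y_2 + y_3 = 0, whose determinant is
  \<open>sigma2 \<Gamma>\<close>. A positive value makes this form definite.\<close>

lemma picard_lindelof:
  fixes F :: "'a::euclidean_space \<Rightarrow> 'a"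
  assumes lip: "\<And>x y. norm (F x - F y) \<le> L * norm (x - y)" and L: "L > 0"
  obtains X where "X 0 = x0" "continuous_on {0..T} X"
    "\<And>t. t \<in> {0<..<T} \<Longrightarrow> (X has_vector_derivative F (X t)) (at t)"
proof -
  have "L-lipschitz_on UNIV F"
    using lip L by (auto simp: lipschitz_on_def dist_norm)
  then have contF: "continuous_on UNIV F"
    by (rule lipschitz_on_continuous_on)
  define step :: "(real \<Rightarrow> 'a) \<Rightarrow> real \<Rightarrow> 'a"
    where "step X = (\<lambda>t. x0 + integral {0..t} (\<lambda>s. F (X s)))" for X
  define \<phi> where "\<phi> n = (step ^^ n) (\<lambda>_. x0)" for n
  have \<phi>_Suc: "\<phi> (Suc n) t = x0 + integral {0..t} (\<lambda>s. F (\<phi> n s))" for n t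
    by (simp add: \<phi>_def step_def)
  have contFX: "continuous_on {0..T} (\<lambda>s. F (X s))" if "continuous_on {0..T} X" for X
    using continuous_on_compose2[OF contF that] by simp
  have cont_step: "continuous_on {0..T} (\<lambda>t. x0 + integral {0..t} (\<lambda>s. F (X s)))"
    if "continuous_on {0..T} X" for X
    by (intro continuous_intros indefinite_integral_continuous_1 integrable_continuous_real
        contFX that)
  have cont\<phi>: "continuous_on {0..T} (\<phi> n)" for n
  proof (induction n)
    case 0 then show ?case by (simp add: \<phi>_def)
  next
    case (Suc n)
    have "\<phi> (Suc n) = (\<lambda>t. x0 + integral {0..t} (\<lambda>s. F (\<phi> n s)))"
      by (rule ext) (simp add: \<phi>_Suc)
    then show ?case using cont_step[OF Suc] by simp
  qed
  have intble: "(\<lambda>s. F (X s)) integrable_on {0..t}" if "continuous_on {0..T} X" "t \<le> T" for X t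
    using integrable_continuous_real[OF continuous_on_subset[OF contFX[OF that(1)]]] that(2) by auto
  define C where "C = norm (F x0) * \<bar>T\<bar>"
  \<comment> \<open>Measured against the weight exp (2 L t), the Picard map contracts by 1/2 on all
    of [0, T], however large T is, so no short-time solutions have to be glued.\<close>
  have int_exp: "((\<lambda>s. L * (K * exp (2 * L * s))) has_integral K / 2 * (exp (2 * L * t) - 1)) {0..t}"
    if "t \<ge> 0" for K t
  proof -
    have "((\<lambda>s. L * (K * exp (2 * L * s))) has_integral
       K / 2 * exp (2 * L * t) - K / 2 * exp (2 * L * 0)) {0..t}"
      using that by (intro fundamental_theorem_of_calculus)
        (auto intro!: derivative_eq_intros simp: has_real_derivative_iff_has_vector_derivative[symmetric])
    then show ?thesis by (simp add: algebra_simps)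
  qed
  have contract: "norm (integral {0..t} (\<lambda>s. F (X s)) - integral {0..t} (\<lambda>s. F (Y s)))
      \<le> K / 2 * exp (2 * L * t)"
    if "continuous_on {0..T} X" "continuous_on {0..T} Y" "t \<in> {0..T}"
      "\<And>s. s \<in> {0..T} \<Longrightarrow> norm (X s - Y s) \<le> K * exp (2 * L * s)" for X Y K t
  proof -
    have "norm (X 0 - Y 0) \<le> K" using that(4)[of 0] that(3) by simp
    then have "K \<ge> 0" using norm_ge_zero order_trans by blast
    have "norm (integral {0..t} (\<lambda>s. F (X s)) - integral {0..t} (\<lambda>s. F (Y s)))
      = norm (integral {0..t} (\<lambda>s. F (X s) - F (Y s)))"
      using that intble by (subst Henstock_Kurzweil_Integration.integral_diff) auto
    also have "\<dots> \<le> integral {0..t} (\<lambda>s. L * (K * exp (2 * L * s)))"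
    proof (rule integral_norm_bound_integral)
      show "(\<lambda>s. F (X s) - F (Y s)) integrable_on {0..t}"
        using that intble by (intro integrable_diff) auto
      show "(\<lambda>s. L * (K * exp (2 * L * s))) integrable_on {0..t}"
        using int_exp[of t K] that by auto
      fix s assume "s \<in> {0..t}"
      then have "norm (X s - Y s) \<le> K * exp (2 * L * s)" using that by auto
      then show "norm (F (X s) - F (Y s)) \<le> L * (K * exp (2 * L * s))"
        using lip[of "X s" "Y s"] L by (meson mult_left_mono less_imp_le order_trans)
    qed
    also have "\<dots> = K / 2 * (exp (2 * L * t) - 1)"
      by (rule integral_unique[OF int_exp]) (use that in auto)
    also have "\<dots> \<le> K / 2 * exp (2 * L * t)" using \<open>K \<ge> 0\<close> by (simp add: algebra_simps)
    finally show ?thesis .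
  qed
  have diff: "norm (\<phi> (Suc n) t - \<phi> n t) \<le> C * (1/2)^n * exp (2 * L * t)" if "t \<in> {0..T}" for n t
    using that
  proof (induction n arbitrary: t)
    case 0
    have "\<phi> (Suc 0) t - \<phi> 0 t = t *\<^sub>R F x0"
      using 0 by (simp add: \<phi>_Suc) (simp add: \<phi>_def)
    then have "norm (\<phi> (Suc 0) t - \<phi> 0 t) = t * norm (F x0)" using 0 by simp
    also have "\<dots> \<le> C" using 0 by (auto simp: C_def mult.commute[of "norm (F x0)"] intro!: mult_right_mono)
    also have "C = C * 1" by simp
    also have "\<dots> \<le> C * exp (2 * L * t)"
      using 0 L by (intro mult_left_mono) (auto simp: C_def)
    finally show ?case by simp
  next
    case (Suc n)
    show ?case
      using contract[OF cont\<phi>[of "Suc n"] cont\<phi>[of n] Suc.prems, of "C * (1/2)^n"] Suc.IH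
      by (simp add: \<phi>_Suc[of "Suc n"] \<phi>_Suc[of n])
  qed
  define E where "E = exp (2 * L * \<bar>T\<bar>)"
  have diff': "norm (\<phi> (Suc n) t - \<phi> n t) \<le> C * E * (1/2)^n" if "t \<in> {0..T}" for n t
  proof -
    have "exp (2 * L * t) \<le> E" using that L by (auto simp: E_def)
    then have "C * (1/2)^n * exp (2 * L * t) \<le> C * (1/2)^n * E"
      by (intro mult_left_mono) (auto simp: C_def)
    then show ?thesis using diff[OF that, of n] by (simp add: mult_ac)
  qed
  have "uniform_limit {0..T} (\<lambda>n t. \<Sum>i<n. \<phi> (Suc i) t - \<phi> i t)
     (\<lambda>t. \<Sum>i. \<phi> (Suc i) t - \<phi> i t) sequentially"
    by (rule Weierstrass_m_test[OF diff']) (auto intro!: summable_mult summable_geometric)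
  then have "uniform_limit {0..T} (\<lambda>n t. x0 + (\<Sum>i<n. \<phi> (Suc i) t - \<phi> i t))
     (\<lambda>t. x0 + (\<Sum>i. \<phi> (Suc i) t - \<phi> i t)) sequentially"
    by (intro uniform_limit_intros)
  moreover have "x0 + (\<Sum>i<n. \<phi> (Suc i) t - \<phi> i t) = \<phi> n t" for n t
    using sum_lessThan_telescope[of "\<lambda>i. \<phi> i t" n] by (simp add: \<phi>_def[of 0])
  ultimately obtain X where lim: "uniform_limit {0..T} \<phi> X sequentially"
    by auto
  have contX: "continuous_on {0..T} X"
    by (rule uniform_limit_theorem[OF _ lim]) (auto simp: cont\<phi>)
  have eq: "X t = x0 + integral {0..t} (\<lambda>s. F (X s))" if t: "t \<in> {0..T}" for t
  proof -
    have l1: "(\<lambda>n. \<phi> (Suc n) t) \<longlonglongrightarrow> X t"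
      using tendsto_uniform_limitI[OF lim t] by (rule LIMSEQ_Suc)
    have "(\<lambda>n. integral {0..t} (\<lambda>s. F (\<phi> n s))) \<longlonglongrightarrow> integral {0..t} (\<lambda>s. F (X s))"
    proof (rule LIMSEQ_I)
      fix e :: real assume "e > 0"
      \<comment> \<open>One application of the Picard map costs at most a factor E / 2, so iterates
        within k of the limit give an error of at most e / 2.\<close>
      define k where "k = e / E"
      have Ep: "E > 0" by (simp add: E_def)
      have "k > 0" using \<open>e > 0\<close> Ep by (simp add: k_def)
      have "\<forall>\<^sub>F n in sequentially. \<forall>s\<in>{0..T}. dist (\<phi> n s) (X s) < k"
        using uniform_limitD[OF lim \<open>k > 0\<close>] .
      then obtain N where N: "\<And>n s. n \<ge> N \<Longrightarrow> s \<in> {0..T} \<Longrightarrow> norm (\<phi> n s - X s) < k"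
        unfolding eventually_sequentially dist_norm by blast
      have "norm (integral {0..t} (\<lambda>s. F (\<phi> n s)) - integral {0..t} (\<lambda>s. F (X s))) < e"
        if "n \<ge> N" for n
      proof -
        have "norm (\<phi> n s - X s) \<le> k * exp (2 * L * s)" if "s \<in> {0..T}" for s
        proof -
          have "k * 1 \<le> k * exp (2 * L * s)"
            using that L \<open>k > 0\<close> by (intro mult_left_mono) auto
          then show ?thesis using N[OF \<open>n \<ge> N\<close> that] by simp
        qed
        from contract[OF cont\<phi> contX t this]
        have "norm (integral {0..t} (\<lambda>s. F (\<phi> n s)) - integral {0..t} (\<lambda>s. F (X s)))
          \<le> k / 2 * exp (2 * L * t)" .
        also have "\<dots> \<le> k / 2 * E"
          using t L \<open>k > 0\<close> by (intro mult_left_mono) (auto simp: E_def)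
        also have "\<dots> < e" using \<open>e > 0\<close> Ep by (simp add: k_def)
        finally show ?thesis .
      qed
      then show "\<exists>no. \<forall>n\<ge>no. norm (integral {0..t} (\<lambda>s. F (\<phi> n s)) -
          integral {0..t} (\<lambda>s. F (X s))) < e" by blast
    qed
    then have "(\<lambda>n. \<phi> (Suc n) t) \<longlonglongrightarrow> x0 + integral {0..t} (\<lambda>s. F (X s))"
      unfolding \<phi>_Suc by (intro tendsto_intros)
    from LIMSEQ_unique[OF l1 this] show ?thesis .
  qed
  \<comment> \<open>For negative T the interval is empty and \<open>X\<close> carries no
    information, yet the initial value is promised for every T.\<close>
  define Y where "Y t = (if t \<in> {0..T} then X t else x0)" for t
  show ?thesis
  proof
    show "Y 0 = x0"
      using eq[of 0] by (auto simp: Y_def)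
    show "continuous_on {0..T} Y"
      using contX by (rule continuous_on_eq) (simp add: Y_def)
    fix t assume t: "t \<in> {0<..<T}"
    have "((\<lambda>u. integral {0..u} (\<lambda>s. F (X s))) has_vector_derivative F (X t)) (at t within {0..T})"
      by (rule integral_has_vector_derivative[OF contFX[OF contX]]) (use t in auto)
    then have "((\<lambda>u. x0 + integral {0..u} (\<lambda>s. F (X s))) has_vector_derivative F (X t)) (at t within {0..T})"
      by (auto intro!: derivative_eq_intros)
    then have "(Y has_vector_derivative F (X t)) (at t within {0..T})"
      by (rule has_vector_derivative_transform[rotated 2]) (use t eq in \<open>auto simp: Y_def\<close>)
    then show "(Y has_vector_derivative F (Y t)) (at t)"
      using t at_within_Icc_at[of 0 t T] by (simp add: Y_def)
  qed
qed

subsection \<open>The hyperboloid model and the action of SL(2)\<close>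

lemma hyp_inner_commute: "hyp_inner X Y = hyp_inner Y X"
  by (simp add: hyp_inner_def mult.commute)

lemma hyp_inner_simps:
  "hyp_inner (X + Y) Z = hyp_inner X Z + hyp_inner Y Z"
  "hyp_inner Z (X + Y) = hyp_inner Z X + hyp_inner Z Y"
  "hyp_inner (- X) Z = - hyp_inner X Z"
  "hyp_inner (X - Y) Z = hyp_inner X Z - hyp_inner Y Z"
  "hyp_inner Z (X - Y) = hyp_inner Z X - hyp_inner Z Y"
  "hyp_inner (a *\<^sub>R X) Z = a * hyp_inner X Z"
  "hyp_inner Z (a *\<^sub>R X) = a * hyp_inner Z X"
  by (simp_all add: hyp_inner_def algebra_simps)

lemma bilinear_hyp_inner: "bounded_bilinear hyp_inner"
proof -
  have "bilinear hyp_inner"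
    by (auto simp: bilinear_def hyp_inner_simps intro!: linearI)
  then show ?thesis by (simp add: bilinear_conv_bounded_bilinear)
qed

lemmas continuous_on_hyp_inner [continuous_intros] =
  bounded_bilinear.continuous_on[OF bilinear_hyp_inner]

lemma hyp_cross_simps:
  "hyp_cross (X + Y) Z = hyp_cross X Z + hyp_cross Y Z"
  "hyp_cross Z (X + Y) = hyp_cross Z X + hyp_cross Z Y"
  "hyp_cross (a *\<^sub>R X) Z = a *\<^sub>R hyp_cross X Z"
  "hyp_cross Z (a *\<^sub>R X) = a *\<^sub>R hyp_cross Z X"
  by (simp_all add: hyp_cross_def vec_eq_iff forall_3 algebra_simps)

lemma bilinear_hyp_cross: "bounded_bilinear hyp_cross"
proof -
  have "bilinear hyp_cross"
    by (auto simp: bilinear_def hyp_cross_simps intro!: linearI)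
  then show ?thesis by (simp add: bilinear_conv_bounded_bilinear)
qed

lemmas continuous_on_hyp_cross [continuous_intros] =
  bounded_bilinear.continuous_on[OF bilinear_hyp_cross]

text \<open>The ordinary determinant of the three vectors: the sign in the third component of the
  cross product cancels the one in the form.\<close>

definition hyp_triple :: "real^3 \<Rightarrow> real^3 \<Rightarrow> real^3 \<Rightarrow> real" where
  "hyp_triple X Y Z = hyp_inner (hyp_cross X Y) Z"

lemma hyp_triple_degenerate:
  "hyp_triple X X Y = 0" "hyp_triple X Y X = 0" "hyp_triple Y X X = 0"
  by (simp_all add: hyp_triple_def hyp_inner_def hyp_cross_def algebra_simps)

text \<open>The Gram determinant for a form with matrix diag(1, 1, -1) is the squared determinant of
  the vectors times -1.\<close>

lemma hyp_triple_sq: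
  "(hyp_triple X Y Z)\<^sup>2 = - (hyp_inner X X * hyp_inner Y Y * hyp_inner Z Z
     + 2 * hyp_inner X Y * hyp_inner Y Z * hyp_inner Z X
     - hyp_inner X X * (hyp_inner Y Z)\<^sup>2 - hyp_inner Y Y * (hyp_inner Z X)\<^sup>2
     - hyp_inner Z Z * (hyp_inner X Y)\<^sup>2)"
  unfolding hyp_triple_def hyp_inner_def hyp_cross_def by simp algebra

definition gram :: "real \<Rightarrow> real \<Rightarrow> real \<Rightarrow> real" where
  "gram a b c = 1 + 2 * a * b * c - a\<^sup>2 - b\<^sup>2 - c\<^sup>2"

lemma hyp_plane_iff: "X \<in> hyp_plane \<longleftrightarrow> hyp_inner X X = -1 \<and> X$3 > 0"
  by (auto simp: hyp_plane_def hyp_inner_def power2_eq_square)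

lemma hyp_triple_sq_gram:
  assumes "X \<in> hyp_plane" "Y \<in> hyp_plane" "Z \<in> hyp_plane"
  shows "(hyp_triple X Y Z)\<^sup>2 = gram (- hyp_inner Y Z) (- hyp_inner Z X) (- hyp_inner X Y)"
  using assms unfolding hyp_triple_sq hyp_plane_iff gram_def by simp

lemma hyp_plane_coord_le:
  assumes "X \<in> hyp_plane"
  shows "X$3 \<ge> 1" "\<bar>X$i\<bar> \<le> X$3"
proof -
  have h: "(X$3)\<^sup>2 = 1 + (X$1)\<^sup>2 + (X$2)\<^sup>2" "X$3 > 0"
    using assms by (auto simp: hyp_plane_def)
  have "1\<^sup>2 \<le> (X$3)\<^sup>2" using h by simp
  then show "X$3 \<ge> 1" using h(2) by (meson less_imp_le power2_le_imp_le)
  have "(X$1)\<^sup>2 \<le> (X$3)\<^sup>2" "(X$2)\<^sup>2 \<le> (X$3)\<^sup>2" using h by simp_all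
  then have "\<bar>X$1\<bar> \<le> X$3" "\<bar>X$2\<bar> \<le> X$3" "\<bar>X$3\<bar> \<le> X$3"
    using h(2) by (auto simp: abs_le_square_iff[symmetric])
  then show "\<bar>X$i\<bar> \<le> X$3" using exhaust_3[of i] by auto
qed

lemma hyp_inner_less_minus_one:
  assumes "X \<in> hyp_plane" "Y \<in> hyp_plane" "X \<noteq> Y"
  shows "hyp_inner X Y < -1"
proof -
  have "hyp_inner X Y \<noteq> -1"
  proof
    assume e: "hyp_inner X Y = -1"
    \<comment> \<open>This combination has third coordinate zero, where the form is Euclidean; under
      \<open>e\<close> the form of it is also nonpositive, so it must vanish.\<close>
    let ?d = "Y$3 *\<^sub>R X - X$3 *\<^sub>R Y"
    have XY: "hyp_inner X X = -1" "hyp_inner Y Y = -1" "X$3 > 0" "Y$3 > 0"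
      using assms by (auto simp: hyp_plane_iff)
    have "hyp_inner ?d ?d = - (X$3 - Y$3)\<^sup>2"
      by (simp only: hyp_inner_simps XY e hyp_inner_commute[of Y X])
        (simp add: power2_eq_square algebra_simps)
    moreover have "hyp_inner ?d ?d = (?d$1)\<^sup>2 + (?d$2)\<^sup>2"
      by (simp add: hyp_inner_def power2_eq_square algebra_simps)
    ultimately have "(X$3 - Y$3)\<^sup>2 + (?d$1)\<^sup>2 + (?d$2)\<^sup>2 = 0" by linarith
    then have "X$3 = Y$3" "?d$1 = 0" "?d$2 = 0"
      by (auto simp: add_nonneg_eq_0_iff)
    then have "X = Y" using XY by (auto simp: vec_eq_iff forall_3)
    then show False using assms by simp
  qed
  then show ?thesis using hyp_inner_le_minus_one[OF assms(1,2)] by linarith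
qed

lemma hyp_inner_sq_gt_one:
  assumes "X \<in> hyp_plane" "Y \<in> hyp_plane" "X \<noteq> Y"
  shows "(hyp_inner X Y)\<^sup>2 > 1"
  using hyp_inner_less_minus_one[OF assms] one_less_power[of "- hyp_inner X Y" 2] by simp

section \<open>The action in coordinates and its invariants\<close>

definition adj2 :: "real^2^2 \<Rightarrow> real^2^2" where
  "adj2 g = vector [vector [g$2$2, - g$1$2], vector [- g$2$1, g$1$1]]"

lemma SL2_det: "g \<in> SL2 \<longleftrightarrow> g$1$1 * g$2$2 - g$1$2 * g$2$1 = 1"
  by (simp add: SL2_def det_2)

lemma adj2_mult:
  assumes "g \<in> SL2"
  shows "g ** adj2 g = mat 1" "adj2 g ** g = mat 1"
  using assms by (simp_all add: SL2_det adj2_def matrix_matrix_mult_def mat_def vec_eq_iff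
      forall_2 sum_2 algebra_simps)

lemma matrix_inv_SL2:
  assumes "g \<in> SL2"
  shows "matrix_inv g = adj2 g"
proof -
  have "matrix_inv g = matrix_inv g ** (g ** adj2 g)" using adj2_mult[OF assms] by simp
  also have "\<dots> = adj2 g" by (simp add: matrix_mul_assoc SL2_matrix_inv[OF assms])
  finally show ?thesis .
qed

text \<open>With the adjugate as inverse the action is polynomial in the entries of
  \<open>g\<close>. Invariance of form and cross product then becomes a polynomial identity modulo
  det g = 1.\<close>

lemma sl2_act_coords:
  assumes "g \<in> SL2"
  shows "sl2_act g X = vector [
     (g$1$1 * g$2$2 + g$1$2 * g$2$1) * X$1 + (g$1$2 * g$2$2 - g$1$1 * g$2$1) * X$2
       - (g$1$1 * g$2$1 + g$1$2 * g$2$2) * X$3,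
     (g$2$1 * g$2$2 - g$1$1 * g$1$2) * X$1
       + ((g$1$1)\<^sup>2 - (g$1$2)\<^sup>2 - (g$2$1)\<^sup>2 + (g$2$2)\<^sup>2) / 2 * X$2
       + ((g$1$1)\<^sup>2 + (g$1$2)\<^sup>2 - (g$2$1)\<^sup>2 - (g$2$2)\<^sup>2) / 2 * X$3,
     - (g$1$1 * g$1$2 + g$2$1 * g$2$2) * X$1
       + ((g$1$1)\<^sup>2 - (g$1$2)\<^sup>2 + (g$2$1)\<^sup>2 - (g$2$2)\<^sup>2) / 2 * X$2
       + ((g$1$1)\<^sup>2 + (g$1$2)\<^sup>2 + (g$2$1)\<^sup>2 + (g$2$2)\<^sup>2) / 2 * X$3]"
  unfolding sl2_act_def matrix_inv_SL2[OF assms]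
  by (simp add: of_mat_def to_mat_def adj2_def matrix_matrix_mult_def vec_eq_iff forall_3 sum_2
     power2_eq_square field_simps)

lemma sl2_act_linear: "linear (sl2_act g)"
proof (rule linearI)
  show "sl2_act g (X + Y) = sl2_act g X + sl2_act g Y" for X Y
    by (simp add: sl2_act_def of_mat_def to_mat_def matrix_matrix_mult_def vec_eq_iff forall_3 sum_2
        field_simps)
  show "sl2_act g (c *\<^sub>R X) = c *\<^sub>R sl2_act g X" for X c
    by (simp add: sl2_act_def of_mat_def to_mat_def matrix_matrix_mult_def vec_eq_iff forall_3 sum_2
        field_simps)
qed

lemma hyp_inner_sl2_act:
  assumes "g \<in> SL2"
  shows "hyp_inner (sl2_act g X) (sl2_act g Y) = hyp_inner X Y"
  using assms[unfolded SL2_det] unfolding sl2_act_coords[OF assms] hyp_inner_def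
  by (simp add: field_simps) algebra

lemma hyp_cross_sl2_act:
  assumes "g \<in> SL2"
  shows "hyp_cross (sl2_act g X) (sl2_act g Y) = sl2_act g (hyp_cross X Y)"
  using assms[unfolded SL2_det] unfolding sl2_act_coords[OF assms] hyp_cross_def
  by (simp add: vec_eq_iff forall_3 field_simps) (intro conjI; algebra)

lemma adj2_SL2: "g \<in> SL2 \<Longrightarrow> adj2 g \<in> SL2"
  by (simp add: SL2_det adj2_def algebra_simps)

lemma SL2_mult: "g \<in> SL2 \<Longrightarrow> h \<in> SL2 \<Longrightarrow> g ** h \<in> SL2"
  by (simp add: SL2_def det_mul)

lemma adj2_matrix_mult: "adj2 (g ** h) = adj2 h ** adj2 g"
  by (simp add: adj2_def matrix_matrix_mult_def vec_eq_iff forall_2 sum_2 algebra_simps)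

lemma to_mat_inject: "to_mat X = to_mat Y \<Longrightarrow> X = Y"
  by (metis of_mat_to_mat)

lemma sl2_act_mult:
  assumes "g \<in> SL2" "h \<in> SL2"
  shows "sl2_act (g ** h) X = sl2_act g (sl2_act h X)"
  by (rule to_mat_inject)
    (simp add: to_mat_sl2_act assms SL2_mult matrix_inv_SL2 adj2_matrix_mult matrix_mul_assoc)

lemma sl2_act_adj2:
  assumes "g \<in> SL2"
  shows "sl2_act (adj2 g) (sl2_act g X) = X"
proof -
  have "sl2_act (adj2 g) (sl2_act g X) = sl2_act (mat 1) X"
    using sl2_act_mult[OF adj2_SL2[OF assms] assms] adj2_mult[OF assms] by simp
  also have "\<dots> = X"
  proof (rule to_mat_inject)
    have "mat 1 \<in> SL2" by (simp add: SL2_def)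
    moreover have "adj2 (mat 1) = mat 1"
      by (simp add: adj2_def mat_def vec_eq_iff forall_2)
    ultimately show "to_mat (sl2_act (mat 1) X) = to_mat X"
      by (simp add: to_mat_sl2_act matrix_inv_SL2)
  qed
  finally show ?thesis .
qed

text \<open>Invariance of the form leaves open which sheet is reached. The third coordinate of the
  image is half the sum of the values of the binary form \<open>?p\<close> at the two rows of
  \<open>g\<close>, and \<open>?p\<close> is positive definite because its determinant is minus the
  form of \<open>X\<close>, that is 1.\<close>

lemma sl2_act_hyp_plane:
  assumes g: "g \<in> SL2" and X: "X \<in> hyp_plane"
  shows "sl2_act g X \<in> hyp_plane"
proof -
  let ?p = "\<lambda>a b. (X$3 + X$2) * a\<^sup>2 - 2 * X$1 * a * b + (X$3 - X$2) * b\<^sup>2"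
  have h: "(X$3)\<^sup>2 = 1 + (X$1)\<^sup>2 + (X$2)\<^sup>2" "X$3 > 0"
    using X by (auto simp: hyp_plane_def)
  have "(X$2)\<^sup>2 < (X$3)\<^sup>2" unfolding h(1) by (simp add: add_pos_nonneg)
  then have "\<bar>X$2\<bar> < \<bar>X$3\<bar>" by (metis abs_le_square_iff not_le)
  then have pos: "X$3 + X$2 > 0" "X$3 - X$2 > 0" using h(2) by linarith+
  have form: "?p a b > 0" if "(a, b) \<noteq> (0, 0)" for a b
  proof -
    have "(X$3 + X$2) * ?p a b = ((X$3 + X$2) * a - X$1 * b)\<^sup>2
        + ((X$3)\<^sup>2 - (X$1)\<^sup>2 - (X$2)\<^sup>2) * b\<^sup>2"
      by algebra
    also have "\<dots> = ((X$3 + X$2) * a - X$1 * b)\<^sup>2 + b\<^sup>2" unfolding h(1) by simp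
    also have "\<dots> > 0"
    proof (cases "b = 0")
      case True then show ?thesis using that pos by simp
    next
      case False then have "b\<^sup>2 > 0" by simp
      then show ?thesis by (meson add_nonneg_pos zero_le_power2)
    qed
    finally show ?thesis using pos(1) zero_less_mult_pos by blast
  qed
  have "(sl2_act g X)$3 = (?p (g$1$1) (g$1$2) + ?p (g$2$1) (g$2$2)) / 2"
    unfolding sl2_act_coords[OF g] vector_3 by (simp add: power2_eq_square field_simps)
  moreover have "(g$1$1, g$1$2) \<noteq> (0, 0)" "(g$2$1, g$2$2) \<noteq> (0, 0)"
    using g by (auto simp: SL2_det)
  ultimately have "(sl2_act g X)$3 > 0"
    by (metis form add_pos_pos half_gt_zero)
  then show ?thesis
    using X by (simp add: hyp_plane_iff hyp_inner_sl2_act[OF g])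
qed

section \<open>Transitivity and congruence of triples of points\<close>

lemma sl2_act_to_base:
  assumes X: "X \<in> hyp_plane"
  shows "\<exists>g\<in>SL2. sl2_act g X = vector [0, 0, 1]"
proof -
  have h: "(X$3)\<^sup>2 = 1 + (X$1)\<^sup>2 + (X$2)\<^sup>2" "X$3 > 0"
    using X by (auto simp: hyp_plane_def)
  define k where "k = 1 / sqrt (2 + 2 * X$3)"
  have k: "k\<^sup>2 * (2 + 2 * X$3) = 1"
    using h(2) by (simp add: k_def power_divide)
  \<comment> \<open>Let S be the symmetric matrix with rows (z - y, x) and (x, z + y), where (x, y,
    z) are the coordinates of \<open>X\<close>. It has determinant 1 and trace 2 z, so by
    Cayley-Hamilton \<open>g\<close> = (S + 1) / sqrt (2 + 2 z) is its square root. The action of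
    \<open>g\<close> takes the inverse of S, which represents \<open>X\<close>, to the identity,
    which represents the base point.\<close>
  define g :: "real^2^2" where
    "g = vector [vector [k * (1 - X$2 + X$3), k * X$1], vector [k * X$1, k * (1 + X$2 + X$3)]]"
  have g: "g \<in> SL2"
  proof -
    have "g$1$1 * g$2$2 - g$1$2 * g$2$1 = k\<^sup>2 * (1 + 2 * X$3 + ((X$3)\<^sup>2 - (X$1)\<^sup>2 - (X$2)\<^sup>2))"
      by (simp add: g_def power2_eq_square algebra_simps)
    then show ?thesis using k by (simp add: SL2_det h(1) algebra_simps)
  qed
  have "(sl2_act g X)$1 = k\<^sup>2 * X$1 * (1 + (X$1)\<^sup>2 + (X$2)\<^sup>2 - (X$3)\<^sup>2)"
    "(sl2_act g X)$2 = k\<^sup>2 * X$2 * (1 + (X$1)\<^sup>2 + (X$2)\<^sup>2 - (X$3)\<^sup>2)"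
    "(sl2_act g X)$3 = k\<^sup>2 * (- 2 * (1 + X$3) * ((X$1)\<^sup>2 + (X$2)\<^sup>2)
        + ((1 + X$3)\<^sup>2 + ((X$1)\<^sup>2 + (X$2)\<^sup>2)) * X$3)"
    unfolding sl2_act_coords[OF g] by (simp_all add: g_def power2_eq_square field_simps)
  moreover have "1 + (X$1)\<^sup>2 + (X$2)\<^sup>2 - (X$3)\<^sup>2 = 0" using h by simp
  moreover have "k\<^sup>2 * (- 2 * (1 + X$3) * ((X$1)\<^sup>2 + (X$2)\<^sup>2)
        + ((1 + X$3)\<^sup>2 + ((X$1)\<^sup>2 + (X$2)\<^sup>2)) * X$3) = 1"
  proof -
    have e: "(X$1)\<^sup>2 + (X$2)\<^sup>2 = (X$3)\<^sup>2 - 1" using h by simp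
    have "k\<^sup>2 * (- 2 * (1 + X$3) * ((X$3)\<^sup>2 - 1) + ((1 + X$3)\<^sup>2 + ((X$3)\<^sup>2 - 1)) * X$3)
      = k\<^sup>2 * (2 + 2 * X$3)"
      by (simp add: power2_eq_square algebra_simps)
    then show ?thesis unfolding e k .
  qed
  ultimately have "sl2_act g X = vector [0, 0, 1]"
    by (simp add: vec_eq_iff forall_3)
  with g show ?thesis by blast
qed

lemma polar_coordinates:
  fixes x y :: real
  shows "\<exists>t. x = sqrt (x\<^sup>2 + y\<^sup>2) * cos t \<and> y = sqrt (x\<^sup>2 + y\<^sup>2) * sin t"
proof (cases "x\<^sup>2 + y\<^sup>2 = 0")
  case True then show ?thesis by (auto simp: sum_power2_eq_zero_iff)
next
  case False
  then have "(x / sqrt (x\<^sup>2 + y\<^sup>2))\<^sup>2 + (y / sqrt (x\<^sup>2 + y\<^sup>2))\<^sup>2 = 1"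
    by (simp add: power_divide add_divide_distrib[symmetric])
  from sincos_total_2pi[OF this] obtain t where "x / sqrt (x\<^sup>2 + y\<^sup>2) = cos t" "y / sqrt (x\<^sup>2 + y\<^sup>2) = sin t"
    by metis
  then show ?thesis using False by (intro exI[of _ t]) (auto simp: field_simps)
qed

lemma sl2_act_rotate:
  "\<exists>g\<in>SL2. sl2_act g (vector [0, 0, 1]) = vector [0, 0, 1] \<and>
     sl2_act g W = vector [sqrt ((W$1)\<^sup>2 + (W$2)\<^sup>2), 0, W$3]"
proof -
  define w where "w = sqrt ((W$1)\<^sup>2 + (W$2)\<^sup>2)"
  obtain t where t: "W$1 = w * cos t" "W$2 = w * sin t"
    using polar_coordinates[of "W$1" "W$2"] unfolding w_def by blast
  \<comment> \<open>Half angles, since a rotation in SL(2) turns the first two coordinates by twice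
    its angle.\<close>
  define c where "c = cos (t/2)"
  define s where "s = sin (t/2)"
  have cs: "c\<^sup>2 + s\<^sup>2 = 1" by (simp add: c_def s_def)
  have dbl: "cos t = c\<^sup>2 - s\<^sup>2" "sin t = 2 * s * c"
    using cos_double[of "t/2"] sin_double[of "t/2"] by (simp_all add: c_def s_def)
  define g :: "real^2^2" where "g = vector [vector [c, s], vector [- s, c]]"
  have g: "g \<in> SL2"
    unfolding SL2_det using cs by (simp add: g_def power2_eq_square)
  have "sl2_act g (vector [0, 0, 1]) = vector [0, 0, 1]"
    unfolding sl2_act_coords[OF g] using cs by (simp add: g_def vec_eq_iff forall_3)
  moreover have "sl2_act g W = vector [w, 0, W$3]"
  proof -
    have "(sl2_act g W)$1 = (c\<^sup>2 - s\<^sup>2) * W$1 + 2 * s * c * W$2"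
      "(sl2_act g W)$2 = - 2 * s * c * W$1 + (c\<^sup>2 - s\<^sup>2) * W$2"
      "(sl2_act g W)$3 = (c\<^sup>2 + s\<^sup>2) * W$3"
      unfolding sl2_act_coords[OF g] by (simp_all add: g_def power2_eq_square field_simps)
    moreover have "(c\<^sup>2 - s\<^sup>2) * (w * (c\<^sup>2 - s\<^sup>2)) + 2 * s * c * (w * (2 * s * c)) = w * (c\<^sup>2 + s\<^sup>2)\<^sup>2"
      by (simp add: power2_eq_square algebra_simps)
    ultimately show ?thesis
      using cs t[unfolded dbl] by (simp add: vec_eq_iff forall_3)
  qed
  ultimately show ?thesis using g unfolding w_def by blast
qed

lemma sl2_act_normal_form:
  assumes X: "X \<in> hyp_plane" and Y: "Y \<in> hyp_plane"
  shows "\<exists>g\<in>SL2. sl2_act g X = vector [0, 0, 1] \<and>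
     sl2_act g Y = vector [sqrt ((hyp_inner X Y)\<^sup>2 - 1), 0, - hyp_inner X Y]"
proof -
  obtain g where g: "g \<in> SL2" "sl2_act g X = vector [0, 0, 1]"
    using sl2_act_to_base[OF X] by blast
  define W where "W = sl2_act g Y"
  obtain h where h: "h \<in> SL2" "sl2_act h (vector [0, 0, 1]) = vector [0, 0, 1]"
    "sl2_act h W = vector [sqrt ((W$1)\<^sup>2 + (W$2)\<^sup>2), 0, W$3]"
    using sl2_act_rotate by blast
  have W: "W \<in> hyp_plane" unfolding W_def by (rule sl2_act_hyp_plane[OF g(1) Y])
  have "hyp_inner X Y = hyp_inner (sl2_act g X) W"
    by (simp add: W_def hyp_inner_sl2_act[OF g(1)])
  also have "\<dots> = - W$3" by (simp add: g hyp_inner_def)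
  finally have c: "W$3 = - hyp_inner X Y" by simp
  have "(W$1)\<^sup>2 + (W$2)\<^sup>2 = (W$3)\<^sup>2 - 1" using W by (simp add: hyp_plane_def)
  then show ?thesis
    using g h c sl2_act_mult[OF h(1) g(1)]
    by (intro bexI[of _ "h ** g"]) (auto simp: SL2_mult W_def)
qed

text \<open>Once the first two points are moved to a standard position that depends only on their
  distance, two coordinates of the third are determined by its distances to them, and the remaining
  one by the oriented volume. The volume excludes the mirror image.\<close>

lemma sl2_act_congruent:
  assumes X: "X1 \<in> hyp_plane" "X2 \<in> hyp_plane" "X3 \<in> hyp_plane" "X1 \<noteq> X2"
    and Y: "Y1 \<in> hyp_plane" "Y2 \<in> hyp_plane" "Y3 \<in> hyp_plane"
    and eq: "hyp_inner X1 X2 = hyp_inner Y1 Y2" "hyp_inner X2 X3 = hyp_inner Y2 Y3"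
      "hyp_inner X3 X1 = hyp_inner Y3 Y1" "hyp_triple X1 X2 X3 = hyp_triple Y1 Y2 Y3"
  shows "\<exists>g\<in>SL2. sl2_act g X1 = Y1 \<and> sl2_act g X2 = Y2 \<and> sl2_act g X3 = Y3"
proof -
  define c where "c = - hyp_inner X1 X2"
  define w where "w = sqrt (c\<^sup>2 - 1)"
  have w: "w > 0" using hyp_inner_sq_gt_one[OF X(1,2,4)] by (simp add: w_def c_def)
  obtain g where g: "g \<in> SL2" "sl2_act g X1 = vector [0, 0, 1]" "sl2_act g X2 = vector [w, 0, c]"
    using sl2_act_normal_form[OF X(1,2)] by (auto simp: w_def c_def)
  obtain h where h: "h \<in> SL2" "sl2_act h Y1 = vector [0, 0, 1]" "sl2_act h Y2 = vector [w, 0, c]"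
    using sl2_act_normal_form[OF Y(1,2)] by (auto simp: w_def c_def eq)
  have coords: "(sl2_act g U3)$3 = - hyp_inner U3 U1"
      "(sl2_act g U3)$1 = (hyp_inner U2 U3 + c * (sl2_act g U3)$3) / w"
      "(sl2_act g U3)$2 = hyp_triple U1 U2 U3 / w"
    if g: "g \<in> SL2" "sl2_act g U1 = vector [0, 0, 1]" "sl2_act g U2 = vector [w, 0, c]"
    for g U1 U2 U3
  proof -
    have "hyp_inner U3 U1 = hyp_inner (sl2_act g U3) (sl2_act g U1)"
      "hyp_inner U2 U3 = hyp_inner (sl2_act g U2) (sl2_act g U3)"
      "hyp_triple U1 U2 U3 = hyp_inner (hyp_cross (sl2_act g U1) (sl2_act g U2)) (sl2_act g U3)"
      by (simp_all add: hyp_triple_def hyp_inner_sl2_act[OF g(1)] hyp_cross_sl2_act[OF g(1)])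
    then show "(sl2_act g U3)$3 = - hyp_inner U3 U1"
      "(sl2_act g U3)$1 = (hyp_inner U2 U3 + c * (sl2_act g U3)$3) / w"
      "(sl2_act g U3)$2 = hyp_triple U1 U2 U3 / w"
      unfolding g using w by (simp_all add: hyp_inner_def hyp_cross_def)
  qed
  have "sl2_act g X3 = sl2_act h Y3"
    using coords[OF g, of X3] coords[OF h, of Y3] eq by (simp add: vec_eq_iff forall_3)
  then have "sl2_act g X1 = sl2_act h Y1" "sl2_act g X2 = sl2_act h Y2" "sl2_act g X3 = sl2_act h Y3"
    using g h by simp_all
  then show ?thesis
    by (intro bexI[of _ "adj2 h ** g"])
      (simp_all add: sl2_act_mult sl2_act_adj2 SL2_mult adj2_SL2 g(1) h(1))
qed

subsection \<open>Shape, volume and momentum of a configuration\<close>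

lemma UNIV_3_diff: "UNIV - {1::3} = {2, 3}" "UNIV - {2::3} = {3, 1}" "UNIV - {3::3} = {1, 2}"
  using exhaust_3 by force+

definition shape :: "config \<Rightarrow> real^3" where
  "shape X = vector [- hyp_inner (X$2) (X$3), - hyp_inner (X$3) (X$1), - hyp_inner (X$1) (X$2)]"

definition vol :: "config \<Rightarrow> real" where
  "vol X = hyp_triple (X$1) (X$2) (X$3)"

definition rate :: "real \<Rightarrow> real" where
  "rate x = 1 / (x\<^sup>2 - 1)"

lemma shape_nth [simp]:
  "shape X $ 1 = - hyp_inner (X$2) (X$3)" "shape X $ 2 = - hyp_inner (X$3) (X$1)"
  "shape X $ 3 = - hyp_inner (X$1) (X$2)"
  by (simp_all add: shape_def)

lemma continuous_on_shape [continuous_intros]: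
  fixes f :: "'a::t2_space \<Rightarrow> config"
  shows "continuous_on S f \<Longrightarrow> continuous_on S (\<lambda>x. shape (f x))"
proof (rule continuous_on_componentwise[THEN iffD2], intro ballI)
  fix b :: "real^3" assume f: "continuous_on S f" and "b \<in> Basis"
  then obtain i where "b = axis i 1" by (auto simp: Basis_vec_def)
  then have "(\<lambda>x. shape (f x) \<bullet> b) = (\<lambda>x. shape (f x) $ i)" by (simp add: inner_axis)
  moreover have "continuous_on S (\<lambda>x. - hyp_inner (f x $ p) (f x $ q))" for p q
    by (intro continuous_intros f)
  then have "continuous_on S (\<lambda>x. shape (f x) $ i)"
    using exhaust_3[of i] by (elim disjE) simp_all
  ultimately show "continuous_on S (\<lambda>x. shape (f x) \<bullet> b)" by (simp only:)
qed

lemma continuous_on_vol [continuous_intros]: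
  "continuous_on S f \<Longrightarrow> continuous_on S (\<lambda>x. vol (f x))"
  unfolding vol_def hyp_triple_def by (intro continuous_intros)

lemma continuous_on_momentum [continuous_intros]:
  "continuous_on S f \<Longrightarrow> continuous_on S (\<lambda>x. momentum \<Gamma> (f x))"
  unfolding momentum_def by (intro continuous_intros)

lemma phase_space_hyp_plane: "X \<in> phase_space \<Longrightarrow> X$r \<in> hyp_plane"
  by (simp add: phase_space_def)

lemma shape_gt_one:
  assumes "X \<in> phase_space"
  shows "shape X $ i > 1"
proof -
  have "- hyp_inner (X$r) (X$p) > 1" if "r \<noteq> p" for r p
    using hyp_inner_less_minus_one[of "X$r" "X$p"] assms that by (auto simp: phase_space_def)
  from this[of 2 3] this[of 3 1] this[of 1 2] show ?thesis
    using exhaust_3[of i] by (auto simp: shape_def)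
qed

lemma phase_space_shape:
  assumes "\<And>r. X$r \<in> hyp_plane" "\<And>i. shape X $ i > 1"
  shows "X \<in> phase_space"
proof -
  have "hyp_inner (X$r) (X$r) = -1" for r using assms(1) by (simp add: hyp_plane_iff)
  then have "X$r \<noteq> X$p" if "r \<noteq> p" for r p
    using that assms(2)[of 1] assms(2)[of 2] assms(2)[of 3] exhaust_3[of r] exhaust_3[of p]
    by (auto simp: hyp_inner_commute)
  then show ?thesis using assms(1) by (simp add: phase_space_def)
qed

lemma vol_sq:
  "X \<in> phase_space \<Longrightarrow> (vol X)\<^sup>2 = gram (shape X $ 1) (shape X $ 2) (shape X $ 3)"
  using hyp_triple_sq_gram[of "X$1" "X$2" "X$3"] by (simp add: vol_def phase_space_hyp_plane)

lemma equilateral_shape: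
  assumes "X \<in> phase_space" "equilateral X"
  obtains \<kappa> where "\<kappa> > 1" "shape X = vec \<kappa>"
proof -
  have e: "hyp_inner (X$1) (X$2) = hyp_inner (X$2) (X$3)" "hyp_inner (X$2) (X$3) = hyp_inner (X$3) (X$1)"
    using assms by (simp_all add: cosh_hyp_dist phase_space_hyp_plane equilateral_def)
  show ?thesis
    using shape_gt_one[OF assms(1), of 1] e
    by (intro that[of "- hyp_inner (X$1) (X$2)"]) (simp_all add: vec_eq_iff forall_3)
qed

lemma sl2_act_config_nth [simp]: "sl2_act_config g X $ r = sl2_act g (X$r)"
  by (simp add: sl2_act_config_def)

lemma sl2_act_config_invariants:
  assumes "g \<in> SL2"
  shows "shape (sl2_act_config g X) = shape X" "vol (sl2_act_config g X) = vol X"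
    "momentum \<Gamma> (sl2_act_config g X) = sl2_act g (momentum \<Gamma> X)"
proof -
  show "shape (sl2_act_config g X) = shape X"
    by (simp add: vec_eq_iff forall_3 hyp_inner_sl2_act[OF assms])
  show "vol (sl2_act_config g X) = vol X"
    by (simp add: vol_def hyp_triple_def hyp_cross_sl2_act[OF assms] hyp_inner_sl2_act[OF assms])
  show "momentum \<Gamma> (sl2_act_config g X) = sl2_act g (momentum \<Gamma> X)"
    by (simp add: momentum_def linear_sum[OF sl2_act_linear] linear_cmul[OF sl2_act_linear])
qed

lemma sl2_act_config_phase_space:
  assumes "g \<in> SL2" "X \<in> phase_space"
  shows "sl2_act_config g X \<in> phase_space"
  by (rule phase_space_shape)
    (use assms in \<open>simp_all add: sl2_act_config_invariants sl2_act_hyp_plane phase_space_hyp_plane shape_gt_one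
      del: shape_nth\<close>)

lemma phase_space_congruent:
  assumes "X \<in> phase_space" "Y \<in> phase_space" "shape X = shape Y" "vol X = vol Y"
  obtains g where "g \<in> SL2" "sl2_act_config g X = Y"
proof -
  have "\<exists>g\<in>SL2. sl2_act g (X$1) = Y$1 \<and> sl2_act g (X$2) = Y$2 \<and> sl2_act g (X$3) = Y$3"
    using assms by (intro sl2_act_congruent)
      (auto simp: phase_space_def vol_def vec_eq_iff forall_3)
  then show ?thesis using that by (auto simp: vec_eq_iff forall_3)
qed

lemma hyp_inner_momentum:
  assumes "X \<in> phase_space"
  shows "hyp_inner (momentum \<Gamma> X) (momentum \<Gamma> X) = - (\<Gamma> 1)\<^sup>2 - (\<Gamma> 2)\<^sup>2 - (\<Gamma> 3)\<^sup>2
     - 2 * (\<Gamma> 2 * \<Gamma> 3 * shape X $ 1 + \<Gamma> 3 * \<Gamma> 1 * shape X $ 2 + \<Gamma> 1 * \<Gamma> 2 * shape X $ 3)"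
  using assms
  by (simp add: momentum_def sum_3 hyp_inner_simps phase_space_def hyp_plane_iff power2_eq_square
      hyp_inner_commute[of "X$2" "X$1"] hyp_inner_commute[of "X$3" "X$2"] hyp_inner_commute[of "X$1" "X$3"]
      algebra_simps)

text \<open>The pairing of a vortex with the momentum is controlled by the shape alone. Together
  with \<open>timelike_norm_bound\<close> this confines vortices to a bounded set.\<close>

lemma hyp_inner_momentum_nth:
  assumes "X \<in> phase_space"
  shows "\<bar>hyp_inner (momentum \<Gamma> X) (X$r)\<bar> \<le> (\<Sum>i\<in>UNIV. \<bar>\<Gamma> i\<bar>) * (1 + (\<Sum>i\<in>UNIV. shape X $ i))"
proof -
  have p: "shape X $ i > 1" for i using shape_gt_one[OF assms] .
  have "\<bar>hyp_inner (X$i) (X$r)\<bar> \<le> 1 + (\<Sum>i\<in>UNIV. shape X $ i)" for i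
    using p[of 1] p[of 2] p[of 3] assms exhaust_3[of i] exhaust_3[of r]
    by (auto simp: sum_3 phase_space_def hyp_plane_iff
      hyp_inner_commute[of "X$2" "X$1"] hyp_inner_commute[of "X$3" "X$2"] hyp_inner_commute[of "X$1" "X$3"])
  then have "\<bar>\<Gamma> i * hyp_inner (X$i) (X$r)\<bar> \<le> \<bar>\<Gamma> i\<bar> * (1 + (\<Sum>i\<in>UNIV. shape X $ i))" for i
    unfolding abs_mult by (intro mult_left_mono) auto
  then have "\<bar>\<Sum>i\<in>UNIV. \<Gamma> i * hyp_inner (X$i) (X$r)\<bar> \<le> (\<Sum>i\<in>UNIV. \<bar>\<Gamma> i\<bar> * (1 + (\<Sum>i\<in>UNIV. shape X $ i)))"
    by (intro order_trans[OF sum_abs] sum_mono)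
  then show ?thesis
    by (simp add: momentum_def sum_3 hyp_inner_simps distrib_right)
qed

lemma vortex_field_nth:
  "vortex_field \<Gamma> X $ 1 = (1 / pi) *\<^sub>R ((\<Gamma> 2 * rate (shape X $ 3)) *\<^sub>R hyp_cross (X$2) (X$1)
      + (\<Gamma> 3 * rate (shape X $ 2)) *\<^sub>R hyp_cross (X$3) (X$1))"
  "vortex_field \<Gamma> X $ 2 = (1 / pi) *\<^sub>R ((\<Gamma> 3 * rate (shape X $ 1)) *\<^sub>R hyp_cross (X$3) (X$2)
      + (\<Gamma> 1 * rate (shape X $ 3)) *\<^sub>R hyp_cross (X$1) (X$2))"
  "vortex_field \<Gamma> X $ 3 = (1 / pi) *\<^sub>R ((\<Gamma> 1 * rate (shape X $ 2)) *\<^sub>R hyp_cross (X$1) (X$3)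
      + (\<Gamma> 2 * rate (shape X $ 1)) *\<^sub>R hyp_cross (X$2) (X$3))"
  by (simp_all add: vortex_field_def UNIV_3_diff rate_def
      hyp_inner_commute[of "X$2" "X$1"] hyp_inner_commute[of "X$3" "X$2"] hyp_inner_commute[of "X$1" "X$3"])

lemma hyp_inner_cross_self: "hyp_inner (hyp_cross X Y) X = 0" "hyp_inner (hyp_cross X Y) Y = 0"
  using hyp_triple_degenerate by (simp_all add: hyp_triple_def)

lemma vortex_field_tangent: "hyp_inner (vortex_field \<Gamma> X $ r) (X$r) = 0"
  using exhaust_3[of r] by (auto simp: vortex_field_nth hyp_inner_simps hyp_inner_cross_self)

lemma vortex_field_momentum: "momentum \<Gamma> (vortex_field \<Gamma> X) = 0"
proof -
  have "hyp_cross Y Z = - hyp_cross Z Y" for Y Z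
    by (simp add: hyp_cross_def vec_eq_iff forall_3)
  note a = this[of "X$2" "X$1"] this[of "X$3" "X$2"] this[of "X$1" "X$3"]
  show ?thesis
    unfolding momentum_def sum_3 vortex_field_nth a by (simp add: scaleR_add_right algebra_simps)
qed

text \<open>Two vortices do not change their own distance, because their cross product is orthogonal
  to both. Only the third vortex contributes, through the triple product.\<close>

lemma vortex_field_shape:
  "hyp_inner (vortex_field \<Gamma> X $ 2) (X$3) + hyp_inner (X$2) (vortex_field \<Gamma> X $ 3)
     = - (\<Gamma> 1 * vol X / pi * (rate (shape X $ 2) - rate (shape X $ 3)))"
  "hyp_inner (vortex_field \<Gamma> X $ 3) (X$1) + hyp_inner (X$3) (vortex_field \<Gamma> X $ 1)
     = - (\<Gamma> 2 * vol X / pi * (rate (shape X $ 3) - rate (shape X $ 1)))"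
  "hyp_inner (vortex_field \<Gamma> X $ 1) (X$2) + hyp_inner (X$1) (vortex_field \<Gamma> X $ 2)
     = - (\<Gamma> 3 * vol X / pi * (rate (shape X $ 1) - rate (shape X $ 2)))"
proof -
  note c = hyp_inner_commute[of "X$_" "hyp_cross _ _"] hyp_inner_commute[of "X$_" "vortex_field _ _ $ _"]
  have t: "hyp_inner (hyp_cross (X$1) (X$2)) (X$3) = vol X"
    "hyp_inner (hyp_cross (X$2) (X$3)) (X$1) = vol X"
    "hyp_inner (hyp_cross (X$3) (X$1)) (X$2) = vol X"
    "hyp_inner (hyp_cross (X$2) (X$1)) (X$3) = - vol X"
    "hyp_inner (hyp_cross (X$3) (X$2)) (X$1) = - vol X"
    "hyp_inner (hyp_cross (X$1) (X$3)) (X$2) = - vol X"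
    by (simp_all add: vol_def hyp_triple_def hyp_inner_def hyp_cross_def algebra_simps)
  show "hyp_inner (vortex_field \<Gamma> X $ 2) (X$3) + hyp_inner (X$2) (vortex_field \<Gamma> X $ 3)
     = - (\<Gamma> 1 * vol X / pi * (rate (shape X $ 2) - rate (shape X $ 3)))"
    unfolding c by (simp add: vortex_field_nth hyp_inner_simps hyp_inner_cross_self t field_simps del: shape_nth)
  show "hyp_inner (vortex_field \<Gamma> X $ 3) (X$1) + hyp_inner (X$3) (vortex_field \<Gamma> X $ 1)
     = - (\<Gamma> 2 * vol X / pi * (rate (shape X $ 3) - rate (shape X $ 1)))"
    unfolding c by (simp add: vortex_field_nth hyp_inner_simps hyp_inner_cross_self t field_simps del: shape_nth)
  show "hyp_inner (vortex_field \<Gamma> X $ 1) (X$2) + hyp_inner (X$1) (vortex_field \<Gamma> X $ 2)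
     = - (\<Gamma> 3 * vol X / pi * (rate (shape X $ 1) - rate (shape X $ 2)))"
    unfolding c by (simp add: vortex_field_nth hyp_inner_simps hyp_inner_cross_self t field_simps del: shape_nth)
qed

lemma hyp_inner_has_derivative:
  assumes "(X has_vector_derivative X') (at t)" "(Y has_vector_derivative Y') (at t)"
  shows "((\<lambda>t. hyp_inner (X t) (Y t)) has_real_derivative hyp_inner X' (Y t) + hyp_inner (X t) Y') (at t)"
  using bounded_bilinear.has_vector_derivative[OF bilinear_hyp_inner assms]
  by (simp add: has_real_derivative_iff_has_vector_derivative add.commute)

lemma vec_nth_has_vector_derivative:
  "(X has_vector_derivative X') (at t) \<Longrightarrow> ((\<lambda>t. X t $ r) has_vector_derivative X' $ r) (at t)"
  by (rule bounded_linear.has_vector_derivative[OF bounded_linear_vec_nth])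

text \<open>Stated for curves in the ambient space: the last item is what later shows that a
  solution constructed in R^3 stays on the hyperboloid.\<close>

lemma solution_derivatives:
  assumes "(X has_vector_derivative vortex_field \<Gamma> (X t)) (at t)"
  shows "((\<lambda>t. shape (X t) $ 1) has_real_derivative
      \<Gamma> 1 * vol (X t) / pi * (rate (shape (X t) $ 2) - rate (shape (X t) $ 3))) (at t)"
    "((\<lambda>t. shape (X t) $ 2) has_real_derivative
      \<Gamma> 2 * vol (X t) / pi * (rate (shape (X t) $ 3) - rate (shape (X t) $ 1))) (at t)"
    "((\<lambda>t. shape (X t) $ 3) has_real_derivative
      \<Gamma> 3 * vol (X t) / pi * (rate (shape (X t) $ 1) - rate (shape (X t) $ 2))) (at t)"
    "((\<lambda>t. momentum \<Gamma> (X t)) has_vector_derivative 0) (at t)"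
    "((\<lambda>t. hyp_inner (X t $ r) (X t $ r)) has_real_derivative 0) (at t)"
proof -
  have d: "((\<lambda>t. X t $ r) has_vector_derivative vortex_field \<Gamma> (X t) $ r) (at t)" for r
    by (rule vec_nth_has_vector_derivative[OF assms])
  have h: "((\<lambda>t. - hyp_inner (X t $ r) (X t $ p)) has_real_derivative
     - (hyp_inner (vortex_field \<Gamma> (X t) $ r) (X t $ p) + hyp_inner (X t $ r) (vortex_field \<Gamma> (X t) $ p))) (at t)"
    for r p by (rule DERIV_minus[OF hyp_inner_has_derivative[OF d d]])
  show "((\<lambda>t. shape (X t) $ 1) has_real_derivative
      \<Gamma> 1 * vol (X t) / pi * (rate (shape (X t) $ 2) - rate (shape (X t) $ 3))) (at t)"
    using h[of 2 3] unfolding vortex_field_shape by simp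
  show "((\<lambda>t. shape (X t) $ 2) has_real_derivative
      \<Gamma> 2 * vol (X t) / pi * (rate (shape (X t) $ 3) - rate (shape (X t) $ 1))) (at t)"
    using h[of 3 1] unfolding vortex_field_shape by simp
  show "((\<lambda>t. shape (X t) $ 3) has_real_derivative
      \<Gamma> 3 * vol (X t) / pi * (rate (shape (X t) $ 1) - rate (shape (X t) $ 2))) (at t)"
    using h[of 1 2] unfolding vortex_field_shape by simp
  have "((\<lambda>t. momentum \<Gamma> (X t)) has_vector_derivative momentum \<Gamma> (vortex_field \<Gamma> (X t))) (at t)"
    unfolding momentum_def
    by (intro has_vector_derivative_sum bounded_linear.has_vector_derivative[OF bounded_linear_scaleR_right] d)
  then show "((\<lambda>t. momentum \<Gamma> (X t)) has_vector_derivative 0) (at t)"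
    by (simp add: vortex_field_momentum)
  show "((\<lambda>t. hyp_inner (X t $ r) (X t $ r)) has_real_derivative 0) (at t)"
    using hyp_inner_has_derivative[OF d[of r] d[of r]]
    by (simp add: vortex_field_tangent hyp_inner_commute[of "X t $ r" "vortex_field _ _ $ _"])
qed

subsection \<open>Conserved quantities of the shape dynamics\<close>

definition rate_deriv :: "real \<Rightarrow> real" where
  "rate_deriv x = - (2 * x) / (x\<^sup>2 - 1)\<^sup>2"

text \<open>At x = cosh d this is ln (tanh (d / 2)), up to a factor the Green's function of the
  hyperbolic plane, hence the pair interaction of vortices.\<close>

definition rate_prim :: "real \<Rightarrow> real" where
  "rate_prim x = (ln (x - 1) - ln (x + 1)) / 2"

lemma sq_minus_one_pos: "(x::real) > 1 \<Longrightarrow> x\<^sup>2 - 1 > 0"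
  using one_less_power[of x 2] by simp

lemma sq_neq_one: "(x::real) > 1 \<Longrightarrow> x\<^sup>2 \<noteq> 1" "(x::real) > 1 \<Longrightarrow> x * x \<noteq> 1"
  using sq_minus_one_pos[of x] by (auto simp: power2_eq_square)

lemma rate_prim_deriv:
  assumes "x > 1"
  shows "(rate_prim has_real_derivative rate x) (at x)"
proof -
  have "(rate_prim has_real_derivative (1 / (x - 1) - 1 / (x + 1)) / 2) (at x)"
    unfolding rate_prim_def using assms by (auto intro!: derivative_eq_intros)
  moreover have "(1 / (x - 1) - 1 / (x + 1)) / 2 = rate x"
    using assms sq_neq_one[OF assms]
    by (simp add: rate_def divide_simps power2_eq_square) (simp add: algebra_simps)
  ultimately show ?thesis by simp
qed

lemma rate_has_deriv:
  assumes "x > 1"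
  shows "(rate has_real_derivative rate_deriv x) (at x)"
  unfolding rate_def rate_deriv_def using sq_minus_one_pos[OF assms]
  by (auto intro!: derivative_eq_intros simp: power2_eq_square)

lemma continuous_on_rate_deriv: "continuous_on {1<..} rate_deriv"
proof -
  have "(x\<^sup>2 - 1)\<^sup>2 \<noteq> 0" if "x \<in> {1<..}" for x :: real
    using sq_neq_one[of x] that by simp
  then show ?thesis unfolding rate_deriv_def by (auto intro!: continuous_intros)
qed

lemma rate_deriv_neg: "x > 1 \<Longrightarrow> rate_deriv x < 0"
  using sq_neq_one[of x] by (simp add: rate_deriv_def)

lemma rate_deriv_near:
  assumes "\<kappa> > 1" "\<eta> > 0"
  obtains r where "r > 0" "r < \<kappa> - 1" "\<And>x. \<bar>x - \<kappa>\<bar> \<le> r \<Longrightarrow> \<bar>rate_deriv x - rate_deriv \<kappa>\<bar> < \<eta>"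
proof -
  have "isCont rate_deriv \<kappa>"
    using continuous_on_rate_deriv assms by (simp add: continuous_on_eq_continuous_at)
  then obtain d where d: "d > 0" "\<And>x. \<bar>x - \<kappa>\<bar> < d \<Longrightarrow> \<bar>rate_deriv x - rate_deriv \<kappa>\<bar> < \<eta>"
    using assms(2) unfolding continuous_at_eps_delta dist_real_def by (metis dist_real_def)
  show ?thesis
    by (rule that[of "min d (\<kappa> - 1) / 2"]) (use d assms in auto)
qed

text \<open>The remainder of \<open>rate_prim\<close> after its first-order Taylor polynomial at
  \<kappa>. Summed with weights 1 / \<open>\<Gamma> i\<close>, the removed linear part is a multiple
  of \<open>shape_linear\<close>, so conservation is not lost while the first variation
  disappears.\<close>

definition excess :: "real \<Rightarrow> real \<Rightarrow> real" where
  "excess \<kappa> x = rate_prim x - rate_prim \<kappa> - rate \<kappa> * (x - \<kappa>)"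

lemma excess_taylor:
  assumes "\<kappa> > 1" "x > 1"
  obtains \<theta> where "\<bar>\<theta> - \<kappa>\<bar> \<le> \<bar>x - \<kappa>\<bar>" "\<theta> > 1" "excess \<kappa> x = rate_deriv \<theta> / 2 * (x - \<kappa>)\<^sup>2"
proof (cases "x = \<kappa>")
  case True
  then show ?thesis using that[of \<kappa>] assms by (simp add: excess_def)
next
  case False
  define diff where "diff n = (if n = 0 then rate_prim else if n = Suc 0 then rate else rate_deriv)"
    for n :: nat
  have "\<exists>t. (if x < \<kappa> then x < t \<and> t < \<kappa> else \<kappa> < t \<and> t < x) \<and>
      rate_prim x = (\<Sum>m<2. diff m \<kappa> / fact m * (x - \<kappa>)^m) + diff 2 t / fact 2 * (x - \<kappa>)^2"
    by (rule Taylor[of 2 diff rate_prim "min x \<kappa>" "max x \<kappa>"])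
      (use assms False in \<open>auto simp: diff_def less_2_cases_iff intro!: rate_prim_deriv rate_has_deriv\<close>)
  then obtain t where t: "if x < \<kappa> then x < t \<and> t < \<kappa> else \<kappa> < t \<and> t < x"
     "rate_prim x = (\<Sum>m<2. diff m \<kappa> / fact m * (x - \<kappa>)^m) + diff 2 t / fact 2 * (x - \<kappa>)^2"
    by blast
  show ?thesis
  proof (rule that[of t])
    show "\<bar>t - \<kappa>\<bar> \<le> \<bar>x - \<kappa>\<bar>" "t > 1" using t(1) assms by (auto split: if_splits)
    show "excess \<kappa> x = rate_deriv t / 2 * (x - \<kappa>)\<^sup>2"
      using t(2) by (simp add: excess_def diff_def numeral_2_eq_2)
  qed
qed

text \<open>Eliminating y3 leaves a binary form with determinant g1 g2 + g2 g3 + g3 g1. Multiplying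
  by its leading coefficient g1 + g3 completes the square whatever the signs of the weights.\<close>

lemma constrained_form_bound:
  fixes g1 g2 g3 y1 y2 y3 :: real
  assumes "y1 + y2 + y3 = 0"
  shows "(g1 * g2 + g2 * g3 + g3 * g1) * y2\<^sup>2 \<le> \<bar>g1 + g3\<bar> * \<bar>g1 * y1\<^sup>2 + g2 * y2\<^sup>2 + g3 * y3\<^sup>2\<bar>"
proof -
  have y3: "y3 = - y1 - y2" using assms by simp
  have "(g1 + g3) * (g1 * y1\<^sup>2 + g2 * y2\<^sup>2 + g3 * y3\<^sup>2)
     = ((g1 + g3) * y1 + g3 * y2)\<^sup>2 + (g1 * g2 + g2 * g3 + g3 * g1) * y2\<^sup>2"
    unfolding y3 by (simp add: power2_eq_square algebra_simps)
  then have "(g1 * g2 + g2 * g3 + g3 * g1) * y2\<^sup>2 \<le> (g1 + g3) * (g1 * y1\<^sup>2 + g2 * y2\<^sup>2 + g3 * y3\<^sup>2)"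
    by simp
  also have "\<dots> \<le> \<bar>g1 + g3\<bar> * \<bar>g1 * y1\<^sup>2 + g2 * y2\<^sup>2 + g3 * y3\<^sup>2\<bar>"
    by (metis abs_ge_self abs_mult)
  finally show ?thesis .
qed

text \<open>By \<open>hyp_inner_momentum\<close> this is, up to a constant and a factor depending on
  \<Gamma>, the form evaluated at the momentum.\<close>

definition shape_linear :: "(3 \<Rightarrow> real) \<Rightarrow> real \<Rightarrow> real^3 \<Rightarrow> real" where
  "shape_linear \<Gamma> \<kappa> s = (\<Sum>i\<in>UNIV. (s$i - \<kappa>) / \<Gamma> i)"

text \<open>The Hamiltonian, the sum of the products \<open>\<Gamma> j * \<Gamma> k\<close> times
  \<open>rate_prim\<close> over the pairs, divided by the product of all vorticities and corrected
  by a constant and a multiple of \<open>shape_linear\<close>.\<close>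

definition shape_energy :: "(3 \<Rightarrow> real) \<Rightarrow> real \<Rightarrow> real^3 \<Rightarrow> real" where
  "shape_energy \<Gamma> \<kappa> s = (\<Sum>i\<in>UNIV. excess \<kappa> (s$i) / \<Gamma> i)"

definition sigma2 :: "(3 \<Rightarrow> real) \<Rightarrow> real" where
  "sigma2 \<Gamma> = \<Gamma> 1 * \<Gamma> 2 + \<Gamma> 2 * \<Gamma> 3 + \<Gamma> 3 * \<Gamma> 1"

text \<open>In the variables y_i = (s_i - \<kappa>) / \<open>\<Gamma> i\<close> the first condition
  says that they sum to zero, and the energy is half the sum of \<theta>_i \<open>\<Gamma> i\<close>
  y_i^2 with every \<theta>_i close to \<open>rate_deriv \<kappa>\<close>. Definiteness on the plane
  survives this perturbation of the coefficients.\<close>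

lemma shape_energy_isolated:
  assumes \<kappa>: "\<kappa> > 1" and \<Gamma>: "\<And>r. \<Gamma> r \<noteq> 0" and S: "sigma2 \<Gamma> > 0"
  obtains r where "r > 0" "r < \<kappa> - 1"
    "\<And>s. (\<And>i. \<bar>s$i - \<kappa>\<bar> \<le> r) \<Longrightarrow> shape_linear \<Gamma> \<kappa> s = 0 \<Longrightarrow> shape_energy \<Gamma> \<kappa> s = 0 \<Longrightarrow> s = vec \<kappa>"
proof -
  define m where "m = rate_deriv \<kappa>"
  have m: "m < 0" using rate_deriv_neg[OF \<kappa>] by (simp add: m_def)
  \<comment> \<open>The three cyclic instances of \<open>constrained_form_bound\<close>, weighted
    with the absolute vorticities, show that the form with absolute weights is at most
    \<open>M\<close> times the absolute value of the signed form \<open>Q\<close>.\<close>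
  define M where "M = (\<bar>\<Gamma> 1\<bar> * \<bar>\<Gamma> 2 + \<Gamma> 3\<bar> + \<bar>\<Gamma> 2\<bar> * \<bar>\<Gamma> 3 + \<Gamma> 1\<bar> + \<bar>\<Gamma> 3\<bar> * \<bar>\<Gamma> 1 + \<Gamma> 2\<bar>) / sigma2 \<Gamma>"
  have M: "M \<ge> 0" unfolding M_def using S by (intro divide_nonneg_pos add_nonneg_nonneg) auto
  \<comment> \<open>Chosen so that \<eta> M < |m|: replacing the \<theta>_i by m then costs strictly
    less than |m Q|, unless Q = 0.\<close>
  define \<eta> where "\<eta> = \<bar>m\<bar> / (M + 1)"
  have \<eta>: "\<eta> > 0" unfolding \<eta>_def using m M by (intro divide_pos_pos) auto
  obtain r where r: "r > 0" "r < \<kappa> - 1" "\<And>x. \<bar>x - \<kappa>\<bar> \<le> r \<Longrightarrow> \<bar>rate_deriv x - m\<bar> < \<eta>"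
    using rate_deriv_near[OF \<kappa> \<eta>] unfolding m_def by metis
  show ?thesis
  proof (rule that[OF r(1,2)])
    fix s :: "real^3"
    assume s: "\<And>i. \<bar>s$i - \<kappa>\<bar> \<le> r" and l: "shape_linear \<Gamma> \<kappa> s = 0" and E: "shape_energy \<Gamma> \<kappa> s = 0"
    define y where "y i = (s$i - \<kappa>) / \<Gamma> i" for i
    have u: "s$i - \<kappa> = \<Gamma> i * y i" for i using \<Gamma> by (simp add: y_def)
    have sum: "y 1 + y 2 + y 3 = 0" using l by (simp add: shape_linear_def sum_3 y_def)
    define Q where "Q = \<Gamma> 1 * (y 1)\<^sup>2 + \<Gamma> 2 * (y 2)\<^sup>2 + \<Gamma> 3 * (y 3)\<^sup>2"
    have b: "sigma2 \<Gamma> * (y 1)\<^sup>2 \<le> \<bar>\<Gamma> 2 + \<Gamma> 3\<bar> * \<bar>Q\<bar>" "sigma2 \<Gamma> * (y 2)\<^sup>2 \<le> \<bar>\<Gamma> 3 + \<Gamma> 1\<bar> * \<bar>Q\<bar>"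
       "sigma2 \<Gamma> * (y 3)\<^sup>2 \<le> \<bar>\<Gamma> 1 + \<Gamma> 2\<bar> * \<bar>Q\<bar>"
      using constrained_form_bound[of "y 3" "y 1" "y 2" "\<Gamma> 3" "\<Gamma> 1" "\<Gamma> 2"] sum
        constrained_form_bound[of "y 1" "y 2" "y 3" "\<Gamma> 1" "\<Gamma> 2" "\<Gamma> 3"]
        constrained_form_bound[of "y 2" "y 3" "y 1" "\<Gamma> 2" "\<Gamma> 3" "\<Gamma> 1"]
      by (simp_all add: Q_def sigma2_def add_ac mult_ac)
    have Mb: "\<bar>\<Gamma> 1\<bar> * (y 1)\<^sup>2 + \<bar>\<Gamma> 2\<bar> * (y 2)\<^sup>2 + \<bar>\<Gamma> 3\<bar> * (y 3)\<^sup>2 \<le> M * \<bar>Q\<bar>"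
    proof -
      have "sigma2 \<Gamma> * (\<bar>\<Gamma> 1\<bar> * (y 1)\<^sup>2 + \<bar>\<Gamma> 2\<bar> * (y 2)\<^sup>2 + \<bar>\<Gamma> 3\<bar> * (y 3)\<^sup>2)
        = \<bar>\<Gamma> 1\<bar> * (sigma2 \<Gamma> * (y 1)\<^sup>2) + \<bar>\<Gamma> 2\<bar> * (sigma2 \<Gamma> * (y 2)\<^sup>2) + \<bar>\<Gamma> 3\<bar> * (sigma2 \<Gamma> * (y 3)\<^sup>2)"
        by (simp add: algebra_simps)
      also have "\<dots> \<le> \<bar>\<Gamma> 1\<bar> * (\<bar>\<Gamma> 2 + \<Gamma> 3\<bar> * \<bar>Q\<bar>) + \<bar>\<Gamma> 2\<bar> * (\<bar>\<Gamma> 3 + \<Gamma> 1\<bar> * \<bar>Q\<bar>)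
           + \<bar>\<Gamma> 3\<bar> * (\<bar>\<Gamma> 1 + \<Gamma> 2\<bar> * \<bar>Q\<bar>)"
        by (intro add_mono mult_left_mono b) auto
      also have "\<dots> = sigma2 \<Gamma> * M * \<bar>Q\<bar>" using S by (simp add: M_def distrib_right mult.assoc)
      finally show ?thesis using S by (simp add: mult.assoc)
    qed
    have "\<exists>\<theta>. \<bar>\<theta> - m\<bar> < \<eta> \<and> excess \<kappa> (s$i) / \<Gamma> i = \<theta> / 2 * (\<Gamma> i * (y i)\<^sup>2)" for i
    proof -
      have "s$i > 1" using s[of i] r(2) by linarith
      then obtain t where t: "\<bar>t - \<kappa>\<bar> \<le> \<bar>s$i - \<kappa>\<bar>"
          "excess \<kappa> (s$i) = rate_deriv t / 2 * (s$i - \<kappa>)\<^sup>2"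
        using excess_taylor[OF \<kappa>] by metis
      have "excess \<kappa> (s$i) / \<Gamma> i = rate_deriv t / 2 * (\<Gamma> i * (y i)\<^sup>2)"
        unfolding t(2) u using \<Gamma>[of i] by (simp add: power2_eq_square)
      then show ?thesis using r(3)[of t] s[of i] t(1) by (intro exI[of _ "rate_deriv t"]) auto
    qed
    then obtain \<theta> where \<theta>: "\<And>i. \<bar>\<theta> i - m\<bar> < \<eta>"
        "\<And>i. excess \<kappa> (s$i) / \<Gamma> i = \<theta> i / 2 * (\<Gamma> i * (y i)\<^sup>2)" by metis
    have "0 = 2 * shape_energy \<Gamma> \<kappa> s" using E by simp
    also have "\<dots> = m * Q + ((\<theta> 1 - m) * (\<Gamma> 1 * (y 1)\<^sup>2) + (\<theta> 2 - m) * (\<Gamma> 2 * (y 2)\<^sup>2)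
        + (\<theta> 3 - m) * (\<Gamma> 3 * (y 3)\<^sup>2))"
      by (simp add: shape_energy_def sum_3 \<theta>(2) Q_def algebra_simps)
    finally have "\<bar>m * Q\<bar> = \<bar>(\<theta> 1 - m) * (\<Gamma> 1 * (y 1)\<^sup>2) + (\<theta> 2 - m) * (\<Gamma> 2 * (y 2)\<^sup>2)
        + (\<theta> 3 - m) * (\<Gamma> 3 * (y 3)\<^sup>2)\<bar>" by linarith
    also have "\<dots> \<le> \<bar>\<theta> 1 - m\<bar> * (\<bar>\<Gamma> 1\<bar> * (y 1)\<^sup>2) + \<bar>\<theta> 2 - m\<bar> * (\<bar>\<Gamma> 2\<bar> * (y 2)\<^sup>2)
        + \<bar>\<theta> 3 - m\<bar> * (\<bar>\<Gamma> 3\<bar> * (y 3)\<^sup>2)"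
    proof -
      have "\<bar>(\<theta> i - m) * (\<Gamma> i * (y i)\<^sup>2)\<bar> = \<bar>\<theta> i - m\<bar> * (\<bar>\<Gamma> i\<bar> * (y i)\<^sup>2)" for i
        by (simp add: abs_mult)
      from this[of 1] this[of 2] this[of 3] show ?thesis by linarith
    qed
    also have "\<dots> \<le> \<eta> * (\<bar>\<Gamma> 1\<bar> * (y 1)\<^sup>2) + \<eta> * (\<bar>\<Gamma> 2\<bar> * (y 2)\<^sup>2) + \<eta> * (\<bar>\<Gamma> 3\<bar> * (y 3)\<^sup>2)"
      by (intro add_mono mult_right_mono[OF less_imp_le[OF \<theta>(1)]]) auto
    also have "\<dots> \<le> \<eta> * (M * \<bar>Q\<bar>)"
      using mult_left_mono[OF Mb, of \<eta>] \<eta> by (simp add: algebra_simps)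
    finally have "\<bar>m\<bar> * \<bar>Q\<bar> \<le> \<eta> * M * \<bar>Q\<bar>" by (simp add: abs_mult mult_ac)
    moreover have "\<eta> * M < \<bar>m\<bar>" using m M by (simp add: \<eta>_def divide_simps mult_less_cancel_left)
    ultimately have "\<not> \<bar>Q\<bar> > 0"
      using mult_strict_right_mono[of "\<eta> * M" "\<bar>m\<bar>" "\<bar>Q\<bar>"] by linarith
    then have "Q = 0" by simp
    then have "\<bar>Q\<bar> = 0" by simp
    with b S have "y 1 = 0" "y 2 = 0" "y 3 = 0" by (auto simp: mult_le_0_iff)
    then show "s = vec \<kappa>" using u[of 1] u[of 2] u[of 3] by (simp add: vec_eq_iff forall_3)
  qed
qed

section \<open>Euclidean norms from the indefinite form\<close>

lemma hyp_inner_norm_bound: "\<bar>hyp_inner X Y\<bar> \<le> norm X * norm Y"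
proof -
  define Z :: "real^3" where "Z = vector [Y$1, Y$2, - Y$3]"
  have "norm Z = norm Y" by (simp add: Z_def norm_vec_def L2_set_def sum_3)
  moreover have "hyp_inner X Y = X \<bullet> Z" by (simp add: hyp_inner_def Z_def inner_vec_def sum_3)
  ultimately show ?thesis using Cauchy_Schwarz_ineq2[of X Z] by simp
qed

text \<open>The form is positive definite on the orthogonal complement of a timelike vector, so its
  value at w and the pairing of w with \<mu> together control the Euclidean norm.\<close>

lemma timelike_norm_bound:
  assumes "hyp_inner \<mu> \<mu> < 0"
  obtains C where "C > 0" "\<And>w. (norm w)\<^sup>2 \<le> C * (\<bar>hyp_inner w w\<bar> + (hyp_inner w \<mu>)\<^sup>2)"
proof -
  define n where "n = - hyp_inner \<mu> \<mu>"
  define m where "m = (\<mu>$1)\<^sup>2 + (\<mu>$2)\<^sup>2"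
  have n: "n > 0" using assms by (simp add: n_def)
  have m: "m \<ge> 0" by (simp add: m_def)
  have s: "(\<mu>$3)\<^sup>2 = m + n" by (simp add: n_def m_def hyp_inner_def power2_eq_square)
  \<comment> \<open>Young's inequality (p - h)^2 \<le> (1 + n / (2 m)) p^2 + (1 + 2 m / n) h^2,
    followed by p^2 \<le> v m, produces these coefficients. Since A falls short of m + n by n / 2, a
    positive multiple of (w$3)^2 remains.\<close>
  define A where "A = m + n / 2"
  define B where "B = 1 + 2 * m / n"
  have AB: "A > 0" "B \<ge> 1" using n m by (simp_all add: A_def B_def)
  have main: "n / 2 * (w$3)\<^sup>2 \<le> A * hyp_inner w w + B * (hyp_inner w \<mu>)\<^sup>2" for w :: "real^3"
  proof -
    define v where "v = (w$1)\<^sup>2 + (w$2)\<^sup>2"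
    define p where "p = w$1 * \<mu>$1 + w$2 * \<mu>$2"
    define h where "h = hyp_inner w \<mu>"
    have "v * m - p\<^sup>2 = (w$1 * \<mu>$2 - w$2 * \<mu>$1)\<^sup>2"
      by (simp add: v_def m_def p_def power2_eq_square algebra_simps)
    then have pv: "p\<^sup>2 \<le> v * m" by (smt (verit) zero_le_power2)
    have "(w$3)\<^sup>2 * (m + n) = (p - h)\<^sup>2"
      unfolding s[symmetric] by (simp add: p_def h_def hyp_inner_def power2_eq_square algebra_simps)
    also have "\<dots> \<le> A * v + B * h\<^sup>2"
    proof (cases "m = 0")
      case True
      then have "p = 0" using pv by simp
      then show ?thesis using AB v_def by (simp add: True B_def)
    next
      case False
      then have mp: "m > 0" using m by simp
      have "(p - h)\<^sup>2 \<le> (1 + n / (2 * m)) * p\<^sup>2 + B * h\<^sup>2"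
      proof -
        have "(1 + n / (2 * m)) * p\<^sup>2 + B * h\<^sup>2 - (p - h)\<^sup>2 = (n * p + 2 * m * h)\<^sup>2 / (2 * m * n)"
          using mp n by (simp add: B_def divide_simps power2_eq_square) (simp add: algebra_simps)
        also have "\<dots> \<ge> 0" using mp n by simp
        finally show ?thesis by simp
      qed
      also have "\<dots> \<le> (1 + n / (2 * m)) * (v * m) + B * h\<^sup>2"
        using pv mp n by (intro add_mono mult_left_mono order_refl) auto
      also have "\<dots> = A * v + B * h\<^sup>2" using mp by (simp add: A_def field_simps)
      finally show ?thesis .
    qed
    finally have "(w$3)\<^sup>2 * (m + n) \<le> A * v + B * h\<^sup>2" .
    moreover have "v = hyp_inner w w + (w$3)\<^sup>2" by (simp add: v_def hyp_inner_def power2_eq_square)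
    ultimately show ?thesis by (simp add: A_def h_def algebra_simps)
  qed
  define C where "C = 1 + 4 / n * (A + B)"
  have c0: "4 / n * A \<ge> 0" "4 / n * B \<ge> 0" using AB n by simp_all
  show ?thesis
  proof (rule that[of C])
    show "C > 0" using c0 by (simp add: C_def distrib_left)
    fix w :: "real^3"
    have "(norm w)\<^sup>2 = hyp_inner w w + 4 / n * (n / 2 * (w$3)\<^sup>2)"
      unfolding power2_norm_eq_inner
      using n by (simp add: inner_vec_def sum_3 hyp_inner_def power2_eq_square)
    also have "\<dots> \<le> hyp_inner w w + 4 / n * (A * hyp_inner w w + B * (hyp_inner w \<mu>)\<^sup>2)"
      by (intro add_mono mult_left_mono main) (use n in auto)
    also have "\<dots> = (1 + 4 / n * A) * hyp_inner w w + 4 / n * B * (hyp_inner w \<mu>)\<^sup>2"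
      by (simp add: algebra_simps)
    also have "\<dots> \<le> C * \<bar>hyp_inner w w\<bar> + C * (hyp_inner w \<mu>)\<^sup>2"
    proof (rule add_mono)
      have "(1 + 4 / n * A) * hyp_inner w w \<le> (1 + 4 / n * A) * \<bar>hyp_inner w w\<bar>"
        using c0 by (intro mult_left_mono) auto
      also have "\<dots> \<le> C * \<bar>hyp_inner w w\<bar>"
        using c0 by (intro mult_right_mono) (auto simp: C_def distrib_left)
      finally show "(1 + 4 / n * A) * hyp_inner w w \<le> C * \<bar>hyp_inner w w\<bar>" .
      show "4 / n * B * (hyp_inner w \<mu>)\<^sup>2 \<le> C * (hyp_inner w \<mu>)\<^sup>2"
        using c0 by (intro mult_right_mono) (auto simp: C_def distrib_left)
    qed
    finally show "(norm w)\<^sup>2 \<le> C * (\<bar>hyp_inner w w\<bar> + (hyp_inner w \<mu>)\<^sup>2)"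
      by (simp add: distrib_left)
  qed
qed

section \<open>Conservation laws along trajectories\<close>

lemma zero_derivative_constant:
  fixes f :: "real \<Rightarrow> 'a::real_normed_vector"
  assumes "is_interval I" "\<And>t. t \<in> I \<Longrightarrow> (f has_vector_derivative 0) (at t)" "s \<in> I" "t \<in> I"
  shows "f s = f t"
proof -
  obtain c where "\<And>x. x \<in> I \<Longrightarrow> f x = c"
    using has_vector_derivative_zero_constant[of I f] assms(1,2)
    by (auto simp: is_interval_convex intro: has_vector_derivative_at_within)
  then show ?thesis using assms(3,4) by simp
qed

lemma trajectoryD:
  assumes "trajectory \<Gamma> I X" "t \<in> I"
  shows "X t \<in> phase_space" "(X has_vector_derivative vortex_field \<Gamma> (X t)) (at t)"
  using assms by (auto simp: trajectory_def)

lemma trajectory_continuous: "trajectory \<Gamma> I X \<Longrightarrow> continuous_on I X"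
  by (auto intro!: continuous_at_imp_continuous_on has_vector_derivative_continuous dest: trajectoryD(2))

lemma trajectory_momentum:
  assumes "trajectory \<Gamma> I X" "s \<in> I" "t \<in> I"
  shows "momentum \<Gamma> (X s) = momentum \<Gamma> (X t)"
proof (rule zero_derivative_constant[OF _ _ assms(2,3)])
  show "is_interval I" using assms by (simp add: trajectory_def)
qed (rule solution_derivatives(4)[OF trajectoryD(2)[OF assms(1)]])

lemma trajectory_shape_linear:
  assumes "trajectory \<Gamma> I X" "\<And>r. \<Gamma> r \<noteq> 0" "s \<in> I" "t \<in> I"
  shows "shape_linear \<Gamma> \<kappa> (shape (X s)) = shape_linear \<Gamma> \<kappa> (shape (X t))"
proof (rule zero_derivative_constant[OF _ _ assms(3,4)])
  show "is_interval I" using assms by (simp add: trajectory_def)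
  fix t assume "t \<in> I"
  note d = solution_derivatives(1-3)[OF trajectoryD(2)[OF assms(1) this]]
  note e = DERIV_diff[OF d(1) DERIV_const, THEN DERIV_cdivide]
    DERIV_diff[OF d(2) DERIV_const, THEN DERIV_cdivide] DERIV_diff[OF d(3) DERIV_const, THEN DERIV_cdivide]
  have cancel: "(g * v / pi * b - 0) / g = v / pi * b" if "g \<noteq> 0" for b g v :: real
    using that by simp
  show "((\<lambda>t. shape_linear \<Gamma> \<kappa> (shape (X t))) has_vector_derivative 0) (at t)"
    unfolding has_real_derivative_iff_has_vector_derivative[symmetric] shape_linear_def sum_3
    by (rule DERIV_cong[OF DERIV_add[OF DERIV_add[OF e(1,2)] e(3)]], unfold cancel[OF assms(2)])
      (simp add: algebra_simps del: shape_nth)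
qed

lemma excess_deriv:
  assumes "x > 1"
  shows "(excess \<kappa> has_real_derivative rate x - rate \<kappa>) (at x)"
  unfolding excess_def using rate_prim_deriv[OF assms] by (auto intro!: derivative_eq_intros)

lemma trajectory_shape_energy:
  assumes "trajectory \<Gamma> I X" "\<And>r. \<Gamma> r \<noteq> 0" "s \<in> I" "t \<in> I"
  shows "shape_energy \<Gamma> \<kappa> (shape (X s)) = shape_energy \<Gamma> \<kappa> (shape (X t))"
proof (rule zero_derivative_constant[OF _ _ assms(3,4)])
  show "is_interval I" using assms by (simp add: trajectory_def)
  fix t assume t: "t \<in> I"
  note d = solution_derivatives(1-3)[OF trajectoryD(2)[OF assms(1) t]]
  note g = shape_gt_one[OF trajectoryD(1)[OF assms(1) t]]
  have e: "((\<lambda>t. excess \<kappa> (shape (X t) $ i) / \<Gamma> i) has_real_derivative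
      (rate (shape (X t) $ i) - rate \<kappa>) * D / \<Gamma> i) (at t)"
    if "((\<lambda>t. shape (X t) $ i) has_real_derivative D) (at t)" for i D
    by (rule DERIV_cdivide[OF DERIV_chain2[OF excess_deriv[OF g] that]])
  have cancel: "(a * (g * v / pi * b)) / g = a * (v / pi * b)" if "g \<noteq> 0" for a b g v :: real
    using that by simp
  have "((\<lambda>t. shape_energy \<Gamma> \<kappa> (shape (X t))) has_real_derivative 0) (at t)"
    unfolding shape_energy_def sum_3
    by (rule DERIV_cong[OF DERIV_add[OF DERIV_add[OF e[OF d(1)] e[OF d(2)]] e[OF d(3)]]],
        unfold cancel[OF assms(2)])
      (simp add: algebra_simps diff_divide_distrib del: shape_nth)
  then show "((\<lambda>t. shape_energy \<Gamma> \<kappa> (shape (X t))) has_vector_derivative 0) (at t)"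
    by (simp add: has_real_derivative_iff_has_vector_derivative)
qed

text \<open>A level that is never attained cannot be crossed. In this form the shape, the sign of
  the volume and the choice of the upper sheet are all kept.\<close>

lemma interval_sublevel_trapped:
  fixes f :: "real \<Rightarrow> real"
  assumes "is_interval I" "continuous_on I f" "\<And>t. t \<in> I \<Longrightarrow> f t \<noteq> c" "s \<in> I" "f s < c" "t \<in> I"
  shows "f t < c"
proof (rule ccontr)
  assume c: "\<not> f t < c"
  have "connected (f ` I)"
    using assms(1,2) by (intro connected_continuous_image) (simp_all add: is_interval_connected)
  then have "c \<in> f ` I"
    by (rule connectedD_interval[of _ "f s" "f t"]) (use assms(4-6) c in \<open>simp_all add: less_imp_le\<close>)
  then show False using assms(3) by auto
qed

text \<open>At the equilateral shape the Gram determinant is (\<kappa> - 1)^2 (2 \<kappa> + 1).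
  Hence near it the oriented volume cannot change sign, and its lower bound makes the growth rate
  uniform.\<close>

lemma vol_nonzero_near:
  assumes "\<kappa> > 1"
  obtains r where "r > 0" "\<And>s :: real^3. norm (s - vec \<kappa>) < r \<Longrightarrow> gram (s$1) (s$2) (s$3) > gram \<kappa> \<kappa> \<kappa> / 4"
    "gram \<kappa> \<kappa> \<kappa> > 0"
proof -
  have "gram \<kappa> \<kappa> \<kappa> = (\<kappa> - 1)\<^sup>2 * (2 * \<kappa> + 1)"
    by (simp add: gram_def power2_eq_square algebra_simps)
  then have p: "gram \<kappa> \<kappa> \<kappa> > 0" using assms by simp
  have "isCont (\<lambda>s::real^3. gram (s$1) (s$2) (s$3)) (vec \<kappa>)"
    unfolding gram_def by (intro continuous_intros)
  then have "((\<lambda>s::real^3. gram (s$1) (s$2) (s$3)) \<longlongrightarrow> gram \<kappa> \<kappa> \<kappa>) (at (vec \<kappa>))"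
    by (simp add: isCont_def)
  then have "\<forall>\<^sub>F s::real^3 in at (vec \<kappa>). gram \<kappa> \<kappa> \<kappa> / 4 < gram (s$1) (s$2) (s$3)"
    by (rule order_tendstoD) (use p in auto)
  then obtain r where r: "r > 0" "\<And>s::real^3. s \<noteq> vec \<kappa> \<Longrightarrow> dist s (vec \<kappa>) < r \<Longrightarrow> gram \<kappa> \<kappa> \<kappa> / 4 < gram (s$1) (s$2) (s$3)"
    unfolding eventually_at by blast
  show ?thesis
  proof (rule that[OF r(1) _ p])
    show "gram (s$1) (s$2) (s$3) > gram \<kappa> \<kappa> \<kappa> / 4" if "norm (s - vec \<kappa>) < r" for s :: "real^3"
      using r(2)[of s] that p by (cases "s = vec \<kappa>") (auto simp: dist_norm)
  qed
qed

section \<open>Compactness modulo the isotropy group of the momentum\<close>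

lemma momentum_timelike:
  assumes "X \<in> phase_space" "shape X = vec \<kappa>" "\<kappa> > 1" "sigma2 \<Gamma> > 0"
  shows "hyp_inner (momentum \<Gamma> X) (momentum \<Gamma> X) < 0"
proof -
  have "hyp_inner (momentum \<Gamma> X) (momentum \<Gamma> X)
     = - ((\<Gamma> 1)\<^sup>2 + (\<Gamma> 2)\<^sup>2 + (\<Gamma> 3)\<^sup>2 + 2 * (\<kappa> * sigma2 \<Gamma>))"
    unfolding hyp_inner_momentum[OF assms(1)] assms(2) sigma2_def by (simp add: algebra_simps)
  also have "\<dots> < 0"
    using assms(3,4) zero_le_power2[of "\<Gamma> 1"] zero_le_power2[of "\<Gamma> 2"] zero_le_power2[of "\<Gamma> 3"]
      mult_pos_pos[of \<kappa> "sigma2 \<Gamma>"] by linarith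
  finally show ?thesis .
qed

text \<open>Closeness of \<open>Y\<close> to the orbit of \<open>Xe\<close> is expressed by functions invariant under the
  isotropy group of the momentum, so that no control on the group elements is needed. Compactness
  enters through the momentum being timelike.\<close>

lemma invariants_control_orbit:
  assumes Xe: "Xe \<in> phase_space" "shape Xe = vec \<kappa>" and \<kappa>: "\<kappa> > 1" and S: "sigma2 \<Gamma> > 0"
    and \<mu>: "\<mu> = momentum \<Gamma> Xe" and V: "invariant_open_nbhd (isotropy \<mu>) Xe V"
  obtains \<epsilon> where "\<epsilon> > 0"
    "\<And>Y. Y \<in> phase_space \<Longrightarrow> norm (shape Y - vec \<kappa>) < \<epsilon> \<Longrightarrow> vol Y * vol Xe > 0 \<Longrightarrow>
       \<bar>hyp_inner (momentum \<Gamma> Y - \<mu>) \<mu>\<bar> < \<epsilon> \<Longrightarrow> Y \<in> V"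
proof (rule ccontr)
  assume "\<not> thesis"
  with that have neg: "\<exists>Y. Y \<in> phase_space \<and> norm (shape Y - vec \<kappa>) < \<epsilon> \<and> vol Y * vol Xe > 0 \<and>
       \<bar>hyp_inner (momentum \<Gamma> Y - \<mu>) \<mu>\<bar> < \<epsilon> \<and> Y \<notin> V" if "\<epsilon> > 0" for \<epsilon> :: real
    using \<open>\<epsilon> > 0\<close> by blast
  have "\<exists>Y. \<forall>n::nat. Y n \<in> phase_space \<and> norm (shape (Y n) - vec \<kappa>) < inverse (real (Suc n)) \<and>
      vol (Y n) * vol Xe > 0 \<and> \<bar>hyp_inner (momentum \<Gamma> (Y n) - \<mu>) \<mu>\<bar> < inverse (real (Suc n)) \<and> Y n \<notin> V"
    by (intro choice allI neg) simp
  then obtain Y where Y: "\<And>n::nat. Y n \<in> phase_space"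
      "\<And>n. norm (shape (Y n) - vec \<kappa>) < inverse (real (Suc n))"
      "\<And>n. vol (Y n) * vol Xe > 0"
      "\<And>n. \<bar>hyp_inner (momentum \<Gamma> (Y n) - \<mu>) \<mu>\<bar> < inverse (real (Suc n))" "\<And>n. Y n \<notin> V"
    by blast
  have "(\<lambda>n. shape (Y n) - vec \<kappa>) \<longlonglongrightarrow> 0"
    by (rule Lim_null_comparison[OF always_eventually LIMSEQ_inverse_real_of_nat])
      (use Y(2) less_imp_le in blast)
  then have shape_lim: "(\<lambda>n. shape (Y n)) \<longlonglongrightarrow> vec \<kappa>" by (simp add: LIM_zero_iff)
  define w where "w n = momentum \<Gamma> (Y n) - \<mu>" for n
  have w\<mu>: "(\<lambda>n. hyp_inner (w n) \<mu>) \<longlonglongrightarrow> 0"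
    by (rule Lim_null_comparison[OF always_eventually LIMSEQ_inverse_real_of_nat])
      (use Y(4) less_imp_le in \<open>auto simp: w_def\<close>)
  \<comment> \<open>The form of the momentum is a function of the shape and converges with it.
    Expanding the square of \<mu> + \<open>w n\<close> then gives convergence of the form of
    \<open>w n\<close> to 0.\<close>
  have "(\<lambda>n. hyp_inner (momentum \<Gamma> (Y n)) (momentum \<Gamma> (Y n))) \<longlonglongrightarrow> hyp_inner \<mu> \<mu>"
    unfolding \<mu> hyp_inner_momentum[OF Xe(1)] hyp_inner_momentum[OF Y(1)] Xe(2)
    by (intro tendsto_intros shape_lim)
  then have "(\<lambda>n. (hyp_inner (momentum \<Gamma> (Y n)) (momentum \<Gamma> (Y n)) - hyp_inner \<mu> \<mu>) - 2 * hyp_inner (w n) \<mu>)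
      \<longlonglongrightarrow> (hyp_inner \<mu> \<mu> - hyp_inner \<mu> \<mu>) - 2 * 0"
    by (rule tendsto_diff[OF tendsto_diff[OF _ tendsto_const] tendsto_mult[OF tendsto_const w\<mu>]])
  moreover have "(hyp_inner (momentum \<Gamma> (Y n)) (momentum \<Gamma> (Y n)) - hyp_inner \<mu> \<mu>) - 2 * hyp_inner (w n) \<mu>
      = hyp_inner (w n) (w n)" for n
    by (simp add: w_def hyp_inner_simps hyp_inner_commute[of \<mu> "momentum \<Gamma> (Y n)"])
  ultimately have ww: "(\<lambda>n. hyp_inner (w n) (w n)) \<longlonglongrightarrow> 0" by simp
  obtain C where C: "C > 0" "\<And>w. (norm w)\<^sup>2 \<le> C * (\<bar>hyp_inner w w\<bar> + (hyp_inner w \<mu>)\<^sup>2)"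
    using timelike_norm_bound[of \<mu>] momentum_timelike[OF Xe \<kappa> S] unfolding \<mu> by blast
  have "(\<lambda>n. C * (\<bar>hyp_inner (w n) (w n)\<bar> + (hyp_inner (w n) \<mu>)\<^sup>2)) \<longlonglongrightarrow> C * (\<bar>0\<bar> + 0\<^sup>2)"
    by (rule tendsto_mult[OF tendsto_const tendsto_add[OF tendsto_rabs[OF ww] tendsto_power[OF w\<mu>]]])
  then have C0: "(\<lambda>n. C * (\<bar>hyp_inner (w n) (w n)\<bar> + (hyp_inner (w n) \<mu>)\<^sup>2)) \<longlonglongrightarrow> 0"
    by (simp only: abs_zero power_zero_numeral add_0 mult_zero_right)
  have norm_w: "(\<lambda>n. (norm (w n))\<^sup>2) \<longlonglongrightarrow> 0"
    by (rule tendsto_sandwich[OF always_eventually always_eventually tendsto_const C0])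
      (intro allI zero_le_power2 C(2))+
  then have "(\<lambda>n. sqrt ((norm (w n))\<^sup>2)) \<longlonglongrightarrow> sqrt 0" by (rule tendsto_real_sqrt)
  then have w0: "w \<longlonglongrightarrow> 0" by (simp only: real_sqrt_abs abs_norm_cancel real_sqrt_zero tendsto_norm_zero_iff)
  \<comment> \<open>The pairing with \<mu> is bounded only up to a term in the norm of
    \<open>Y n $ r\<close> itself; below this threshold that term is at most half the left side and
    can be absorbed.\<close>
  have "\<forall>\<^sub>F n in sequentially. (norm (w n))\<^sup>2 < 1 / (4 * C)"
    by (rule order_tendstoD(2)[OF norm_w]) (use C in simp)
  then obtain N where N: "\<And>n. n \<ge> N \<Longrightarrow> (norm (w n))\<^sup>2 < 1 / (4 * C)"
    by (auto simp: eventually_sequentially)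
  define B where "B = (\<Sum>i\<in>UNIV. \<bar>\<Gamma> i\<bar>) * (1 + 3 * (\<kappa> + 1))"
  have bnd: "(norm (Y n $ r))\<^sup>2 \<le> 2 * C * (1 + 2 * B\<^sup>2)" if "n \<ge> N" for n r
  proof -
    have "\<bar>shape (Y n) $ i - \<kappa>\<bar> \<le> 1" for i
      using component_le_norm_cart[of "shape (Y n) - vec \<kappa>" i] Y(2)[of n]
        inverse_le_1_iff[of "real (Suc n)"] by simp
    then have "shape (Y n) $ i \<le> \<kappa> + 1" for i by (smt (verit))
    then have "(\<Sum>i\<in>UNIV. shape (Y n) $ i) \<le> (\<Sum>i\<in>(UNIV::3 set). \<kappa> + 1)" by (intro sum_mono)
    then have "(\<Sum>i\<in>UNIV. \<bar>\<Gamma> i\<bar>) * (1 + (\<Sum>i\<in>UNIV. shape (Y n) $ i)) \<le> B"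
      unfolding B_def by (intro mult_left_mono) (auto simp: sum_nonneg)
    then have JB: "\<bar>hyp_inner (momentum \<Gamma> (Y n)) (Y n $ r)\<bar> \<le> B"
      using hyp_inner_momentum_nth[OF Y(1)] order_trans by blast
    let ?x = "norm (Y n $ r)" and ?w = "norm (w n)"
    have "\<bar>hyp_inner (Y n $ r) \<mu>\<bar> = \<bar>hyp_inner (momentum \<Gamma> (Y n)) (Y n $ r) - hyp_inner (Y n $ r) (w n)\<bar>"
      by (simp add: w_def hyp_inner_simps hyp_inner_commute[of "momentum \<Gamma> (Y n)"])
    also have "\<dots> \<le> B + ?x * ?w"
      using JB hyp_inner_norm_bound[of "Y n $ r" "w n"] by linarith
    finally have "(hyp_inner (Y n $ r) \<mu>)\<^sup>2 \<le> (B + ?x * ?w)\<^sup>2" by (rule abs_le_square_iff[THEN iffD1, OF order_trans]) simp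
    also have "\<dots> \<le> 2 * B\<^sup>2 + 2 * ?x\<^sup>2 * ?w\<^sup>2"
      using zero_le_power2[of "B - ?x * ?w"] by (simp add: power2_eq_square algebra_simps)
    finally have "(hyp_inner (Y n $ r) \<mu>)\<^sup>2 \<le> 2 * B\<^sup>2 + 2 * ?x\<^sup>2 * ?w\<^sup>2" .
    moreover have "hyp_inner (Y n $ r) (Y n $ r) = -1"
      using Y(1)[of n] by (simp add: phase_space_def hyp_plane_iff)
    ultimately have "\<bar>hyp_inner (Y n $ r) (Y n $ r)\<bar> + (hyp_inner (Y n $ r) \<mu>)\<^sup>2
        \<le> 1 + (2 * B\<^sup>2 + 2 * ?x\<^sup>2 * ?w\<^sup>2)" by simp
    then have "C * (\<bar>hyp_inner (Y n $ r) (Y n $ r)\<bar> + (hyp_inner (Y n $ r) \<mu>)\<^sup>2)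
        \<le> C * (1 + (2 * B\<^sup>2 + 2 * ?x\<^sup>2 * ?w\<^sup>2))"
      using C(1) by (intro mult_left_mono) auto
    then have "?x\<^sup>2 \<le> C * (1 + (2 * B\<^sup>2 + 2 * ?x\<^sup>2 * ?w\<^sup>2))"
      using C(2) order_trans by blast
    also have "\<dots> \<le> C * (1 + (2 * B\<^sup>2 + 2 * ?x\<^sup>2 * (1 / (4 * C))))"
      using C(1) N[OF that] by (intro mult_left_mono add_left_mono) auto
    also have "\<dots> = C * (1 + 2 * B\<^sup>2) + ?x\<^sup>2 / 2" using C(1) by (simp add: field_simps)
    finally show ?thesis by simp
  qed
  have "bounded (range (\<lambda>n. Y (n + N)))"
  proof (rule boundedI)
    fix x assume "x \<in> range (\<lambda>n. Y (n + N))"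
    then obtain n where x: "x = Y (n + N)" by blast
    have "norm x \<le> (\<Sum>r\<in>UNIV. norm (x$r))" by (simp add: norm_vec_def L2_set_le_sum)
    also have "\<dots> \<le> (\<Sum>r\<in>(UNIV::3 set). sqrt (2 * C * (1 + 2 * B\<^sup>2)))"
      unfolding x by (intro sum_mono real_le_rsqrt bnd) simp
    finally show "norm x \<le> (\<Sum>r\<in>(UNIV::3 set). sqrt (2 * C * (1 + 2 * B\<^sup>2)))" .
  qed
  then obtain Z f where f: "strict_mono f" and Z: "((\<lambda>n. Y (n + N)) \<circ> f) \<longlonglongrightarrow> Z"
    using bounded_imp_convergent_subsequence by blast
  define k where "k n = f n + N" for n
  have k: "filterlim k sequentially sequentially"
    using filterlim_subseq[OF f] unfolding k_def
    by (rule filterlim_at_top_mono) simp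
  have Z: "(\<lambda>n. Y (k n)) \<longlonglongrightarrow> Z" using Z by (simp add: k_def o_def)
  have lim: "(\<lambda>n. F (Y (k n))) \<longlonglongrightarrow> F Z" if "continuous_on UNIV F"
    for F :: "config \<Rightarrow> 'b::topological_space"
    using continuous_on_tendsto_compose[OF that Z] by simp
  have "(\<lambda>n. shape (Y (k n))) \<longlonglongrightarrow> shape Z" by (intro lim continuous_intros)
  then have shapeZ: "shape Z = vec \<kappa>"
    using filterlim_compose[OF shape_lim k] LIMSEQ_unique by blast
  have "(\<lambda>n. momentum \<Gamma> (Y (k n))) \<longlonglongrightarrow> momentum \<Gamma> Z" by (intro lim continuous_intros)
  moreover have "(\<lambda>n. w (k n) + \<mu>) \<longlonglongrightarrow> 0 + \<mu>"
    by (intro tendsto_intros filterlim_compose[OF w0 k])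
  ultimately have JZ: "momentum \<Gamma> Z = \<mu>" using LIMSEQ_unique by (fastforce simp: w_def)
  have "Z $ r \<in> hyp_plane" for r
  proof -
    have a: "(\<lambda>n. hyp_inner (Y (k n) $ r) (Y (k n) $ r)) \<longlonglongrightarrow> hyp_inner (Z $ r) (Z $ r)"
      "(\<lambda>n. Y (k n) $ r $ 3) \<longlonglongrightarrow> Z $ r $ 3"
      by (intro lim continuous_intros)+
    \<comment> \<open>The bound 1 passes to the limit, which strict positivity of the third
      coordinate would not.\<close>
    have "hyp_inner (Y n $ r) (Y n $ r) = -1" "Y n $ r $ 3 \<ge> 1" for n
      using Y(1)[of n] hyp_plane_coord_le(1) by (simp_all add: phase_space_def hyp_plane_iff)
    then have "hyp_inner (Z $ r) (Z $ r) = -1" "Z $ r $ 3 \<ge> 1"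
      using a LIMSEQ_le_const[OF a(2), of 1] by (simp_all add: LIMSEQ_const_iff)
    then show ?thesis by (simp add: hyp_plane_iff)
  qed
  then have Zp: "Z \<in> phase_space"
    by (rule phase_space_shape) (use \<kappa> in \<open>simp add: shapeZ\<close>)
  have "(\<lambda>n. vol (Y (k n)) * vol Xe) \<longlonglongrightarrow> vol Z * vol Xe" by (intro lim continuous_intros)
  then have "vol Z * vol Xe \<ge> 0" using Y(3) by (intro LIMSEQ_le_const) (auto intro: less_imp_le)
  moreover have "(vol Z)\<^sup>2 = (vol Xe)\<^sup>2" by (simp only: vol_sq[OF Zp] vol_sq[OF Xe(1)] shapeZ Xe(2))
  ultimately have "vol Xe = vol Z"
    by (auto simp: power2_eq_iff) (simp add: mult_le_0_iff flip: power2_eq_square)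
  then obtain g where g: "g \<in> SL2" "sl2_act_config g Xe = Z"
    using phase_space_congruent[OF Xe(1) Zp] shapeZ Xe(2) by metis
  \<comment> \<open>Both configurations have momentum \<mu>, and the momentum is equivariant, so
    \<open>g\<close> lies in the isotropy group without having been chosen there.\<close>
  have "sl2_act g \<mu> = \<mu>"
    using sl2_act_config_invariants(3)[OF g(1), of \<Gamma> Xe] g JZ \<mu> by simp
  then have "Z \<in> V" using V g by (auto simp: invariant_open_nbhd_def isotropy_def)
  obtain T where T: "open T" "V = phase_space \<inter> T"
    using V by (auto simp: invariant_open_nbhd_def openin_open)
  have "\<forall>\<^sub>F n in sequentially. Y (k n) \<in> T"
    using topological_tendstoD[OF Z T(1)] \<open>Z \<in> V\<close> T(2) by blast
  then obtain n where "Y (k n) \<in> T" by (auto simp: eventually_sequentially)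
  then show False using T(2) Y(1,5) by blast
qed

section \<open>Stability for positive \<open>sigma2\<close>\<close>

lemma continuous_on_shape_energy:
  fixes f :: "'a::topological_space \<Rightarrow> real^3"
  assumes "continuous_on S f" "\<And>x i. x \<in> S \<Longrightarrow> f x $ i > 1" "\<And>r. \<Gamma> r \<noteq> 0"
  shows "continuous_on S (\<lambda>x. shape_energy \<Gamma> \<kappa> (f x))"
proof -
  have e: "continuous_on {1<..} (excess \<kappa>)"
    using excess_deriv by (auto intro!: continuous_at_imp_continuous_on DERIV_isCont)
  have "continuous_on S (\<lambda>x. excess \<kappa> (f x $ i))" for i
    by (rule continuous_on_compose2[OF e]) (use assms(2) in \<open>auto intro!: continuous_intros assms(1)\<close>)
  then show ?thesis
    unfolding shape_energy_def using assms(3) by (intro continuous_intros) auto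
qed

lemma continuous_on_shape_linear:
  fixes f :: "'a::topological_space \<Rightarrow> real^3"
  assumes "continuous_on S f" "\<And>r. \<Gamma> r \<noteq> 0"
  shows "continuous_on S (\<lambda>x. shape_linear \<Gamma> \<kappa> (f x))"
  unfolding shape_linear_def using assms by (intro continuous_intros) auto

lemma openin_less_real:
  fixes h :: "'a::topological_space \<Rightarrow> real"
  assumes "continuous_on S h"
  shows "openin (top_of_set S) {x \<in> S. h x < c}"
proof -
  have "{x \<in> S. h x < c} = S \<inter> h -` {..<c}" by auto
  then show ?thesis using continuous_openin_preimage_gen[OF assms open_lessThan] by simp
qed

lemma openin_greater_real:
  fixes h :: "'a::topological_space \<Rightarrow> real"
  assumes "continuous_on S h"
  shows "openin (top_of_set S) {x \<in> S. h x > c}"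
  using openin_less_real[of S "\<lambda>x. - h x" "- c"] assms by (simp add: continuous_on_minus)

text \<open>\<open>U\<close> is cut out by functions invariant under the isotropy group. Two of
  them, \<open>N\<close> of the shape and the pairing with \<mu>, are conserved; the first traps the
  shape, and a trapped shape fixes the sign of the volume.\<close>

lemma equilateral_stable:
  assumes Xe: "Xe \<in> phase_space" "shape Xe = vec \<kappa>" and \<kappa>: "\<kappa> > 1"
    and \<Gamma>: "\<And>r. \<Gamma> r \<noteq> 0" and S: "sigma2 \<Gamma> > 0" and \<mu>: "\<mu> = momentum \<Gamma> Xe"
  shows "G_stable \<Gamma> (isotropy \<mu>) Xe"
  unfolding G_stable_def
proof (intro allI impI)
  fix V assume V: "invariant_open_nbhd (isotropy \<mu>) Xe V"
  obtain \<epsilon> where \<epsilon>: "\<epsilon> > 0"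
    "\<And>Y. Y \<in> phase_space \<Longrightarrow> norm (shape Y - vec \<kappa>) < \<epsilon> \<Longrightarrow> vol Y * vol Xe > 0 \<Longrightarrow>
       \<bar>hyp_inner (momentum \<Gamma> Y - \<mu>) \<mu>\<bar> < \<epsilon> \<Longrightarrow> Y \<in> V"
    using invariants_control_orbit[OF Xe \<kappa> S \<mu> V] by blast
  obtain r0 where r0: "r0 > 0" "r0 < \<kappa> - 1"
    "\<And>s. (\<And>i. \<bar>s$i - \<kappa>\<bar> \<le> r0) \<Longrightarrow> shape_linear \<Gamma> \<kappa> s = 0 \<Longrightarrow> shape_energy \<Gamma> \<kappa> s = 0 \<Longrightarrow> s = vec \<kappa>"
    using shape_energy_isolated[OF \<kappa> \<Gamma> S] by blast
  obtain rg where rg: "rg > 0"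
    "\<And>s :: real^3. norm (s - vec \<kappa>) < rg \<Longrightarrow> gram (s$1) (s$2) (s$3) > gram \<kappa> \<kappa> \<kappa> / 4" "gram \<kappa> \<kappa> \<kappa> > 0"
    using vol_nonzero_near[OF \<kappa>] by blast
  define r where "r = min \<epsilon> (min r0 rg)"
  have r: "r > 0" "r \<le> \<epsilon>" "r \<le> r0" "r \<le> rg" using \<epsilon>(1) r0(1) rg(1) by (auto simp: r_def)
  define N where "N s = \<bar>shape_linear \<Gamma> \<kappa> s\<bar> + \<bar>shape_energy \<Gamma> \<kappa> s\<bar>" for s
  let ?K = "sphere (vec \<kappa> :: real^3) r"
  have K: "\<bar>s$i - \<kappa>\<bar> \<le> r" if "s \<in> ?K" for s i
    using component_le_norm_cart[of "s - vec \<kappa>" i] that by (simp add: dist_norm norm_minus_commute)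
  have "continuous_on ?K N"
    unfolding N_def
    by (intro continuous_on_add continuous_on_rabs continuous_on_shape_energy continuous_on_shape_linear
        continuous_on_id \<Gamma>) (use K r0(2) r(3) in \<open>smt (verit)\<close>)
  moreover have "?K \<noteq> {}" using r(1) by simp
  \<comment> \<open>The minimum of \<open>N\<close> on the sphere is the height of a barrier.
    Isolation of the equilateral shape makes it positive, and a trajectory starting below it can
    never meet the sphere, as \<open>N\<close> is conserved.\<close>
  ultimately obtain s0 where s0: "s0 \<in> ?K" "\<And>s. s \<in> ?K \<Longrightarrow> N s0 \<le> N s"
    using continuous_attains_inf[OF compact_sphere] by blast
  have "N s0 \<noteq> 0"
  proof
    assume "N s0 = 0"
    then have "shape_linear \<Gamma> \<kappa> s0 = 0" "shape_energy \<Gamma> \<kappa> s0 = 0" by (simp_all add: N_def)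
    moreover have "\<bar>s0$i - \<kappa>\<bar> \<le> r0" for i using K[OF s0(1), of i] r(3) by linarith
    ultimately have "s0 = vec \<kappa>" by (rule r0(3)[rotated 1])
    then show False using s0(1) r(1) by simp
  qed
  then have \<eta>: "N s0 > 0" by (simp add: N_def order_less_le)
  define U where "U = {Y \<in> phase_space. norm (shape Y - vec \<kappa>) < r \<and> N (shape Y) < N s0 \<and>
      vol Y * vol Xe > 0 \<and> \<bar>hyp_inner (momentum \<Gamma> Y - \<mu>) \<mu>\<bar> < \<epsilon>}"
  have volXe: "(vol Xe)\<^sup>2 = gram \<kappa> \<kappa> \<kappa>" using vol_sq[OF Xe(1)] unfolding Xe(2) by simp
  have nbhd: "invariant_open_nbhd (isotropy \<mu>) Xe U"
    unfolding invariant_open_nbhd_def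
  proof (intro conjI ballI)
    have "continuous_on phase_space (\<lambda>Y. N (shape Y))"
      unfolding N_def
      by (intro continuous_on_add continuous_on_rabs continuous_on_shape_energy continuous_on_shape_linear
        continuous_on_shape continuous_on_id \<Gamma> shape_gt_one)
    then have "openin (top_of_set phase_space) ({Y \<in> phase_space. norm (shape Y - vec \<kappa>) < r} \<inter>
       {Y \<in> phase_space. N (shape Y) < N s0} \<inter> {Y \<in> phase_space. vol Y * vol Xe > 0} \<inter>
       {Y \<in> phase_space. \<bar>hyp_inner (momentum \<Gamma> Y - \<mu>) \<mu>\<bar> < \<epsilon>})"
      by (intro openin_Int openin_less_real openin_greater_real continuous_intros)
    moreover have "\<dots> = U" by (auto simp: U_def)
    ultimately show "openin (top_of_set phase_space) U" by (simp only:)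
    show "Xe \<in> U"
      using Xe r(1) \<eta> \<epsilon>(1) volXe rg(3)
      by (auto simp: U_def N_def shape_linear_def shape_energy_def excess_def \<mu> hyp_inner_def power2_eq_square)
  next
    fix g Y assume g: "g \<in> isotropy \<mu>" and Y: "Y \<in> U"
    have gS: "g \<in> SL2" "sl2_act g \<mu> = \<mu>" using g by (auto simp: isotropy_def)
    \<comment> \<open>Both arguments are moved by \<open>g\<close>, the second one trivially. This
      is where \<open>g\<close> must fix \<mu>.\<close>
    have "hyp_inner (momentum \<Gamma> (sl2_act_config g Y) - \<mu>) \<mu> = hyp_inner (sl2_act g (momentum \<Gamma> Y - \<mu>)) (sl2_act g \<mu>)"
      by (simp add: sl2_act_config_invariants[OF gS(1)] linear_diff[OF sl2_act_linear] gS(2))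
    also have "\<dots> = hyp_inner (momentum \<Gamma> Y - \<mu>) \<mu>" by (rule hyp_inner_sl2_act[OF gS(1)])
    finally show "sl2_act_config g Y \<in> U"
      using Y by (simp add: U_def sl2_act_config_invariants[OF gS(1)] sl2_act_config_phase_space[OF gS(1)])
  qed
  have "X t \<in> V" if tr: "trajectory \<Gamma> I X" and s: "s \<in> I" "X s \<in> U" and t: "t \<in> I" for I X s t
  proof -
    have I: "is_interval I" using tr by (simp add: trajectory_def)
    have cont: "continuous_on I X" by (rule trajectory_continuous[OF tr])
    have N: "N (shape (X u)) = N (shape (X s))" if "u \<in> I" for u
      unfolding N_def trajectory_shape_linear[OF tr \<Gamma> that s(1)] trajectory_shape_energy[OF tr \<Gamma> that s(1)] ..
    have near: "norm (shape (X u) - vec \<kappa>) < r" if u: "u \<in> I" for u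
    proof (rule interval_sublevel_trapped[OF I _ _ s(1) _ u])
      show "continuous_on I (\<lambda>t. norm (shape (X t) - vec \<kappa>))" by (intro continuous_intros cont)
      show "norm (shape (X s) - vec \<kappa>) < r" using s(2) by (simp add: U_def)
      fix v assume v: "v \<in> I"
      show "norm (shape (X v) - vec \<kappa>) \<noteq> r"
      proof
        assume "norm (shape (X v) - vec \<kappa>) = r"
        then have "N s0 \<le> N (shape (X v))"
          by (intro s0(2)) (simp add: dist_norm norm_minus_commute)
        then show False using N[OF v] s(2) by (simp add: U_def)
      qed
    qed
    have "- (vol (X t) * vol Xe) < 0"
    proof (rule interval_sublevel_trapped[OF I _ _ s(1) _ t])
      show "continuous_on I (\<lambda>t. - (vol (X t) * vol Xe))" by (intro continuous_intros cont)
      show "- (vol (X s) * vol Xe) < 0" using s(2) by (simp add: U_def)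
      fix v assume v: "v \<in> I"
      have "(vol (X v))\<^sup>2 > 0"
        using vol_sq[OF trajectoryD(1)[OF tr v]] rg(2)[of "shape (X v)"] near[OF v] r(4) rg(3) by simp
      then show "- (vol (X v) * vol Xe) \<noteq> 0" using volXe rg(3) by auto
    qed
    moreover have "\<bar>hyp_inner (momentum \<Gamma> (X t) - \<mu>) \<mu>\<bar> < \<epsilon>"
      using trajectory_momentum[OF tr t s(1)] s(2) by (simp add: U_def)
    ultimately show ?thesis
      using \<epsilon>(2)[OF trajectoryD(1)[OF tr t]] near[OF t] r(2) by simp
  qed
  then show "\<exists>U. invariant_open_nbhd (isotropy \<mu>) Xe U \<and>
      (\<forall>I X. trajectory \<Gamma> I X \<and> (\<exists>t\<in>I. X t \<in> U) \<longrightarrow> (\<forall>t\<in>I. X t \<in> V))"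
    using nbhd by blast
qed

subsection \<open>Trajectories confined near an equilateral configuration\<close>

text \<open>Boundedness is included because products of Lipschitz functions need it to be Lipschitz.
  The class is then closed under all operations from which the modified field is built.\<close>

definition bdd_lipschitz :: "('a::real_normed_vector \<Rightarrow> real) \<Rightarrow> bool" where
  "bdd_lipschitz f \<longleftrightarrow> (\<exists>M\<ge>0. \<exists>L\<ge>0. (\<forall>x. \<bar>f x\<bar> \<le> M) \<and> (\<forall>x y. \<bar>f x - f y\<bar> \<le> L * norm (x - y)))"

lemma bdd_lipschitzI:
  assumes "M \<ge> 0" "L \<ge> 0" "\<And>x. \<bar>f x\<bar> \<le> M" "\<And>x y. \<bar>f x - f y\<bar> \<le> L * norm (x - y)"
  shows "bdd_lipschitz f"
  using assms unfolding bdd_lipschitz_def by blast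

lemma bdd_lipschitzE:
  assumes "bdd_lipschitz f"
  obtains M L where "M \<ge> 0" "L \<ge> 0" "\<And>x. \<bar>f x\<bar> \<le> M" "\<And>x y. \<bar>f x - f y\<bar> \<le> L * norm (x - y)"
  using assms unfolding bdd_lipschitz_def by blast

lemma bdd_lipschitz_const: "bdd_lipschitz (\<lambda>x. c)"
  by (rule bdd_lipschitzI[of "\<bar>c\<bar>" 0]) auto

lemma bdd_lipschitz_add:
  assumes "bdd_lipschitz f" "bdd_lipschitz g"
  shows "bdd_lipschitz (\<lambda>x. f x + g x)"
proof -
  obtain M L where f: "M \<ge> 0" "L \<ge> 0" "\<And>x. \<bar>f x\<bar> \<le> M" "\<And>x y. \<bar>f x - f y\<bar> \<le> L * norm (x - y)"
    using bdd_lipschitzE[OF assms(1)] by blast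
  obtain M' L' where g: "M' \<ge> 0" "L' \<ge> 0" "\<And>x. \<bar>g x\<bar> \<le> M'" "\<And>x y. \<bar>g x - g y\<bar> \<le> L' * norm (x - y)"
    using bdd_lipschitzE[OF assms(2)] by blast
  show ?thesis
  proof (rule bdd_lipschitzI[of "M + M'" "L + L'"])
    show "\<bar>f x + g x\<bar> \<le> M + M'" for x using f(3)[of x] g(3)[of x] by linarith
    show "\<bar>f x + g x - (f y + g y)\<bar> \<le> (L + L') * norm (x - y)" for x y
      using f(4)[of x y] g(4)[of x y] by (simp add: distrib_right)
  qed (use f g in auto)
qed

lemma bdd_lipschitz_mult:
  assumes "bdd_lipschitz f" "bdd_lipschitz g"
  shows "bdd_lipschitz (\<lambda>x. f x * g x)"
proof -
  obtain M L where f: "M \<ge> 0" "L \<ge> 0" "\<And>x. \<bar>f x\<bar> \<le> M" "\<And>x y. \<bar>f x - f y\<bar> \<le> L * norm (x - y)"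
    using bdd_lipschitzE[OF assms(1)] by blast
  obtain M' L' where g: "M' \<ge> 0" "L' \<ge> 0" "\<And>x. \<bar>g x\<bar> \<le> M'" "\<And>x y. \<bar>g x - g y\<bar> \<le> L' * norm (x - y)"
    using bdd_lipschitzE[OF assms(2)] by blast
  show ?thesis
  proof (rule bdd_lipschitzI[of "M * M'" "M * L' + M' * L"])
    show "\<bar>f x * g x\<bar> \<le> M * M'" for x
      unfolding abs_mult by (intro mult_mono f g) auto
    fix x y
    have "f x * g x - f y * g y = f x * (g x - g y) + g y * (f x - f y)" by (simp add: algebra_simps)
    then have "\<bar>f x * g x - f y * g y\<bar> \<le> \<bar>f x\<bar> * \<bar>g x - g y\<bar> + \<bar>g y\<bar> * \<bar>f x - f y\<bar>"
      by (metis abs_mult abs_triangle_ineq)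
    also have "\<dots> \<le> M * (L' * norm (x - y)) + M' * (L * norm (x - y))"
      by (intro add_mono mult_mono f g) (use f g in auto)
    finally show "\<bar>f x * g x - f y * g y\<bar> \<le> (M * L' + M' * L) * norm (x - y)"
      by (simp add: algebra_simps)
  qed (use f g in auto)
qed

lemma bdd_lipschitz_diff:
  assumes "bdd_lipschitz f" "bdd_lipschitz g"
  shows "bdd_lipschitz (\<lambda>x. f x - g x)"
  using bdd_lipschitz_add[OF assms(1) bdd_lipschitz_mult[OF bdd_lipschitz_const[of "-1"] assms(2)]] by simp

lemma bdd_lipschitz_sum:
  assumes "\<And>i. i \<in> A \<Longrightarrow> bdd_lipschitz (f i)"
  shows "bdd_lipschitz (\<lambda>x. \<Sum>i\<in>A. f i x)"
proof (cases "finite A")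
  case True
  then show ?thesis using assms
    by (induction A) (auto intro: bdd_lipschitz_const bdd_lipschitz_add)
qed (simp add: bdd_lipschitz_const)

lemma bdd_lipschitz_inverse_max:
  assumes "bdd_lipschitz f" "\<epsilon> > 0"
  shows "bdd_lipschitz (\<lambda>x. 1 / max \<epsilon> (f x))"
proof -
  obtain M L where f: "M \<ge> 0" "L \<ge> 0" "\<And>x. \<bar>f x\<bar> \<le> M" "\<And>x y. \<bar>f x - f y\<bar> \<le> L * norm (x - y)"
    using bdd_lipschitzE[OF assms(1)] by blast
  show ?thesis
  proof (rule bdd_lipschitzI[of "1 / \<epsilon>" "L / \<epsilon>\<^sup>2"])
    have "1 / a \<le> 1 / \<epsilon>" if "a \<ge> \<epsilon>" for a using that assms(2) by (simp add: frac_le)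
    moreover have "max \<epsilon> (f x) > 0" for x using assms(2) by (simp add: less_max_iff_disj)
    ultimately show "\<bar>1 / max \<epsilon> (f x)\<bar> \<le> 1 / \<epsilon>" for x using less_imp_le abs_of_pos by (simp del: max_less_iff_conj)
    fix x y
    let ?a = "max \<epsilon> (f x)" and ?b = "max \<epsilon> (f y)"
    have ab: "?a \<ge> \<epsilon>" "?b \<ge> \<epsilon>" by simp_all
    then have ab0: "?a > 0" "?b > 0" using assms(2) by linarith+
    have "1 / ?a - 1 / ?b = (?b - ?a) / (?a * ?b)" using ab0 by (simp add: field_simps)
    then have "\<bar>1 / ?a - 1 / ?b\<bar> = \<bar>?a - ?b\<bar> / (?a * ?b)"
      using ab0 by (simp add: abs_mult abs_minus_commute)
    also have "\<dots> \<le> \<bar>f x - f y\<bar> / (\<epsilon> * \<epsilon>)"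
      using ab assms(2) by (intro frac_le mult_mono) auto
    also have "\<dots> \<le> L * norm (x - y) / (\<epsilon> * \<epsilon>)"
      using assms(2) by (intro divide_right_mono f) auto
    finally show "\<bar>1 / ?a - 1 / ?b\<bar> \<le> L / \<epsilon>\<^sup>2 * norm (x - y)" by (simp add: power2_eq_square)
  qed (use f assms in auto)
qed

section \<open>A globally Lipschitz modification of the vortex field\<close>

definition clamp_config :: "real \<Rightarrow> config \<Rightarrow> config" where
  "clamp_config R X = (\<chi> r i. max (- R) (min R (X$r$i)))"

lemma bdd_lipschitz_clamp:
  assumes "R \<ge> 0"
  shows "bdd_lipschitz (\<lambda>X. clamp_config R X $ r $ i)"
proof (rule bdd_lipschitzI[of R 1])
  show "\<bar>clamp_config R X $ r $ i\<bar> \<le> R" for X using assms by (simp add: clamp_config_def abs_le_iff)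
  fix X Y :: config
  have "\<bar>clamp_config R X $ r $ i - clamp_config R Y $ r $ i\<bar> \<le> \<bar>X$r$i - Y$r$i\<bar>"
    by (simp add: clamp_config_def)
  also have "\<dots> = norm ((X - Y)$r$i)" by simp
  also have "\<dots> \<le> norm ((X - Y)$r)" by (rule Finite_Cartesian_Product.norm_nth_le)
  also have "\<dots> \<le> norm (X - Y)" by (rule Finite_Cartesian_Product.norm_nth_le)
  finally show "\<bar>clamp_config R X $ r $ i - clamp_config R Y $ r $ i\<bar> \<le> 1 * norm (X - Y)" by simp
qed (use assms in auto)

text \<open>Cutting the denominators off at \<epsilon> removes the collision singularity, and
  clamping the argument makes the polynomial numerators bounded. With \<epsilon> = c^2 - 1 nothing
  changes where every entry of the shape is at least c.\<close>

definition regular_field :: "(3 \<Rightarrow> real) \<Rightarrow> real \<Rightarrow> config \<Rightarrow> config" where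
  "regular_field \<Gamma> \<epsilon> X = (\<chi> r. (1 / pi) *\<^sub>R (\<Sum>p\<in>UNIV - {r}.
     (\<Gamma> p * (1 / max \<epsilon> ((hyp_inner (X$r) (X$p))\<^sup>2 - 1))) *\<^sub>R hyp_cross (X$p) (X$r)))"

lemma regular_field_lipschitz:
  assumes "R \<ge> 0" "\<epsilon> > 0"
  obtains L where "L > 0"
    "\<And>X Y. norm (regular_field \<Gamma> \<epsilon> (clamp_config R X) - regular_field \<Gamma> \<epsilon> (clamp_config R Y)) \<le> L * norm (X - Y)"
proof -
  note bl = bdd_lipschitz_const bdd_lipschitz_add bdd_lipschitz_diff bdd_lipschitz_mult
    bdd_lipschitz_sum bdd_lipschitz_inverse_max[OF _ assms(2)] bdd_lipschitz_clamp[OF assms(1)]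
  let ?F = "\<lambda>X. regular_field \<Gamma> \<epsilon> (clamp_config R X)"
  have c: "bdd_lipschitz (\<lambda>X. hyp_cross (clamp_config R X $ p) (clamp_config R X $ r) $ i)" for p r i
  proof -
    have neg: "- x * y + w = w - x * y" for x y w :: real by simp
    show ?thesis
      using exhaust_3[of i] unfolding hyp_cross_def neg
      by (elim disjE) (simp_all only: vector_3, (intro bl)+)
  qed
  have "bdd_lipschitz (\<lambda>X. ?F X $ r $ i)" for r i
    unfolding regular_field_def hyp_inner_def power2_eq_square vec_lambda_beta vector_scaleR_component
      sum_component real_scaleR_def
    by (intro bl c)
  then have "\<exists>L\<ge>0. \<forall>X Y. \<bar>?F X $ r $ i - ?F Y $ r $ i\<bar> \<le> L * norm (X - Y)" for r i
    unfolding bdd_lipschitz_def by blast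
  then have "\<forall>r i. \<exists>L. L \<ge> 0 \<and> (\<forall>X Y. \<bar>?F X $ r $ i - ?F Y $ r $ i\<bar> \<le> L * norm (X - Y))"
    by blast
  then obtain L where "\<forall>r i. L r i \<ge> 0 \<and> (\<forall>X Y. \<bar>?F X $ r $ i - ?F Y $ r $ i\<bar> \<le> L r i * norm (X - Y))"
    unfolding choice_iff by blast
  then have L: "\<And>r i. L r i \<ge> 0" "\<And>r i X Y. \<bar>?F X $ r $ i - ?F Y $ r $ i\<bar> \<le> L r i * norm (X - Y)"
    by blast+
  show ?thesis
  proof (rule that[of "1 + (\<Sum>r\<in>UNIV. \<Sum>i\<in>UNIV. L r i)"])
    have s: "(\<Sum>r\<in>UNIV. \<Sum>i\<in>UNIV. L r i) \<ge> 0" by (intro sum_nonneg L)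
    then show "1 + (\<Sum>r\<in>UNIV. \<Sum>i\<in>UNIV. L r i) > 0" by simp
    fix X Y
    have "norm (?F X - ?F Y) \<le> (\<Sum>r\<in>UNIV. norm ((?F X - ?F Y) $ r))"
      by (simp add: norm_vec_def L2_set_le_sum)
    also have "\<dots> \<le> (\<Sum>r\<in>UNIV. \<Sum>i\<in>UNIV. norm ((?F X - ?F Y) $ r $ i))"
      by (intro sum_mono) (subst norm_vec_def, rule L2_set_le_sum, simp)
    also have "\<dots> \<le> (\<Sum>r\<in>UNIV. \<Sum>i\<in>UNIV. L r i * norm (X - Y))"
      by (intro sum_mono) (simp add: L)
    also have "\<dots> = (\<Sum>r\<in>UNIV. \<Sum>i\<in>UNIV. L r i) * norm (X - Y)" by (simp add: sum_distrib_right)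
    also have "\<dots> \<le> (1 + (\<Sum>r\<in>UNIV. \<Sum>i\<in>UNIV. L r i)) * norm (X - Y)" by (simp add: distrib_right)
    finally show "norm (?F X - ?F Y) \<le> (1 + (\<Sum>r\<in>UNIV. \<Sum>i\<in>UNIV. L r i)) * norm (X - Y)" .
  qed
qed

lemma regular_field_eq:
  assumes "c > 1" "\<And>i. shape X $ i \<ge> c"
  shows "regular_field \<Gamma> (c\<^sup>2 - 1) X = vortex_field \<Gamma> X"
proof -
  have "c\<^sup>2 - 1 \<le> (hyp_inner (X$r) (X$p))\<^sup>2 - 1" if "r \<noteq> p" for r p
  proof -
    have "- hyp_inner (X$r) (X$p) \<ge> c"
      using that assms(2)[of 1] assms(2)[of 2] assms(2)[of 3] exhaust_3[of r] exhaust_3[of p]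
      by (auto simp: hyp_inner_commute)
    then have "c\<^sup>2 \<le> (- hyp_inner (X$r) (X$p))\<^sup>2" using assms(1) by (intro power_mono) auto
    then show ?thesis by simp
  qed
  then show ?thesis
    unfolding regular_field_def vortex_field_def vec_eq_iff
    by (auto intro!: sum.cong simp: max_absorb2)
qed

lemma clamp_config_eq: "(\<And>r i. \<bar>X$r$i\<bar> \<le> R) \<Longrightarrow> clamp_config R X = X"
  by (simp add: clamp_config_def vec_eq_iff abs_le_iff min_absorb2 max_absorb2 minus_le_iff)

lemma local_solution:
  assumes "R \<ge> 0" "c > 1"
  obtains X where "X 0 = Y0" "continuous_on {0..T} X"
    "\<And>t. t \<in> {0<..<T} \<Longrightarrow> (\<And>r i. \<bar>X t $ r $ i\<bar> \<le> R) \<Longrightarrow> (\<And>i. shape (X t) $ i \<ge> c) \<Longrightarrow>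
      (X has_vector_derivative vortex_field \<Gamma> (X t)) (at t)"
proof -
  have e: "c\<^sup>2 - 1 > 0" by (rule sq_minus_one_pos[OF assms(2)])
  obtain L where L: "L > 0"
    "\<And>X Y. norm (regular_field \<Gamma> (c\<^sup>2 - 1) (clamp_config R X) - regular_field \<Gamma> (c\<^sup>2 - 1) (clamp_config R Y)) \<le> L * norm (X - Y)"
    using regular_field_lipschitz[OF assms(1) e] by blast
  obtain X where X: "X 0 = Y0" "continuous_on {0..T} X"
    "\<And>t. t \<in> {0<..<T} \<Longrightarrow> (X has_vector_derivative regular_field \<Gamma> (c\<^sup>2 - 1) (clamp_config R (X t))) (at t)"
    using picard_lindelof[OF L(2,1)] by blast
  show ?thesis
  proof (rule that[OF X(1,2)])
    fix t assume "t \<in> {0<..<T}" and R: "\<And>r i. \<bar>X t $ r $ i\<bar> \<le> R" and s: "\<And>i. shape (X t) $ i \<ge> c"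
    from X(3)[OF this(1)] show "(X has_vector_derivative vortex_field \<Gamma> (X t)) (at t)"
      by (simp only: clamp_config_eq[OF R] regular_field_eq[OF assms(2) s])
  qed
qed

text \<open>The function may have either sign: for a positive one this bounds growth, and applied to
  minus the gap form it yields exponential growth from below.\<close>

lemma gronwall:
  fixes f :: "real \<Rightarrow> real"
  assumes "continuous_on {0..t} f" "t \<ge> 0"
    "\<And>s. 0 < s \<Longrightarrow> s < t \<Longrightarrow> \<exists>D. (f has_real_derivative D) (at s) \<and> D \<le> K * f s"
  shows "f t \<le> f 0 * exp (K * t)"
proof -
  have "f t * exp (- (K * t)) \<le> f 0 * exp (- (K * 0))"
  proof (rule DERIV_nonpos_imp_decreasing_open[OF assms(2)])
    fix s assume "0 < s" "s < t"
    then obtain D where D: "(f has_real_derivative D) (at s)" "D \<le> K * f s" using assms(3) by blast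
    have "((\<lambda>s. f s * exp (- (K * s))) has_real_derivative (D - K * f s) * exp (- (K * s))) (at s)"
      by (auto intro!: derivative_eq_intros D(1) simp: algebra_simps)
    then show "\<exists>y. ((\<lambda>s. f s * exp (- (K * s))) has_real_derivative y) (at s) \<and> y \<le> 0"
      using D(2) by (intro exI[of _ "(D - K * f s) * exp (- (K * s))"]) (simp add: mult_le_0_iff)
  qed (intro continuous_intros assms(1))
  then have "f t * exp (- (K * t)) * exp (K * t) \<le> f 0 * exp (K * t)"
    by (intro mult_right_mono) auto
  then show ?thesis by (simp add: mult.assoc flip: exp_add)
qed

text \<open>Up to sign the third component is the determinant of \<open>A\<close>, \<open>B\<close>
  and the base point \<open>e\<close>, so the Gram identity evaluates its square; the discarded
  terms are nonpositive.\<close>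

lemma hyp_cross_third_bound:
  assumes "A \<in> hyp_plane" "B \<in> hyp_plane"
  shows "(hyp_cross A B $ 3)\<^sup>2 \<le> ((hyp_inner A B)\<^sup>2 - 1) * (B$3)\<^sup>2"
proof -
  define e :: "real^3" where "e = vector [0, 0, 1]"
  have e: "hyp_inner e e = -1" "hyp_inner X e = - X$3" "hyp_inner e X = - X$3" for X
    by (simp_all add: e_def hyp_inner_def)
  have e3: "e $ 3 = 1" by (simp add: e_def)
  have AB: "hyp_inner A A = -1" "hyp_inner B B = -1" using assms by (simp_all add: hyp_plane_iff)
  have "(hyp_cross A B $ 3)\<^sup>2 = (hyp_triple A B e)\<^sup>2" by (simp add: hyp_triple_def e)
  also have "\<dots> = ((hyp_inner A B)\<^sup>2 - 1) * (B$3)\<^sup>2 - ((hyp_inner A B)\<^sup>2 - 1) - (A$3 + hyp_inner A B * B$3)\<^sup>2"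
    unfolding hyp_triple_sq e e3 AB by (simp add: power2_eq_square algebra_simps)
  also have "\<dots> \<le> ((hyp_inner A B)\<^sup>2 - 1) * (B$3)\<^sup>2"
  proof -
    have "(hyp_inner A B)\<^sup>2 \<ge> 1"
      using hyp_inner_le_minus_one[OF assms] power_mono[of 1 "- hyp_inner A B" 2] by simp
    then show ?thesis using zero_le_power2[of "A$3 + hyp_inner A B * B$3"] by linarith
  qed
  finally show ?thesis .
qed

text \<open>While distances stay bounded below, a vortex rises at a speed at most proportional to
  its height. Height therefore grows at most exponentially, and it dominates the other
  coordinates.\<close>

lemma vortex_field_height_bound:
  assumes X: "X \<in> phase_space" and c: "c > 1" "\<And>i. shape X $ i \<ge> c"
  shows "vortex_field \<Gamma> X $ r $ 3 \<le> (\<Sum>p\<in>UNIV. \<bar>\<Gamma> p\<bar>) * sqrt (1 / (c\<^sup>2 - 1)) * X$r$3"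
proof -
  define k where "k = sqrt (1 / (c\<^sup>2 - 1))"
  have c1: "c\<^sup>2 - 1 > 0" by (rule sq_minus_one_pos[OF c(1)])
  have z: "X$r$3 > 0" using X by (simp add: phase_space_def hyp_plane_iff)
  have bnd: "\<Gamma> p / ((hyp_inner (X$r) (X$p))\<^sup>2 - 1) * (hyp_cross (X$p) (X$r) $ 3) \<le> \<bar>\<Gamma> p\<bar> * (k * X$r$3)"
    if "p \<noteq> r" for p
  proof -
    let ?q = "(hyp_inner (X$r) (X$p))\<^sup>2 - 1" and ?w = "hyp_cross (X$p) (X$r) $ 3"
    have "- hyp_inner (X$r) (X$p) \<ge> c"
      using that c(2)[of 1] c(2)[of 2] c(2)[of 3] exhaust_3[of r] exhaust_3[of p]
      by (auto simp: hyp_inner_commute)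
    then have "c\<^sup>2 \<le> (- hyp_inner (X$r) (X$p))\<^sup>2" using c(1) by (intro power_mono) auto
    then have q: "?q \<ge> c\<^sup>2 - 1" by simp
    have "?w\<^sup>2 \<le> ?q * (X$r$3)\<^sup>2"
      using hyp_cross_third_bound[of "X$p" "X$r"] X by (simp add: phase_space_hyp_plane hyp_inner_commute)
    then have "(?w / ?q)\<^sup>2 \<le> ?q * (X$r$3)\<^sup>2 / ?q\<^sup>2"
      unfolding power_divide by (intro divide_right_mono) auto
    also have "\<dots> = (X$r$3)\<^sup>2 * (1 / ?q)" using q c1 by (simp add: power2_eq_square)
    also have "\<dots> \<le> (X$r$3)\<^sup>2 * (1 / (c\<^sup>2 - 1))"
      using q c1 by (intro mult_left_mono frac_le) auto
    also have "\<dots> = (k * X$r$3)\<^sup>2" using c1 by (simp add: k_def power_mult_distrib)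
    finally have "\<bar>?w / ?q\<bar> \<le> \<bar>k * X$r$3\<bar>" by (simp only: abs_le_square_iff)
    also have "\<dots> = k * X$r$3" using z c1 by (simp add: k_def)
    finally have "\<bar>\<Gamma> p\<bar> * \<bar>?w / ?q\<bar> \<le> \<bar>\<Gamma> p\<bar> * (k * X$r$3)" by (rule mult_left_mono) simp
    moreover have "\<Gamma> p / ?q * ?w \<le> \<bar>\<Gamma> p\<bar> * \<bar>?w / ?q\<bar>"
      using abs_ge_self[of "\<Gamma> p * (?w / ?q)"] by (simp add: abs_mult)
    ultimately show ?thesis by linarith
  qed
  have kz: "k * X$r$3 \<ge> 0" using z c1 by (simp add: k_def)
  have "vortex_field \<Gamma> X $ r $ 3 = (1 / pi) * (\<Sum>p\<in>UNIV - {r}.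
      \<Gamma> p / ((hyp_inner (X$r) (X$p))\<^sup>2 - 1) * (hyp_cross (X$p) (X$r) $ 3))"
    by (simp add: vortex_field_def)
  also have "\<dots> \<le> (1 / pi) * (\<Sum>p\<in>UNIV. \<bar>\<Gamma> p\<bar> * (k * X$r$3))"
    using kz by (intro mult_left_mono order_trans[OF sum_mono[OF bnd] sum_mono2]) auto
  also have "\<dots> \<le> 1 * (\<Sum>p\<in>UNIV. \<bar>\<Gamma> p\<bar> * (k * X$r$3))"
    using kz pi_gt3 by (intro mult_right_mono sum_nonneg) auto
  also have "\<dots> = (\<Sum>p\<in>UNIV. \<bar>\<Gamma> p\<bar>) * k * X$r$3" by (simp add: sum_distrib_right mult.assoc)
  finally show ?thesis by (simp add: k_def)
qed

text \<open>The field is replaced by a globally Lipschitz one, and the solution of the modified equation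
  never reaches the region where the two differ: as long as it agrees with a trajectory, confinement
  bounds its shape and the height bound keeps it in a fixed compact set.\<close>

lemma confined_trajectory:
  assumes \<kappa>: "\<kappa> > 1" and \<rho>: "\<rho> > 0" "\<kappa> - 2 * \<rho> > 1" and T: "T > 0"
    and V: "\<And>Y i. Y \<in> V \<Longrightarrow> shape Y $ i \<ge> \<kappa> - \<rho>"
    and U: "openin (top_of_set phase_space) U" and Y0: "Y0 \<in> U" "Y0 \<in> V"
    and confine: "\<And>I X s t. trajectory \<Gamma> I X \<Longrightarrow> s \<in> I \<Longrightarrow> X s \<in> U \<Longrightarrow> t \<in> I \<Longrightarrow> X t \<in> V"
  obtains X where "X 0 = Y0" "continuous_on {0..T} X" "trajectory \<Gamma> {0<..<T} X"
    "\<And>t. t \<in> {0<..<T} \<Longrightarrow> X t \<in> V"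
proof -
  \<comment> \<open>One \<rho> below the bound that confinement provides. This margin, like the 1 in
    \<open>R\<close>, makes the conclusions of \<open>good\<close> strictly better than the
    condition \<open>G\<close> assumed there.\<close>
  define c where "c = \<kappa> - 2 * \<rho>"
  have c: "c > 1" using \<rho> by (simp add: c_def)
  define K where "K = (\<Sum>p\<in>UNIV. \<bar>\<Gamma> p\<bar>) * sqrt (1 / (c\<^sup>2 - 1))"
  have K0: "K \<ge> 0" unfolding K_def using sq_minus_one_pos[OF c] by (intro mult_nonneg_nonneg sum_nonneg) auto
  have Y0p: "Y0 \<in> phase_space" using U Y0(1) openin_subset by fastforce
  have z0: "Y0$r \<in> hyp_plane" for r using Y0p by (rule phase_space_hyp_plane)
  have z0': "Y0$r$3 \<ge> 1" for r using hyp_plane_coord_le(1)[OF z0] .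
  define Z where "Z = (\<Sum>r\<in>UNIV. Y0$r$3) * exp (K * T)"
  have sum_z0: "Y0$r$3 \<le> (\<Sum>r\<in>UNIV. Y0$r$3)" for r
    by (rule member_le_sum) (use z0' in \<open>auto intro: order_trans[OF zero_le_one]\<close>)
  have sum_pos: "(\<Sum>r\<in>UNIV. Y0$r$3) \<ge> 0" using sum_z0[of 1] z0'[of 1] by linarith
  have Z: "Y0$r$3 * exp (K * s) \<le> Z" if "s \<le> T" "s \<ge> 0" for r s
    unfolding Z_def using sum_z0 sum_pos that K0 by (intro mult_mono) (auto intro: mult_left_mono)
  have Zn: "Z \<ge> 0" unfolding Z_def using sum_pos by (intro mult_nonneg_nonneg) auto
  define R where "R = Z + 1"
  obtain X where X: "X 0 = Y0" "continuous_on {0..T} X"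
    "\<And>t. t \<in> {0<..<T} \<Longrightarrow> (\<And>r i. \<bar>X t $ r $ i\<bar> \<le> R) \<Longrightarrow> (\<And>i. shape (X t) $ i \<ge> c) \<Longrightarrow>
      (X has_vector_derivative vortex_field \<Gamma> (X t)) (at t)"
    using local_solution[of R c Y0 T \<Gamma>] c Zn unfolding R_def by (metis add_nonneg_nonneg zero_le_one)
  define G where "G t \<longleftrightarrow> (\<forall>r i. \<bar>X t $ r $ i\<bar> < R) \<and> (\<forall>i. shape (X t) $ i > c)" for t
  have good: "trajectory \<Gamma> {0<..<\<tau>} X \<and> (\<forall>s\<in>{0<..<\<tau>}. X s \<in> V \<and> (\<forall>r i. \<bar>X s $ r $ i\<bar> \<le> Z))"
    if \<tau>: "\<tau> > 0" "\<tau> \<le> T" and G: "\<And>s. s \<in> {0<..<\<tau>} \<Longrightarrow> G s" for \<tau>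
  proof -
    have d: "(X has_vector_derivative vortex_field \<Gamma> (X s)) (at s)" if "s \<in> {0<..<\<tau>}" for s
      by (rule X(3)) (use G[OF that] that \<tau> in \<open>auto simp: G_def intro: less_imp_le simp del: shape_nth\<close>)
    have cont: "continuous_on {0..s} X" if "s \<le> \<tau>" for s
      by (rule continuous_on_subset[OF X(2)]) (use that \<tau> in auto)
    \<comment> \<open>The solution was built in R^3. Conservation of the form places it on the
      two-sheeted hyperboloid, and \<open>pos\<close> selects the upper sheet, as the third
      coordinate cannot pass through 0.\<close>
    have hyp: "hyp_inner (X s $ r) (X s $ r) = -1" if s: "s \<in> {0<..<\<tau>}" for s r
    proof -
      have "hyp_inner (X s $ r) (X s $ r) = hyp_inner (X 0 $ r) (X 0 $ r)"
        by (rule DERIV_isconst2[of 0 s])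
          (use s in \<open>auto intro!: continuous_intros cont solution_derivatives(5) d\<close>)
      then show ?thesis using z0[of r] by (simp add: X(1) hyp_plane_iff)
    qed
    have pos: "X s $ r $ 3 > 0" if s: "s \<in> {0<..<\<tau>}" for s r
    proof -
      have "- (X s $ r $ 3) < 0"
      proof (rule interval_sublevel_trapped[of "{0..s}" "\<lambda>t. - (X t $ r $ 3)" 0 0])
        show "continuous_on {0..s} (\<lambda>t. - (X t $ r $ 3))"
          by (intro continuous_intros cont) (use s in auto)
        fix t assume "t \<in> {0..s}"
        then have "hyp_inner (X t $ r) (X t $ r) = -1"
          using hyp[of t r] s z0[of r] by (cases "t = 0") (auto simp: X(1) hyp_plane_iff)
        then have "(X t $ r $ 3)\<^sup>2 = 1 + (X t $ r $ 1)\<^sup>2 + (X t $ r $ 2)\<^sup>2"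
          by (simp add: hyp_inner_def power2_eq_square)
        then have "(X t $ r $ 3)\<^sup>2 \<noteq> 0"
          using zero_le_power2[of "X t $ r $ 1"] zero_le_power2[of "X t $ r $ 2"] by linarith
        then show "- (X t $ r $ 3) \<noteq> 0" by simp
      qed (use s z0' [of r] X(1) in \<open>auto simp: is_interval_cc\<close>)
      then show ?thesis by simp
    qed
    have ps: "X s \<in> phase_space" if s: "s \<in> {0<..<\<tau>}" for s
    proof (rule phase_space_shape)
      show "X s $ r \<in> hyp_plane" for r using hyp[OF s] pos[OF s] by (simp add: hyp_plane_iff)
      show "shape (X s) $ i > 1" for i
        using G[OF s] c less_trans unfolding G_def by blast
    qed
    have tr: "trajectory \<Gamma> {0<..<\<tau>} X"
      unfolding trajectory_def using d ps by (auto simp: is_interval_oo)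
    obtain O' where O': "open O'" "U = phase_space \<inter> O'" using U by (auto simp: openin_open)
    have "(X \<longlongrightarrow> X 0) (at 0 within {0..T})" using X(2) T by (auto simp: continuous_on_def)
    then have "\<forall>\<^sub>F s in at 0 within {0..T}. X s \<in> O'"
      by (rule topological_tendstoD[OF _ O'(1)]) (use O' Y0 X(1) in auto)
    then obtain e where e: "e > 0" "\<And>s. s \<in> {0..T} \<Longrightarrow> s \<noteq> 0 \<Longrightarrow> dist s 0 < e \<Longrightarrow> X s \<in> O'"
      unfolding eventually_at by blast
    \<comment> \<open>Time 0 is an endpoint of the open interval, whereas confinement asks for a
      time inside it at which the trajectory is in \<open>U\<close>; a slightly later one is still
      in \<open>U\<close>.\<close>
    define s0 where "s0 = min (e / 2) (\<tau> / 2)"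
    have s0: "s0 \<in> {0<..<\<tau>}" "s0 < e" using e(1) \<tau> by (auto simp: s0_def)
    have "X s0 \<in> O'" by (rule e(2)) (use s0 \<tau> in auto)
    then have "X s0 \<in> U" using O'(2) ps[OF s0(1)] by blast
    then have XV: "X s \<in> V" if "s \<in> {0<..<\<tau>}" for s
      using confine[OF tr s0(1) _ that] by blast
    have "\<bar>X s $ r $ i\<bar> \<le> Z" if s: "s \<in> {0<..<\<tau>}" for s r i
    proof -
      have "X s $ r $ 3 \<le> X 0 $ r $ 3 * exp (K * s)"
      proof (rule gronwall)
        show "continuous_on {0..s} (\<lambda>s. X s $ r $ 3)" by (intro continuous_intros cont) (use s in auto)
        fix t assume t: "0 < t" "t < s"
        then have t': "t \<in> {0<..<\<tau>}" using s by auto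
        have "((\<lambda>t. X t $ r $ 3) has_real_derivative vortex_field \<Gamma> (X t) $ r $ 3) (at t)"
          unfolding has_real_derivative_iff_has_vector_derivative
          by (intro bounded_linear.has_vector_derivative[OF bounded_linear_vec_nth] d t')
        moreover have "vortex_field \<Gamma> (X t) $ r $ 3 \<le> K * X t $ r $ 3"
          unfolding K_def
          by (rule vortex_field_height_bound[OF ps[OF t'] c])
            (use G[OF t'] in \<open>auto simp: G_def intro: less_imp_le simp del: shape_nth\<close>)
        ultimately show "\<exists>D. ((\<lambda>t. X t $ r $ 3) has_real_derivative D) (at t) \<and> D \<le> K * X t $ r $ 3"
          by blast
      qed (use s in auto)
      also have "\<dots> \<le> Z" unfolding X(1) by (rule Z) (use s \<tau> in auto)
      finally show ?thesis
        using hyp_plane_coord_le(2)[OF phase_space_hyp_plane[OF ps[OF s]], of r i] by linarith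
    qed
    with tr XV show ?thesis by blast
  qed
  have all_good: "G t" if t: "t \<in> {0..T}" for t
  proof (rule ccontr)
    assume "\<not> G t"
    define B where "B = {t \<in> {0..T}. \<not> G t}"
    have op: "openin (top_of_set {0..T}) {t \<in> {0..T}. \<bar>X t $ r $ i\<bar> < R}"
        "openin (top_of_set {0..T}) {t \<in> {0..T}. shape (X t) $ j > c}" for r i j
      by (intro openin_less_real openin_greater_real continuous_intros X(2))+
    have "openin (top_of_set {0..T}) ((\<Inter>r\<in>UNIV. \<Inter>i\<in>UNIV. {t \<in> {0..T}. \<bar>X t $ r $ i\<bar> < R}) \<inter>
        (\<Inter>j\<in>UNIV. {t \<in> {0..T}. shape (X t) $ j > c}))"
      by (intro openin_Int openin_INT2 op) auto
    moreover have "\<dots> = {0..T} - B"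
      by (rule set_eqI) (simp add: B_def G_def del: shape_nth, blast)
    ultimately have "openin (top_of_set {0..T}) ({0..T} - B)" by (simp only:)
    moreover have "B \<subseteq> {0..T}" unfolding B_def by blast
    ultimately have "closedin (top_of_set {0..T}) B" by (simp only: closedin_def topspace_euclidean_subtopology)
    then have "compact B" by (rule closedin_compact[OF compact_Icc])
    moreover have "B \<noteq> {}" using t \<open>\<not> G t\<close> by (auto simp: B_def)
    \<comment> \<open>The first time at which \<open>G\<close> fails. It exists since
      \<open>G\<close> is an open condition, so that \<open>B\<close> is compact.\<close>
    ultimately obtain \<tau> where \<tau>: "\<tau> \<in> B" "\<And>s. s \<in> B \<Longrightarrow> \<tau> \<le> s"
      using compact_attains_inf[of B] by blast
    have "G 0"
    proof -
      have "\<bar>Y0 $ r $ i\<bar> < R" for r i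
        using Z[of 0 r] hyp_plane_coord_le(2)[OF z0, of r i] T by (simp add: R_def)
      moreover have "shape Y0 $ i > c" for i using V[OF Y0(2), of i] \<rho>(1) by (simp add: c_def)
      ultimately show ?thesis unfolding G_def X(1) by blast
    qed
    then have \<tau>0: "\<tau> > 0" "\<tau> \<le> T" using \<tau>(1) by (auto simp: B_def order_less_le)
    have "G s" if "s \<in> {0<..<\<tau>}" for s using \<tau>(2)[of s] that \<tau>0 by (force simp: B_def)
    note g = good[OF \<tau>0 this]
    \<comment> \<open>The weak bounds valid before \<tau> pass to \<tau> by continuity, and the
      margins make them strict there, contradicting the failure of \<open>G\<close>.\<close>
    have cl: "h \<tau> \<le> b" if "continuous_on {0..T} h" "\<And>s. s \<in> {0<..<\<tau>} \<Longrightarrow> h s \<le> b" for h :: "real \<Rightarrow> real" and b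
    proof (rule continuous_le_on_closure[of "{0<..<\<tau>}" h])
      show "continuous_on (closure {0<..<\<tau>}) h"
        using continuous_on_subset[OF that(1)] \<tau>0 by (simp add: closure_greaterThanLessThan)
    qed (use that \<tau>0 in \<open>auto simp: closure_greaterThanLessThan\<close>)
    have "\<bar>X \<tau> $ r $ i\<bar> < R" for r i
    proof -
      have "\<bar>X \<tau> $ r $ i\<bar> \<le> Z"
        by (rule cl[of "\<lambda>t. \<bar>X t $ r $ i\<bar>"]) (use g in \<open>auto intro!: continuous_intros X(2)\<close>)
      then show ?thesis by (simp add: R_def)
    qed
    moreover have "shape (X \<tau>) $ i > c" for i
    proof -
      have "- shape (X \<tau>) $ i \<le> - (\<kappa> - \<rho>)"
      proof (rule cl[of "\<lambda>t. - shape (X t) $ i"])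
        show "continuous_on {0..T} (\<lambda>t. - shape (X t) $ i)" by (intro continuous_intros X(2))
        show "- shape (X s) $ i \<le> - (\<kappa> - \<rho>)" if "s \<in> {0<..<\<tau>}" for s
          using V[of "X s" i] g that by (simp del: shape_nth)
      qed
      then show ?thesis using \<rho>(1) by (simp add: c_def del: shape_nth)
    qed
    ultimately have "G \<tau>" unfolding G_def by blast
    then show False using \<tau>(1) by (simp add: B_def)
  qed
  have "trajectory \<Gamma> {0<..<T} X \<and> (\<forall>s\<in>{0<..<T}. X s \<in> V \<and> (\<forall>r i. \<bar>X s $ r $ i\<bar> \<le> Z))"
    by (rule good[OF T order_refl all_good]) auto
  then show ?thesis using that[OF X(1,2)] by blast
qed

subsection \<open>Growth of the shape differences\<close>

text \<open>The quadratic form d . R d at d = (x, y, z).\<close>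

definition gap_form :: "(3 \<Rightarrow> real) \<Rightarrow> real \<Rightarrow> real \<Rightarrow> real \<Rightarrow> real" where
  "gap_form \<Gamma> x y z = x * (\<Gamma> 2 * y - \<Gamma> 3 * z) + y * (\<Gamma> 3 * z - \<Gamma> 1 * x) + z * (\<Gamma> 1 * x - \<Gamma> 2 * y)"

text \<open>Differences are used rather than deviations from \<kappa>, because equilateral shapes of
  every size are fixed points and this neutral direction has to be factored out.\<close>

definition shape_gap :: "(3 \<Rightarrow> real) \<Rightarrow> real^3 \<Rightarrow> real" where
  "shape_gap \<Gamma> s = gap_form \<Gamma> (s$2 - s$3) (s$3 - s$1) (s$1 - s$2)"

lemma abs_sum_sq_le: "(\<bar>x\<bar> + \<bar>y\<bar> + \<bar>z\<bar>)\<^sup>2 \<le> 3 * (x\<^sup>2 + y\<^sup>2 + z\<^sup>2)" for x y z :: real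
proof -
  have "3 * (x\<^sup>2 + y\<^sup>2 + z\<^sup>2) - (\<bar>x\<bar> + \<bar>y\<bar> + \<bar>z\<bar>)\<^sup>2
      = (\<bar>x\<bar> - \<bar>y\<bar>)\<^sup>2 + (\<bar>y\<bar> - \<bar>z\<bar>)\<^sup>2 + (\<bar>z\<bar> - \<bar>x\<bar>)\<^sup>2"
    by (simp add: power2_eq_square algebra_simps flip: abs_mult)
  then show ?thesis by (smt (verit) zero_le_power2)
qed

lemma weighted_difference_bound:
  fixes a b x y g M :: real
  assumes "\<bar>a\<bar> + \<bar>b\<bar> \<le> g" "\<bar>x\<bar> \<le> M" "\<bar>y\<bar> \<le> M"
  shows "\<bar>a * x - b * y\<bar> \<le> g * M"
proof -
  have "\<bar>a * x - b * y\<bar> \<le> \<bar>a\<bar> * \<bar>x\<bar> + \<bar>b\<bar> * \<bar>y\<bar>" by (metis abs_mult abs_triangle_ineq4)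
  also have "\<dots> \<le> \<bar>a\<bar> * M + \<bar>b\<bar> * M" using assms by (intro add_mono mult_left_mono) auto
  also have "\<dots> \<le> g * M" using assms mult_right_mono[of "\<bar>a\<bar> + \<bar>b\<bar>" g M] by (simp add: distrib_right)
  finally show ?thesis .
qed

lemma gap_form_bound:
  "\<bar>gap_form \<Gamma> x y z\<bar> \<le> 3 * (\<bar>\<Gamma> 1\<bar> + \<bar>\<Gamma> 2\<bar> + \<bar>\<Gamma> 3\<bar>) * (x\<^sup>2 + y\<^sup>2 + z\<^sup>2)"
proof -
  define g where "g = \<bar>\<Gamma> 1\<bar> + \<bar>\<Gamma> 2\<bar> + \<bar>\<Gamma> 3\<bar>"
  define N where "N = \<bar>x\<bar> + \<bar>y\<bar> + \<bar>z\<bar>"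
  have q: "\<bar>\<Gamma> 2 * y - \<Gamma> 3 * z\<bar> \<le> g * N" "\<bar>\<Gamma> 3 * z - \<Gamma> 1 * x\<bar> \<le> g * N" "\<bar>\<Gamma> 1 * x - \<Gamma> 2 * y\<bar> \<le> g * N"
    by (intro weighted_difference_bound; simp add: g_def N_def)+
  have "\<bar>gap_form \<Gamma> x y z\<bar> \<le> \<bar>x\<bar> * (g * N) + \<bar>y\<bar> * (g * N) + \<bar>z\<bar> * (g * N)"
    unfolding gap_form_def
    by (intro order_trans[OF abs_triangle_ineq] add_mono) (simp_all add: abs_mult mult_left_mono q)
  also have "\<dots> = g * N\<^sup>2" by (simp add: N_def power2_eq_square algebra_simps)
  also have "\<dots> \<le> g * (3 * (x\<^sup>2 + y\<^sup>2 + z\<^sup>2))"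
    unfolding N_def by (intro mult_left_mono abs_sum_sq_le) (simp add: g_def)
  finally show ?thesis unfolding g_def[symmetric] by (simp only: mult_ac)
qed

text \<open>With d = (x, y, z) and e = (e1, e2, e3), the \<open>q\<close>s are R d and the
  \<open>f\<close>s are R e; the first two groups of terms form R e . R d + d . R (R e), the
  derivative of d . R d when d' = R e. For e = m d it is exactly m (|R d|^2 -
  \<open>sigma2 \<Gamma>\<close> |d|^2). The remainder h = e - m d contributes at most 4 g^2 \<eta>
  N^2, and N^2 \<le> 3 |d|^2 gives the constant 12.\<close>

lemma gap_form_growth:
  fixes \<Gamma> :: "3 \<Rightarrow> real" and x y z e1 e2 e3 m \<eta> :: real
  assumes sum: "x + y + z = 0" and \<eta>: "\<eta> \<ge> 0"
    and h: "\<bar>e1 - m * x\<bar> \<le> \<eta> * \<bar>x\<bar>" "\<bar>e2 - m * y\<bar> \<le> \<eta> * \<bar>y\<bar>" "\<bar>e3 - m * z\<bar> \<le> \<eta> * \<bar>z\<bar>"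
  defines "q1 \<equiv> \<Gamma> 2 * y - \<Gamma> 3 * z" and "q2 \<equiv> \<Gamma> 3 * z - \<Gamma> 1 * x" and "q3 \<equiv> \<Gamma> 1 * x - \<Gamma> 2 * y"
    and "f1 \<equiv> \<Gamma> 2 * e2 - \<Gamma> 3 * e3" and "f2 \<equiv> \<Gamma> 3 * e3 - \<Gamma> 1 * e1" and "f3 \<equiv> \<Gamma> 1 * e1 - \<Gamma> 2 * e2"
  shows "\<bar>f1 * q1 + f2 * q2 + f3 * q3 + (x * (\<Gamma> 2 * f2 - \<Gamma> 3 * f3) + y * (\<Gamma> 3 * f3 - \<Gamma> 1 * f1) + z * (\<Gamma> 1 * f1 - \<Gamma> 2 * f2))
      - m * (q1\<^sup>2 + q2\<^sup>2 + q3\<^sup>2 - sigma2 \<Gamma> * (x\<^sup>2 + y\<^sup>2 + z\<^sup>2))\<bar>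
    \<le> 12 * (\<bar>\<Gamma> 1\<bar> + \<bar>\<Gamma> 2\<bar> + \<bar>\<Gamma> 3\<bar>)\<^sup>2 * \<eta> * (x\<^sup>2 + y\<^sup>2 + z\<^sup>2)" (is "\<bar>?lhs\<bar> \<le> _")
proof -
  define g where "g = \<bar>\<Gamma> 1\<bar> + \<bar>\<Gamma> 2\<bar> + \<bar>\<Gamma> 3\<bar>"
  define N where "N = \<bar>x\<bar> + \<bar>y\<bar> + \<bar>z\<bar>"
  define h1 h2 h3 where hs: "h1 = e1 - m * x" "h2 = e2 - m * y" "h3 = e3 - m * z"
  define p1 p2 p3 where ps: "p1 = \<Gamma> 2 * h2 - \<Gamma> 3 * h3" "p2 = \<Gamma> 3 * h3 - \<Gamma> 1 * h1" "p3 = \<Gamma> 1 * h1 - \<Gamma> 2 * h2"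
  have g: "g \<ge> 0" and N: "N \<ge> 0" by (simp_all add: g_def N_def)
  have "\<eta> * \<bar>x\<bar> \<le> \<eta> * N" "\<eta> * \<bar>y\<bar> \<le> \<eta> * N" "\<eta> * \<bar>z\<bar> \<le> \<eta> * N"
    using \<eta> by (auto simp: N_def intro!: mult_left_mono)
  then have hb: "\<bar>h1\<bar> \<le> \<eta> * N" "\<bar>h2\<bar> \<le> \<eta> * N" "\<bar>h3\<bar> \<le> \<eta> * N" using h unfolding hs by linarith+
  have qb: "\<bar>q1\<bar> \<le> g * N" "\<bar>q2\<bar> \<le> g * N" "\<bar>q3\<bar> \<le> g * N"
    unfolding q1_def q2_def q3_def by (intro weighted_difference_bound; simp add: g_def N_def)+
  have pb: "\<bar>p1\<bar> \<le> g * (\<eta> * N)" "\<bar>p2\<bar> \<le> g * (\<eta> * N)" "\<bar>p3\<bar> \<le> g * (\<eta> * N)"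
    unfolding ps by (intro weighted_difference_bound hb; simp add: g_def)+
  have rb: "\<bar>\<Gamma> 2 * p2 - \<Gamma> 3 * p3\<bar> \<le> g * (g * (\<eta> * N))" "\<bar>\<Gamma> 3 * p3 - \<Gamma> 1 * p1\<bar> \<le> g * (g * (\<eta> * N))"
    "\<bar>\<Gamma> 1 * p1 - \<Gamma> 2 * p2\<bar> \<le> g * (g * (\<eta> * N))"
    by (intro weighted_difference_bound pb; simp add: g_def)+
  have z: "z = - x - y" using sum by simp
  have e: "e1 = m * x + h1" "e2 = m * y + h2" "e3 = m * z + h3" by (simp_all add: hs)
  have f: "f1 = m * q1 + p1" "f2 = m * q2 + p2" "f3 = m * q3 + p3"
    unfolding f1_def f2_def f3_def e q1_def q2_def q3_def ps by (simp_all add: algebra_simps)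
  \<comment> \<open>This is R^2 = - \<open>sigma2 \<Gamma>\<close> on vectors of sum zero.\<close>
  have rq: "\<Gamma> 2 * q2 - \<Gamma> 3 * q3 = - sigma2 \<Gamma> * x" "\<Gamma> 3 * q3 - \<Gamma> 1 * q1 = - sigma2 \<Gamma> * y"
    "\<Gamma> 1 * q1 - \<Gamma> 2 * q2 = - sigma2 \<Gamma> * z"
    unfolding q1_def q2_def q3_def sigma2_def z by (simp_all add: algebra_simps)
  have "\<Gamma> 2 * f2 - \<Gamma> 3 * f3 = m * (\<Gamma> 2 * q2 - \<Gamma> 3 * q3) + (\<Gamma> 2 * p2 - \<Gamma> 3 * p3)"
    "\<Gamma> 3 * f3 - \<Gamma> 1 * f1 = m * (\<Gamma> 3 * q3 - \<Gamma> 1 * q1) + (\<Gamma> 3 * p3 - \<Gamma> 1 * p1)"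
    "\<Gamma> 1 * f1 - \<Gamma> 2 * f2 = m * (\<Gamma> 1 * q1 - \<Gamma> 2 * q2) + (\<Gamma> 1 * p1 - \<Gamma> 2 * p2)"
    unfolding f by (simp_all add: algebra_simps)
  note rf = this[unfolded rq]
  have "?lhs = p1 * q1 + p2 * q2 + p3 * q3
      + (x * (\<Gamma> 2 * p2 - \<Gamma> 3 * p3) + y * (\<Gamma> 3 * p3 - \<Gamma> 1 * p1) + z * (\<Gamma> 1 * p1 - \<Gamma> 2 * p2))"
    unfolding rf unfolding f by (simp add: power2_eq_square algebra_simps)
  also have "\<bar>\<dots>\<bar> \<le> (\<bar>p1\<bar> * \<bar>q1\<bar> + \<bar>p2\<bar> * \<bar>q2\<bar> + \<bar>p3\<bar> * \<bar>q3\<bar>)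
      + (\<bar>x\<bar> * \<bar>\<Gamma> 2 * p2 - \<Gamma> 3 * p3\<bar> + \<bar>y\<bar> * \<bar>\<Gamma> 3 * p3 - \<Gamma> 1 * p1\<bar> + \<bar>z\<bar> * \<bar>\<Gamma> 1 * p1 - \<Gamma> 2 * p2\<bar>)"
    unfolding abs_mult[symmetric] by linarith
  also have "\<dots> \<le> (g * (\<eta> * N) * (g * N) + g * (\<eta> * N) * (g * N) + g * (\<eta> * N) * (g * N))
      + (\<bar>x\<bar> * (g * (g * (\<eta> * N))) + \<bar>y\<bar> * (g * (g * (\<eta> * N))) + \<bar>z\<bar> * (g * (g * (\<eta> * N))))"
    by (intro add_mono mult_mono[OF pb(1) qb(1)] mult_mono[OF pb(2) qb(2)] mult_mono[OF pb(3) qb(3)]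
        mult_left_mono rb) (use g N \<eta> in auto)
  also have "\<dots> = 4 * g\<^sup>2 * \<eta> * N\<^sup>2" by (simp add: N_def power2_eq_square algebra_simps)
  also have "\<dots> \<le> 4 * g\<^sup>2 * \<eta> * (3 * (x\<^sup>2 + y\<^sup>2 + z\<^sup>2))"
    unfolding N_def using \<eta> by (intro mult_left_mono abs_sum_sq_le) auto
  finally show ?thesis unfolding g_def[symmetric] by (simp only: mult_ac)
qed

text \<open>The error is relative to the difference of the two arguments, not to their distance from
  \<kappa>. Only so can it be absorbed by a growth term quadratic in the differences.\<close>

lemma rate_secant:
  assumes \<kappa>: "r < \<kappa> - 1" and r: "\<And>x. \<bar>x - \<kappa>\<bar> \<le> r \<Longrightarrow> \<bar>rate_deriv x - m\<bar> < \<eta>"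
    and xy: "\<bar>x - \<kappa>\<bar> \<le> r" "\<bar>y - \<kappa>\<bar> \<le> r"
  shows "\<bar>rate x - rate y - m * (x - y)\<bar> \<le> \<eta> * \<bar>x - y\<bar>"
proof -
  have main: "\<bar>rate x - rate y - m * (x - y)\<bar> \<le> \<eta> * \<bar>x - y\<bar>"
    if "y < x" "\<bar>x - \<kappa>\<bar> \<le> r" "\<bar>y - \<kappa>\<bar> \<le> r" for x y
  proof -
    have "(rate has_real_derivative rate_deriv u) (at u)" if "y \<le> u" "u \<le> x" for u
      by (rule rate_has_deriv) (use that \<open>\<bar>y - \<kappa>\<bar> \<le> r\<close> \<kappa> in linarith)
    from MVT2[OF \<open>y < x\<close> this] obtain u where u: "y < u" "u < x" "rate x - rate y = (x - y) * rate_deriv u"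
      by blast
    have "\<bar>u - \<kappa>\<bar> \<le> r" using u that by linarith
    then have "\<bar>(x - y) * (rate_deriv u - m)\<bar> \<le> \<bar>x - y\<bar> * \<eta>"
      unfolding abs_mult using r[of u] by (intro mult_left_mono) auto
    then show ?thesis using u(3) by (simp add: algebra_simps)
  qed
  show ?thesis
    using main[of y x] main[of x y] xy
    by (cases "x < y"; cases "y < x") (simp_all add: abs_minus_commute algebra_simps)
qed

text \<open>The derivative is left in the pattern R e . R d + d . R (R e), with e the differences of
  the rates, ready for \<open>gap_form_growth\<close>.\<close>

lemma shape_gap_derivative:
  assumes "(X has_vector_derivative vortex_field \<Gamma> (X t)) (at t)"
  defines "s \<equiv> shape (X t)" and "f \<equiv> (\<lambda>i. rate (shape (X t) $ i))"
  defines "f1 \<equiv> \<Gamma> 2 * (f 3 - f 1) - \<Gamma> 3 * (f 1 - f 2)" and "f2 \<equiv> \<Gamma> 3 * (f 1 - f 2) - \<Gamma> 1 * (f 2 - f 3)"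
    and "f3 \<equiv> \<Gamma> 1 * (f 2 - f 3) - \<Gamma> 2 * (f 3 - f 1)"
  shows "((\<lambda>t. shape_gap \<Gamma> (shape (X t))) has_real_derivative vol (X t) / pi *
     (f1 * (\<Gamma> 2 * (s$3 - s$1) - \<Gamma> 3 * (s$1 - s$2)) + f2 * (\<Gamma> 3 * (s$1 - s$2) - \<Gamma> 1 * (s$2 - s$3))
      + f3 * (\<Gamma> 1 * (s$2 - s$3) - \<Gamma> 2 * (s$3 - s$1))
      + ((s$2 - s$3) * (\<Gamma> 2 * f2 - \<Gamma> 3 * f3) + (s$3 - s$1) * (\<Gamma> 3 * f3 - \<Gamma> 1 * f1)
      + (s$1 - s$2) * (\<Gamma> 1 * f1 - \<Gamma> 2 * f2)))) (at t)"
proof -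
  define v where "v = vol (X t) / pi"
  have d: "((\<lambda>t. shape (X t) $ 1) has_real_derivative v * (\<Gamma> 1 * (f 2 - f 3))) (at t)"
    "((\<lambda>t. shape (X t) $ 2) has_real_derivative v * (\<Gamma> 2 * (f 3 - f 1))) (at t)"
    "((\<lambda>t. shape (X t) $ 3) has_real_derivative v * (\<Gamma> 3 * (f 1 - f 2))) (at t)"
    using solution_derivatives(1-3)[OF assms(1)] by (simp_all add: v_def f_def mult_ac del: shape_nth)
  have D: "((\<lambda>t. shape (X t) $ 2 - shape (X t) $ 3) has_real_derivative v * f1) (at t)"
    "((\<lambda>t. shape (X t) $ 3 - shape (X t) $ 1) has_real_derivative v * f2) (at t)"
    "((\<lambda>t. shape (X t) $ 1 - shape (X t) $ 2) has_real_derivative v * f3) (at t)"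
    using DERIV_diff[OF d(2) d(3)] DERIV_diff[OF d(3) d(1)] DERIV_diff[OF d(1) d(2)]
    by (simp_all only: f1_def f2_def f3_def right_diff_distrib)
  have dc: "((\<lambda>t. a * u t - b * w t) has_real_derivative a * u' - b * w') (at t)"
    if "(u has_real_derivative u') (at t)" "(w has_real_derivative w') (at t)" for a b u u' w w'
    by (intro DERIV_diff DERIV_cmult that)
  show ?thesis
    unfolding shape_gap_def gap_form_def
    by (rule DERIV_cong[OF DERIV_add[OF DERIV_add[OF DERIV_mult[OF D(1) dc[OF D(2) D(3)]]
          DERIV_mult[OF D(2) dc[OF D(3) D(1)]]] DERIV_mult[OF D(3) dc[OF D(1) D(2)]]]])
      (simp add: s_def v_def[symmetric] algebra_simps del: shape_nth)
qed

section \<open>Perturbations on which the gap form has a prescribed sign\<close>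

lemma indefinite_quadratic_form:
  fixes A C :: real
  assumes "A \<noteq> 0 \<or> C \<noteq> 0"
  obtains x y where "A * x\<^sup>2 + 2 * (A + C) * x * y + C * y\<^sup>2 > 0"
proof (cases "A > 0 \<or> C > 0")
  case True
  then show ?thesis using that[of 1 0] that[of 0 1] by auto
next
  case False
  show ?thesis
  proof (cases "A = 0")
    case True
    then have "C < 0" using False assms by auto
    then have "C * C * C < 0" by (simp add: mult_neg_neg mult_pos_neg)
    then show ?thesis using that[of "- C" C] True by (simp add: power2_eq_square)
  next
    case A: False
    then have "A < 0" using False by simp
    moreover have "A\<^sup>2 + A * C + C\<^sup>2 > 0"
      using A False mult_nonpos_nonpos[of A C] by (simp add: add_pos_nonneg)
    \<comment> \<open>The discriminant (A + C)^2 - A C = A^2 + A C + C^2 is positive. The point (A +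
      C, - A) makes the completed square vanish and leaves the term with coefficient opposite to
      A.\<close>
    ultimately have "- A * (A\<^sup>2 + A * C + C\<^sup>2) > 0" by (intro mult_pos_pos) auto
    also have "- A * (A\<^sup>2 + A * C + C\<^sup>2) = A * (A + C)\<^sup>2 + 2 * (A + C) * (A + C) * (- A) + C * (- A)\<^sup>2"
      by (simp add: power2_eq_square algebra_simps)
    finally show ?thesis by (rule that)
  qed
qed

text \<open>On the plane of sum zero the form degenerates only when all vorticities agree, and then
  \<open>sigma2 \<Gamma>\<close> is three times a square.\<close>

lemma gap_form_indefinite:
  assumes S: "sigma2 \<Gamma> < 0" and \<sigma>: "\<sigma> \<noteq> 0"
  obtains x y where "\<sigma> * gap_form \<Gamma> x y (- x - y) > 0"
proof -
  have "\<Gamma> 3 - \<Gamma> 1 \<noteq> 0 \<or> \<Gamma> 2 - \<Gamma> 3 \<noteq> 0"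
  proof (rule ccontr)
    assume "\<not> ?thesis"
    then have "\<Gamma> 2 = \<Gamma> 1" "\<Gamma> 3 = \<Gamma> 1" by auto
    then show False using S zero_le_square[of "\<Gamma> 1"] by (simp add: sigma2_def)
  qed
  then have "\<sigma> * (\<Gamma> 3 - \<Gamma> 1) \<noteq> 0 \<or> \<sigma> * (\<Gamma> 2 - \<Gamma> 3) \<noteq> 0" using \<sigma> by simp
  then obtain x y where "\<sigma> * (\<Gamma> 3 - \<Gamma> 1) * x\<^sup>2 + 2 * (\<sigma> * (\<Gamma> 3 - \<Gamma> 1) + \<sigma> * (\<Gamma> 2 - \<Gamma> 3)) * x * y
      + \<sigma> * (\<Gamma> 2 - \<Gamma> 3) * y\<^sup>2 > 0"
    by (rule indefinite_quadratic_form)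
  also have "\<sigma> * (\<Gamma> 3 - \<Gamma> 1) * x\<^sup>2 + 2 * (\<sigma> * (\<Gamma> 3 - \<Gamma> 1) + \<sigma> * (\<Gamma> 2 - \<Gamma> 3)) * x * y
      + \<sigma> * (\<Gamma> 2 - \<Gamma> 3) * y\<^sup>2 = \<sigma> * gap_form \<Gamma> x y (- x - y)"
    by (simp add: gap_form_def power2_eq_square algebra_simps)
  finally show ?thesis by (rule that)
qed

lemma gap_form_scale: "gap_form \<Gamma> (k * x) (k * y) (k * z) = k\<^sup>2 * gap_form \<Gamma> x y z"
  by (simp add: gap_form_def power2_eq_square algebra_simps)

text \<open>Only the first vortex is moved; its tangent direction \<open>v\<close> is read off the basis dual to
  \<open>X\<^sub>1, X\<^sub>2, X\<^sub>3\<close>, which exists because \<open>vol Xe\<close> is not zero.\<close>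

lemma gap_perturbation:
  assumes Xe: "Xe \<in> phase_space" "shape Xe = vec \<kappa>" and vol: "vol Xe \<noteq> 0"
    and U: "openin (top_of_set phase_space) U" "Xe \<in> U"
    and xy: "\<sigma> * gap_form \<Gamma> x y (- x - y) > 0"
  obtains Y where "Y \<in> U" "\<sigma> * shape_gap \<Gamma> (shape Y) > 0"
proof -
  define \<beta> where "\<beta> = x + y"
  \<comment> \<open>Moving the first vortex along \<open>v\<close> changes the second and third
    entries of the shape at rates \<beta> = x + y and y. The differences then start out in the
    direction (x, y, - x - y).\<close>
  define v where "v = (- 1 / vol Xe) *\<^sub>R (y *\<^sub>R hyp_cross (Xe$3) (Xe$1) + \<beta> *\<^sub>R hyp_cross (Xe$1) (Xe$2))"
  have t: "hyp_inner (hyp_cross (Xe$1) (Xe$2)) (Xe$3) = vol Xe"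
    "hyp_inner (hyp_cross (Xe$3) (Xe$1)) (Xe$2) = vol Xe"
    by (simp_all add: vol_def hyp_triple_def hyp_inner_def hyp_cross_def algebra_simps)
  have v: "hyp_inner v (Xe$1) = 0" "hyp_inner v (Xe$2) = - y" "hyp_inner v (Xe$3) = - \<beta>"
    using vol by (simp_all add: v_def hyp_inner_simps hyp_inner_cross_self t)
  define q where "q = hyp_inner v v"
  define n where "n e = sqrt (1 - e\<^sup>2 * q)" for e
  \<comment> \<open>The straight line leaves the hyperboloid to second order; dividing by
    \<open>n e\<close> returns to it.\<close>
  define P where "P e = (1 / n e) *\<^sub>R (Xe$1 + e *\<^sub>R v)" for e
  define Y :: "real \<Rightarrow> config" where "Y e = (\<chi> r. if r = 1 then P e else Xe$r)" for e
  have Y: "Y e $ 1 = P e" "Y e $ 2 = Xe$2" "Y e $ 3 = Xe$3" for e by (simp_all add: Y_def)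
  \<comment> \<open>The exact effect of this normalisation on the differences, satisfying e \<delta>
    = \<kappa> (1 - n). It tends to 0, so the sign obtained for (x, y, - x - y) persists.\<close>
  define \<delta> where "\<delta> e = \<kappa> * e * q / (1 + n e)" for e
  have "((\<lambda>e. 1 - e\<^sup>2 * q) \<longlongrightarrow> 1 - 0\<^sup>2 * q) (at 0)" by (intro tendsto_intros)
  then have n1: "((\<lambda>e. 1 - e\<^sup>2 * q) \<longlongrightarrow> 1) (at 0)" by simp
  have nlim: "(n \<longlongrightarrow> 1) (at 0)" unfolding n_def using tendsto_real_sqrt[OF n1] by simp
  have "(P \<longlongrightarrow> (1 / 1) *\<^sub>R (Xe$1 + 0 *\<^sub>R v)) (at 0)"
    unfolding P_def by (intro tendsto_intros nlim) simp
  then have Plim: "(P \<longlongrightarrow> Xe$1) (at 0)" by simp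
  have Ylim: "(Y \<longlongrightarrow> Xe) (at 0)"
  proof (rule vec_tendstoI)
    show "((\<lambda>e. Y e $ r) \<longlongrightarrow> Xe $ r) (at 0)" for r
      by (cases "r = 1") (simp_all add: Y_def Plim)
  qed
  have "(\<delta> \<longlongrightarrow> \<kappa> * 0 * q / (1 + 1)) (at 0)"
    unfolding \<delta>_def by (intro tendsto_intros nlim) simp
  then have \<delta>lim: "(\<delta> \<longlongrightarrow> 0) (at 0)" by simp
  have "((\<lambda>e. \<sigma> * gap_form \<Gamma> x (y + \<delta> e) (- \<beta> - \<delta> e)) \<longlongrightarrow> \<sigma> * gap_form \<Gamma> x (y + 0) (- \<beta> - 0)) (at 0)"
    unfolding gap_form_def by (intro tendsto_intros \<delta>lim)
  then have "\<forall>\<^sub>F e in at 0. \<sigma> * gap_form \<Gamma> x (y + \<delta> e) (- \<beta> - \<delta> e) > 0"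
    by (rule order_tendstoD(1)) (use xy in \<open>simp add: \<beta>_def\<close>)
  moreover have "\<forall>\<^sub>F e in at 0. 1 - e\<^sup>2 * q > 0" by (rule order_tendstoD(1)[OF n1]) simp
  moreover have "\<forall>\<^sub>F e in at 0. P e $ 3 > 0"
    by (rule order_tendstoD(1)[OF tendsto_vec_nth[OF Plim]])
      (use Xe(1) in \<open>simp add: phase_space_def hyp_plane_iff\<close>)
  moreover have "\<forall>\<^sub>F e in at 0. \<forall>i\<in>UNIV. shape (Y e) $ i > 1"
  proof (rule eventually_ball_finite, simp, intro ballI)
    fix i
    have "continuous_on UNIV (\<lambda>X. shape X $ i)" by (intro continuous_intros)
    then have "((\<lambda>e. shape (Y e) $ i) \<longlongrightarrow> shape Xe $ i) (at 0)"
      by (rule continuous_on_tendsto_compose[OF _ Ylim]) auto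
    then show "\<forall>\<^sub>F e in at 0. shape (Y e) $ i > 1"
      by (rule order_tendstoD(1)) (rule shape_gt_one[OF Xe(1)])
  qed
  moreover obtain W where W: "open W" "U = phase_space \<inter> W" using U(1) by (auto simp: openin_open)
  moreover have "\<forall>\<^sub>F e in at 0. Y e \<in> W"
    by (rule topological_tendstoD[OF Ylim W(1)]) (use U(2) W(2) in auto)
  moreover have "\<forall>\<^sub>F e in at 0. e \<noteq> (0::real)" by (rule eventually_neq_at_within)
  ultimately have "\<forall>\<^sub>F e in at 0. \<sigma> * gap_form \<Gamma> x (y + \<delta> e) (- \<beta> - \<delta> e) > 0 \<and> 1 - e\<^sup>2 * q > 0 \<and>
     P e $ 3 > 0 \<and> (\<forall>i\<in>UNIV. shape (Y e) $ i > 1) \<and> Y e \<in> W \<and> e \<noteq> 0"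
    by (intro eventually_conj)
  then obtain e where e: "\<sigma> * gap_form \<Gamma> x (y + \<delta> e) (- \<beta> - \<delta> e) > 0" "1 - e\<^sup>2 * q > 0"
     "P e $ 3 > 0" "\<forall>i\<in>UNIV. shape (Y e) $ i > 1" "Y e \<in> W" "e \<noteq> 0"
    using eventually_happens'[OF at_neq_bot] by blast
  have n: "n e > 0" "(n e)\<^sup>2 = 1 - e\<^sup>2 * q" using e(2) by (simp_all add: n_def)
  have XX: "hyp_inner (Xe$r) (Xe$r) = -1" for r using Xe(1) by (simp add: phase_space_def hyp_plane_iff)
  have "hyp_inner (P e) (P e) = (e\<^sup>2 * q - 1) / (n e)\<^sup>2"
    unfolding P_def using v(1) XX[of 1] hyp_inner_commute[of "Xe$1" v]
    by (simp add: hyp_inner_simps q_def power2_eq_square diff_divide_distrib)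
  also have "\<dots> = -1" using n e(2) by (simp add: divide_simps)
  finally have "P e \<in> hyp_plane" using e(3) by (simp add: hyp_plane_iff)
  then have "Y e $ r \<in> hyp_plane" for r
    using phase_space_hyp_plane[OF Xe(1), of r] by (simp add: Y_def)
  then have "Y e \<in> phase_space" by (rule phase_space_shape) (use e(4) in blast)
  then have YU: "Y e \<in> U" using W(2) e(5) by blast
  have se: "hyp_inner (Xe$2) (Xe$3) = - \<kappa>" "hyp_inner (Xe$3) (Xe$1) = - \<kappa>" "hyp_inner (Xe$1) (Xe$2) = - \<kappa>"
    using Xe(2) by (auto simp: vec_eq_iff forall_3)
  have s: "shape (Y e) $ 1 = \<kappa>" "shape (Y e) $ 2 = (\<kappa> + e * \<beta>) / n e" "shape (Y e) $ 3 = (\<kappa> + e * y) / n e"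
    using v(2,3) se hyp_inner_commute[of "Xe$3" v] n(1)
    by (simp_all add: Y P_def hyp_inner_simps field_simps)
  have \<delta>: "e * \<delta> e = \<kappa> * (1 - n e)"
  proof -
    have "e * \<delta> e = \<kappa> * (1 - (n e)\<^sup>2) / (1 + n e)" unfolding n(2) by (simp add: \<delta>_def power2_eq_square)
    also have "1 - (n e)\<^sup>2 = (1 - n e) * (1 + n e)" by (simp add: power2_eq_square algebra_simps)
    finally show ?thesis using n(1) by simp
  qed
  have "shape (Y e) $ 2 - shape (Y e) $ 3 = e / n e * x"
    "shape (Y e) $ 3 - shape (Y e) $ 1 = e / n e * (y + \<delta> e)"
    "shape (Y e) $ 1 - shape (Y e) $ 2 = e / n e * (- \<beta> - \<delta> e)"
    unfolding s using n(1) \<delta> by (simp_all add: \<beta>_def field_simps)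
  then have "\<sigma> * shape_gap \<Gamma> (shape (Y e)) = (e / n e)\<^sup>2 * (\<sigma> * gap_form \<Gamma> x (y + \<delta> e) (- \<beta> - \<delta> e))"
    unfolding shape_gap_def by (simp only: gap_form_scale mult.left_commute)
  also have "\<dots> > 0" by (rule mult_pos_pos[OF _ e(1)]) (use e(6) n(1) in simp)
  finally show ?thesis using that YU by blast
qed

section \<open>Instability for negative \<open>sigma2\<close>\<close>

lemma equilateral_unstable:
  assumes Xe: "Xe \<in> phase_space" "shape Xe = vec \<kappa>" and \<kappa>: "\<kappa> > 1" and S: "sigma2 \<Gamma> < 0"
  shows "G_unstable \<Gamma> SL2 Xe"
  unfolding G_unstable_def
proof
  assume stable: "G_stable \<Gamma> SL2 Xe"
  define m where "m = rate_deriv \<kappa>"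
  define g where "g = \<bar>\<Gamma> 1\<bar> + \<bar>\<Gamma> 2\<bar> + \<bar>\<Gamma> 3\<bar>"
  \<comment> \<open>Makes the error 12 g^2 \<eta> |d|^2 of \<open>gap_form_growth\<close> exactly
    half of the main term |m| |\<open>sigma2 \<Gamma>\<close>| |d|^2.\<close>
  define \<eta> where "\<eta> = \<bar>m\<bar> * \<bar>sigma2 \<Gamma>\<bar> / (24 * g\<^sup>2)"
  have m: "m < 0" using rate_deriv_neg[OF \<kappa>] by (simp add: m_def)
  have "g \<noteq> 0"
  proof
    assume "g = 0"
    then have "\<Gamma> 1 = 0" "\<Gamma> 2 = 0" "\<Gamma> 3 = 0" by (simp_all add: g_def add_nonneg_eq_0_iff)
    then show False using S by (simp add: sigma2_def)
  qed
  then have g: "g > 0" by (simp add: g_def order_less_le)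
  have \<eta>: "\<eta> > 0" unfolding \<eta>_def using m S g by (intro divide_pos_pos mult_pos_pos) auto
  obtain r where r: "r > 0" "r < \<kappa> - 1" "\<And>x. \<bar>x - \<kappa>\<bar> \<le> r \<Longrightarrow> \<bar>rate_deriv x - m\<bar> < \<eta>"
    using rate_deriv_near[OF \<kappa> \<eta>] unfolding m_def by blast
  obtain rg where rg: "rg > 0"
    "\<And>s :: real^3. norm (s - vec \<kappa>) < rg \<Longrightarrow> gram (s$1) (s$2) (s$3) > gram \<kappa> \<kappa> \<kappa> / 4" "gram \<kappa> \<kappa> \<kappa> > 0"
    using vol_nonzero_near[OF \<kappa>] by blast
  define \<rho> where "\<rho> = min (min r rg) ((\<kappa> - 1) / 4)"
  have "\<rho> > 0" "\<rho> \<le> r" "\<rho> \<le> rg" "\<rho> \<le> (\<kappa> - 1) / 4"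
    using r(1) rg(1) \<kappa> min.cobounded2[of "min r rg" "(\<kappa> - 1) / 4"] by (simp_all only: \<rho>_def) auto
  then have \<rho>: "\<rho> > 0" "\<kappa> - 2 * \<rho> > 1" "\<rho> \<le> r" "\<rho> \<le> rg" using \<kappa> by auto
  define v0 where "v0 = sqrt (gram \<kappa> \<kappa> \<kappa> / 4)"
  have v0: "v0 > 0" using rg(3) by (simp add: v0_def)
  have volXe: "vol Xe \<noteq> 0" using vol_sq[OF Xe(1)] rg(3) unfolding Xe(2) by auto
  \<comment> \<open>The form d . R d changes in the direction of m times the volume, and m is
    negative; this sign makes the gap increase.\<close>
  define \<sigma> where "\<sigma> = - sgn (vol Xe)"
  have \<sigma>: "\<sigma> \<noteq> 0" "\<bar>\<sigma>\<bar> = 1" using volXe by (simp_all add: \<sigma>_def abs_sgn_eq sgn_zero_iff)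
  \<comment> \<open>The growth is at least v0 / \<pi> times half the main term, and the gap is at
    most 3 g |d|^2; their quotient is \<omega>.\<close>
  define \<omega> where "\<omega> = v0 * \<bar>m\<bar> * \<bar>sigma2 \<Gamma>\<bar> / (6 * pi * g)"
  have \<omega>: "\<omega> > 0" unfolding \<omega>_def using v0 m S g by (intro divide_pos_pos mult_pos_pos) auto
  \<comment> \<open>Shape and oriented volume are invariant under all of SL(2), so confining them
    gives an admissible neighbourhood; an escape of the shape is not undone by any motion of the
    plane.\<close>
  define V where "V = {Y \<in> phase_space. norm (shape Y - vec \<kappa>) < \<rho> \<and> vol Y * vol Xe > 0}"
  have nbhd: "invariant_open_nbhd SL2 Xe V"
    unfolding invariant_open_nbhd_def
  proof (intro conjI ballI)
    have "openin (top_of_set phase_space) ({Y \<in> phase_space. norm (shape Y - vec \<kappa>) < \<rho>} \<inter>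
        {Y \<in> phase_space. vol Y * vol Xe > 0})"
      by (intro openin_Int openin_less_real openin_greater_real continuous_intros)
    moreover have "\<dots> = V" by (auto simp: V_def)
    ultimately show "openin (top_of_set phase_space) V" by (simp only:)
    show "Xe \<in> V" using Xe \<rho>(1) volXe by (auto simp: V_def zero_less_mult_iff linorder_neq_iff)
    show "sl2_act_config g Y \<in> V" if "g \<in> SL2" "Y \<in> V" for g Y
      using that by (simp add: V_def sl2_act_config_invariants sl2_act_config_phase_space)
  qed
  obtain U where U: "invariant_open_nbhd SL2 Xe U"
    "\<And>I X s t. trajectory \<Gamma> I X \<Longrightarrow> s \<in> I \<Longrightarrow> X s \<in> U \<Longrightarrow> t \<in> I \<Longrightarrow> X t \<in> V"
    using stable nbhd unfolding G_stable_def by blast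
  have near: "\<bar>shape Y $ i - \<kappa>\<bar> < \<rho>" if "Y \<in> V" for Y i
    using component_le_norm_cart[of "shape Y - vec \<kappa>" i] that by (simp add: V_def del: shape_nth)
  define gap where "gap Y = \<sigma> * shape_gap \<Gamma> (shape Y)" for Y
  define nsq :: "real^3 \<Rightarrow> real" where "nsq s = (s$2 - s$3)\<^sup>2 + (s$3 - s$1)\<^sup>2 + (s$1 - s$2)\<^sup>2" for s
  have gap_le: "gap Y \<le> 3 * g * nsq (shape Y)" for Y
  proof -
    have "gap Y \<le> \<bar>shape_gap \<Gamma> (shape Y)\<bar>"
      using abs_ge_self[of "gap Y"] \<sigma>(2) by (simp add: gap_def abs_mult)
    also have "\<dots> \<le> 3 * g * nsq (shape Y)"
      unfolding shape_gap_def g_def nsq_def by (rule gap_form_bound)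
    finally show ?thesis .
  qed
  have bounded: "gap Y \<le> 36 * g * \<rho>\<^sup>2" if "Y \<in> V" for Y
  proof -
    have "(shape Y $ i - shape Y $ j)\<^sup>2 \<le> (2 * \<rho>)\<^sup>2" for i j
      by (subst abs_le_square_iff[symmetric]) (use near[OF that, of i] near[OF that, of j] in linarith)
    from this[of 2 3] this[of 3 1] this[of 1 2] have "nsq (shape Y) \<le> 12 * \<rho>\<^sup>2"
      by (simp add: nsq_def del: shape_nth)
    then have "3 * g * nsq (shape Y) \<le> 3 * g * (12 * \<rho>\<^sup>2)" using g by (intro mult_left_mono) auto
    then show ?thesis using gap_le[of Y] by simp
  qed
  have growth: "\<exists>D. ((\<lambda>t. gap (X t)) has_real_derivative D) (at t) \<and> D \<ge> \<omega> * gap (X t)"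
    if X: "(X has_vector_derivative vortex_field \<Gamma> (X t)) (at t)" and XV: "X t \<in> V" for X t
  proof -
    let ?s = "shape (X t)" and ?v = "vol (X t)"
    let ?f = "\<lambda>i. rate (?s $ i)"
    define f1 where "f1 = \<Gamma> 2 * (?f 3 - ?f 1) - \<Gamma> 3 * (?f 1 - ?f 2)"
    define f2 where "f2 = \<Gamma> 3 * (?f 1 - ?f 2) - \<Gamma> 1 * (?f 2 - ?f 3)"
    define f3 where "f3 = \<Gamma> 1 * (?f 2 - ?f 3) - \<Gamma> 2 * (?f 3 - ?f 1)"
    define q1 where "q1 = \<Gamma> 2 * (?s$3 - ?s$1) - \<Gamma> 3 * (?s$1 - ?s$2)"
    define q2 where "q2 = \<Gamma> 3 * (?s$1 - ?s$2) - \<Gamma> 1 * (?s$2 - ?s$3)"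
    define q3 where "q3 = \<Gamma> 1 * (?s$2 - ?s$3) - \<Gamma> 2 * (?s$3 - ?s$1)"
    define E where "E = f1 * q1 + f2 * q2 + f3 * q3
      + ((?s$2 - ?s$3) * (\<Gamma> 2 * f2 - \<Gamma> 3 * f3) + (?s$3 - ?s$1) * (\<Gamma> 3 * f3 - \<Gamma> 1 * f1)
      + (?s$1 - ?s$2) * (\<Gamma> 1 * f1 - \<Gamma> 2 * f2))"
    have der: "((\<lambda>t. shape_gap \<Gamma> (shape (X t))) has_real_derivative ?v / pi * E) (at t)"
      using shape_gap_derivative[OF X] unfolding E_def f1_def f2_def f3_def q1_def q2_def q3_def .
    define k where "k = \<bar>m\<bar> * \<bar>sigma2 \<Gamma>\<bar> * nsq ?s"
    have k: "m * (sigma2 \<Gamma> * nsq ?s) = k" using m S by (simp add: k_def)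
    have near_r: "\<bar>?s $ i - \<kappa>\<bar> \<le> r" for i using near[OF XV, of i] \<rho>(3) by linarith
    have sec: "\<bar>(?f i - ?f j) - m * (?s$i - ?s$j)\<bar> \<le> \<eta> * \<bar>?s$i - ?s$j\<bar>" for i j
      by (rule rate_secant[OF r(2,3) near_r near_r])
    have "\<bar>E - m * (q1\<^sup>2 + q2\<^sup>2 + q3\<^sup>2 - sigma2 \<Gamma> * nsq ?s)\<bar> \<le> 12 * g\<^sup>2 * \<eta> * nsq ?s"
      unfolding E_def f1_def f2_def f3_def q1_def q2_def q3_def g_def nsq_def
      by (rule gap_form_growth[OF _ less_imp_le[OF \<eta>] sec sec sec]) simp
    also have "12 * g\<^sup>2 * \<eta> = \<bar>m\<bar> * \<bar>sigma2 \<Gamma>\<bar> / 2" using g by (simp add: \<eta>_def)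
    also have "\<bar>m\<bar> * \<bar>sigma2 \<Gamma>\<bar> / 2 * nsq ?s = k / 2" by (simp add: k_def)
    finally have "\<bar>E - (m * (q1\<^sup>2 + q2\<^sup>2 + q3\<^sup>2) - k)\<bar> \<le> k / 2"
      unfolding right_diff_distrib k .
    \<comment> \<open>The contribution of |R d|^2 acts in the same direction as the main term and is
      dropped.\<close>
    moreover have "m * (q1\<^sup>2 + q2\<^sup>2 + q3\<^sup>2) \<le> 0" using m by (simp add: mult_nonpos_nonneg)
    ultimately have "k / 2 \<le> - E" by (simp only: abs_le_iff) linarith
    then have E: "\<bar>m\<bar> * \<bar>sigma2 \<Gamma>\<bar> / 2 * nsq ?s \<le> - E" by (simp add: k_def)
    have nn: "nsq ?s \<ge> 0" by (simp add: nsq_def)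
    have X0: "X t \<in> phase_space" "?v * vol Xe > 0" using XV by (auto simp: V_def)
    have "?v\<^sup>2 \<ge> v0\<^sup>2"
      using vol_sq[OF X0(1)] rg(2)[of ?s] XV \<rho>(4) rg(3) by (auto simp: V_def v0_def)
    then have vb: "\<bar>?v\<bar> \<ge> v0" using v0 by (simp add: abs_le_square_iff[symmetric])
    have \<sigma>v: "\<sigma> * ?v = - \<bar>?v\<bar>"
      using X0(2) by (auto simp: \<sigma>_def zero_less_mult_iff sgn_if)
    have "\<omega> * gap (X t) \<le> \<omega> * (3 * g * nsq ?s)"
      using gap_le[of "X t"] \<omega> by (intro mult_left_mono) auto
    also have "\<dots> = v0 / pi * (\<bar>m\<bar> * \<bar>sigma2 \<Gamma>\<bar> / 2 * nsq ?s)" using g by (simp add: \<omega>_def)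
    also have "\<dots> \<le> \<bar>?v\<bar> / pi * (\<bar>m\<bar> * \<bar>sigma2 \<Gamma>\<bar> / 2 * nsq ?s)"
      using vb nn by (intro mult_right_mono divide_right_mono) auto
    also have "\<dots> \<le> \<bar>?v\<bar> / pi * (- E)" using E by (intro mult_left_mono) auto
    also have "\<dots> = \<sigma> * (?v / pi * E)"
    proof -
      have "\<sigma> * (?v / pi * E) = \<sigma> * ?v / pi * E" by simp
      then show ?thesis unfolding \<sigma>v by simp
    qed
    finally have "\<omega> * gap (X t) \<le> \<sigma> * (?v / pi * E)" .
    moreover have "((\<lambda>t. gap (X t)) has_real_derivative \<sigma> * (?v / pi * E)) (at t)"
      unfolding gap_def by (rule DERIV_cmult[OF der])
    ultimately show ?thesis by blast
  qed
  obtain x y where xy: "\<sigma> * gap_form \<Gamma> x y (- x - y) > 0"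
    using gap_form_indefinite[OF S \<sigma>(1)] by blast
  have UV: "openin (top_of_set phase_space) (U \<inter> V)" "Xe \<in> U \<inter> V"
    using U(1) nbhd by (auto simp: invariant_open_nbhd_def)
  obtain Y0 where Y0: "Y0 \<in> U \<inter> V" "gap Y0 > 0"
    using gap_perturbation[OF Xe volXe UV xy] unfolding gap_def by blast
  \<comment> \<open>Already \<omega> T times the initial gap equals the bound on the gap in
    \<open>V\<close>, so exp (\<omega> T) > \<omega> T gives the contradiction at time T. The
    trajectory is built up to T + 1 so that T is an interior time.\<close>
  define T where "T = 36 * g * \<rho>\<^sup>2 / (gap Y0 * \<omega>)"
  have T: "T > 0" unfolding T_def using g \<rho>(1) Y0(2) \<omega> by (intro divide_pos_pos mult_pos_pos) auto
  have Uo: "openin (top_of_set phase_space) U" using U(1) by (simp add: invariant_open_nbhd_def)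
  have lb: "shape Y $ i \<ge> \<kappa> - \<rho>" if "Y \<in> V" for Y i using near[OF that, of i] by linarith
  have "\<exists>X. X 0 = Y0 \<and> continuous_on {0..T + 1} X \<and> trajectory \<Gamma> {0<..<T + 1} X \<and>
    (\<forall>t\<in>{0<..<T + 1}. X t \<in> V)"
  proof (rule confined_trajectory[of \<kappa> \<rho> "T + 1" V U Y0 \<Gamma>])
    show "T + 1 > 0" using T by simp
    show "Y0 \<in> U" "Y0 \<in> V" using Y0(1) by simp_all
    show "shape Y $ i \<ge> \<kappa> - \<rho>" if "Y \<in> V" for Y i by (rule lb[OF that])
    show "X t \<in> V" if "trajectory \<Gamma> I X" "s \<in> I" "X s \<in> U" "t \<in> I" for I X s t
      by (rule U(2)[OF that])
    show "\<exists>X. X 0 = Y0 \<and> continuous_on {0..T + 1} X \<and> trajectory \<Gamma> {0<..<T + 1} X \<and>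
        (\<forall>t\<in>{0<..<T + 1}. X t \<in> V)"
      if "X 0 = Y0" "continuous_on {0..T + 1} X" "trajectory \<Gamma> {0<..<T + 1} X"
        "\<And>t. t \<in> {0<..<T + 1} \<Longrightarrow> X t \<in> V" for X
      using that by blast
  qed (fact \<kappa> \<rho> Uo)+
  then obtain X where X: "X 0 = Y0" "continuous_on {0..T + 1} X" "trajectory \<Gamma> {0<..<T + 1} X"
    "\<And>t. t \<in> {0<..<T + 1} \<Longrightarrow> X t \<in> V"
    by blast
  have "- gap (X T) \<le> - gap (X 0) * exp (\<omega> * T)"
  proof (rule gronwall[where f = "\<lambda>t. - gap (X t)"])
    have cont: "continuous_on {0..T} X" by (rule continuous_on_subset[OF X(2)]) auto
    show "continuous_on {0..T} (\<lambda>t. - gap (X t))"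
      unfolding gap_def shape_gap_def gap_form_def by (intro continuous_intros cont)
    fix s assume s: "0 < s" "s < T"
    then have "s \<in> {0<..<T + 1}" by auto
    then obtain D where D: "((\<lambda>t. gap (X t)) has_real_derivative D) (at s)" "D \<ge> \<omega> * gap (X s)"
      using growth[OF trajectoryD(2)[OF X(3)] X(4)] by blast
    show "\<exists>D. ((\<lambda>t. - gap (X t)) has_real_derivative D) (at s) \<and> D \<le> \<omega> * - gap (X s)"
      using DERIV_minus[OF D(1)] D(2) by (intro exI[of _ "- D"]) simp
  qed (use T in simp)
  then have "gap Y0 * exp (\<omega> * T) \<le> gap (X T)" by (simp add: X(1))
  moreover have "gap (X T) \<le> 36 * g * \<rho>\<^sup>2" by (rule bounded[OF X(4)]) (use T in simp)
  moreover have "36 * g * \<rho>\<^sup>2 = gap Y0 * (\<omega> * T)" using Y0(2) \<omega> by (simp add: T_def)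
  moreover have "gap Y0 * (\<omega> * T) < gap Y0 * exp (\<omega> * T)"
  proof (rule mult_strict_left_mono[OF _ Y0(2)])
    show "\<omega> * T < exp (\<omega> * T)" using exp_ge_add_one_self[of "\<omega> * T"] by linarith
  qed
  ultimately show False by linarith
qed

lemma sum_pairs_sigma2: "(\<Sum>i\<in>UNIV. \<Sum>j\<in>UNIV - {i}. \<Gamma> i * \<Gamma> j) = 2 * sigma2 \<Gamma>" for \<Gamma> :: "3 \<Rightarrow> real"
  by (simp add: sum_3 UNIV_3_diff sigma2_def)

theorem theorem11:
  fixes \<Gamma> :: "3 \<Rightarrow> real" and Xe :: config and \<mu> :: "real^3"
  assumes "Xe \<in> phase_space"
    and "equilateral Xe"
    and "\<And>r. \<Gamma> r \<noteq> 0"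
    and "\<mu> = momentum \<Gamma> Xe"
  shows "((\<Sum>i\<in>UNIV. \<Sum>j\<in>UNIV - {i}. \<Gamma> i * \<Gamma> j) > 0 \<longrightarrow> G_stable \<Gamma> (isotropy \<mu>) Xe) \<and>
         ((\<Sum>i\<in>UNIV. \<Sum>j\<in>UNIV - {i}. \<Gamma> i * \<Gamma> j) < 0 \<longrightarrow> G_unstable \<Gamma> SL2 Xe)"
proof -
  obtain \<kappa> where "\<kappa> > 1" "shape Xe = vec \<kappa>"
    using equilateral_shape[OF assms(1,2)] by blast
  then show ?thesis
    unfolding sum_pairs_sigma2
    using equilateral_stable[OF assms(1) _ _ assms(3) _ assms(4)] equilateral_unstable[OF assms(1)]
    by simp
qed

end
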